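(* Let $p\in\{1,\dots,r\}$, let $\varpi\in\mathrm{Aut}(\Gamma)$ and put $q=\varpi p$; let $P$ and $Q$ be the maximal parabolic subgroups of $G$ corresponding to $\alpha_p$ and $\alpha_q$. Then for every $T\in V$, as identities of meromorphic functions of $s\in\mathbb{C}$, $$\xi^{G/P}_{\mathbb{Q};o}(-c_p-s;\varpi_0T)=\xi^{G/P}_{\mathbb{Q};o}(s;T)=\xi^{G/Q}_{\mathbb{Q};o}(s;\varpi T).$$
   Context: **Root systems.** $G$ is a semisimple algebraic group of rank $r$ over $\mathbb{Q}$ with root system $\Phi$; everything below depends only on $\Phi$, $\Delta$ and the index $p$. $V$ is an $r$-dimensional real vector space with inner product $\langle\cdot,\cdot\rangle$ (extended bilinearly to $V\otimes\mathbb{C}$), $\Phi\subset V$ a (reduced, crystallographic) root system of rank $r$, $\Delta=\{\alpha_1,\dots,\alpha_r\}$ a fundamental system, $\Phi_+$ the corresponding positive system, $\Phi_-=-\Phi_+$, $\alpha^\vee=2\alpha/\langle\alpha,\alpha\rangle$, and $\lambda_1,\dots,\lambda_r$ the fundamental weights, $\langle\alpha_i^\vee,\lambda_j\rangle=\delta_{ij}$. $\rho=\frac12\sum_{\alpha\in\Phi_+}\alpha=\sum_j\lambda_j$ and $\mathrm{ht}\,\alpha^\vee=\langle\rho,\alpha^\vee\rangle$. $W$ is the Weyl group, $w_0$ its longest element, and $\Phi_w=\Phi_+\cap w^{-1}\Phi_-$ for $w\in W$. $\Gamma$ is the Dynkin diagram of $\Phi$; $\mathrm{Aut}(\Gamma)$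 is regarded as a group of permutations of the indices $\{1,\dots,r\}$ and acts on $V$ by linear automorphisms with $\varpi\alpha_i=\alpha_{\varpi i}$ preserving $\Phi$ and the inner product. $\varpi_0\in\mathrm{Aut}(\Gamma)$ is the element with $-\mathrm{id}_V=\varpi_0w_0$. For $1\le p\le r$: the maximal parabolic subgroup $P$ corresponds to $\alpha_p$; $\Delta_p=\Delta\setminus\{\alpha_p\}$; $\Phi_p=\{\alpha\in\Phi:\langle\lambda_p,\alpha\rangle=0\}$; $\Phi_{p+}=\Phi_p\cap\Phi_+$; $\rho_p=\frac12\sum_{\alpha\in\Phi_{p+}}\alpha$; $c_p=2\langle\lambda_p-\rho_p,\alpha_p^\vee\rangle$. **Periods.** $\xi(s)=\pi^{-s/2}\Gamma(s/2)\zeta(s)$ with $\zeta$ the Riemann zeta function. For $\lambda,T$, $$\omega^G_{\mathbb{Q}}(\lambda;T)=\sum_{w\in W}e^{\langle w\lambda-\rho,T\rangle}\Bigl(\prod_{\alpha\in\Delta}\frac{1}{\langle w\lambda-\rho,\alpha^\vee\rangle}\Bigr)\Bigl(\prod_{\alpha\in\Phi_w}\frac{\xi(\langle\lambda,\alpha^\vee\rangle)}{\xi(\langle\lambda,\alpha^\vee\rangle+1)}\Bigr).$$ Writing $\lambda=\rho+\sum_k s_k\lambda_k$ with complex coordinates $s_k=\langle\lambda-\rho,\alpha_k^\vee\rangle$ and $s=s_p$, $\omega^{G/P}_{\mathbb{Q}}(s;T)$ is the iterated residue of $\omega^G_{\mathbb{Q}}(\lambda;T)$ at $s_k=0$ for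 all $k\ne p$. Taken term by term, it is a sum over those $w\in W$ with $\Delta_p\subset w^{-1}(\Delta\cup\Phi_-)$ (call these admissible for $p$), the $w$-term being $$e^{\langle w(\rho+s\lambda_p)-\rho,T\rangle}\Bigl(\prod_{\alpha\in(w^{-1}\Delta)\setminus\Delta_p}\frac{1}{\langle\lambda_p,\alpha^\vee\rangle s+\mathrm{ht}\,\alpha^\vee-1}\Bigr)H_{p,w}(s),$$ $$H_{p,w}(s)=\prod_{\alpha\in\Phi_w\setminus\Delta_p}\xi(\langle\lambda_p,\alpha^\vee\rangle s+\mathrm{ht}\,\alpha^\vee)\prod_{\alpha\in\Phi_w}\frac{1}{\xi(\langle\lambda_p,\alpha^\vee\rangle s+\mathrm{ht}\,\alpha^\vee+1)}.$$ **Weng's zeta function.** $\xi^{G/P}_{\mathbb{Q};o}(s;T)$ is obtained from $\omega^{G/P}_{\mathbb{Q}}(s;T)$ by multiplying by the minimal product of $\xi$ functions cancelling all $\xi$-denominators. Precisely: after formal cancellation, $H_{p,w}(s)=\prod_{k\ge0,\,h\ge1}\xi(ks+h)^{e_{p,w}(k,h)}$ with $$e_{p,w}(k,h)=\sharp\{\alpha\in\Phi_w\setminus\Delta_p:\langle\lambda_p,\alpha^\vee\rangle=k,\ \mathrm{ht}\,\alpha^\vee=h\}-\sharp\{\alpha\in\Phi_w:\langle\lambda_p,\alpha^\vee\rangle=k,\ \mathrm{ht}\,\alpha^\vee=h-1\},$$ and $$\xi^{G/P}_{\mathbb{Q};o}(s;T)=\omega^{G/P}_{\mathbb{Q}}(s;T)\prod_{k\ge0,\,h\ge1}\xi(ks+h)^{m_p(k,h)},\qquad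 m_p(k,h)=\max_{w\text{ admissible for }p}\max(0,-e_{p,w}(k,h)),$$ a product with only finitely many nontrivial factors. The same definitions with $q$ in place of $p$ give $\xi^{G/Q}_{\mathbb{Q};o}$. *)

theory Defs
  imports "HOL-Complex_Analysis.Complex_Analysis" "HOL-Combinatorics.Permutations"
begin

subsection \<open>The completed Riemann zeta function\<close>

(* The analytic continuation of the Dirichlet series to the complement of 1.  It is unique by
   the identity theorem; the clause f 1 = 0 only fixes the junk value at the pole. *)
definition zeta :: "complex \<Rightarrow> complex" where
  "zeta = (THE f. f holomorphic_on (- {1}) \<and> f 1 = 0 \<and>
             (\<forall>s. Re s > 1 \<longrightarrow> (\<lambda>n. 1 / of_nat (Suc n) powr s) sums f s))"

(* At s = 0, 1 (poles) and at s = -2, -4, ... (where Gamma takes the junk value 0) the value is 0;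
   this is why identities below are stated as identities of meromorphic functions. *)
definition xi :: "complex \<Rightarrow> complex" where
  "xi s = of_real pi powr (- s / 2) * Gamma (s / 2) * zeta s"

(* Equality as meromorphic functions on the plane: both sides are meromorphic, and their values
   agree away from a set without accumulation points. *)
definition meromorphic_eq :: "(complex \<Rightarrow> complex) \<Rightarrow> (complex \<Rightarrow> complex) \<Rightarrow> bool" where
  "meromorphic_eq f g \<longleftrightarrow>
     f meromorphic_on UNIV \<and> g meromorphic_on UNIV \<and> (\<forall>\<^sub>\<approx>s\<in>UNIV. f s = g s)"

subsection \<open>Root systems\<close>

definition coroot :: "'v::euclidean_space \<Rightarrow> 'v" where
  "coroot a = (2 / (a \<bullet> a)) *\<^sub>R a"

definition refl :: "'v::euclidean_space \<Rightarrow> 'v \<Rightarrow> 'v" where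
  "refl a v = v - (coroot a \<bullet> v) *\<^sub>R a"

definition root_system :: "'v::euclidean_space set \<Rightarrow> bool" where
  "root_system \<Phi> \<longleftrightarrow>
     finite \<Phi> \<and> 0 \<notin> \<Phi> \<and> span \<Phi> = UNIV \<and>
     (\<forall>a\<in>\<Phi>. refl a ` \<Phi> = \<Phi>) \<and>
     (\<forall>a\<in>\<Phi>. \<forall>b\<in>\<Phi>. coroot a \<bullet> b \<in> \<int>) \<and>
     (\<forall>a\<in>\<Phi>. \<forall>c. c *\<^sub>R a \<in> \<Phi> \<longrightarrow> c = 1 \<or> c = -1)"

(* The simple roots are alpha_1, ..., alpha_r with r = DIM('v). *)
definition fundamental_system :: "'v::euclidean_space set \<Rightarrow> (nat \<Rightarrow> 'v) \<Rightarrow> bool" where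
  "fundamental_system \<Phi> \<alpha> \<longleftrightarrow>
     inj_on \<alpha> {1..DIM('v)} \<and> \<alpha> ` {1..DIM('v)} \<subseteq> \<Phi> \<and> independent (\<alpha> ` {1..DIM('v)}) \<and>
     (\<forall>b\<in>\<Phi>. \<exists>c :: nat \<Rightarrow> nat.
        b = (\<Sum>i=1..DIM('v). real (c i) *\<^sub>R \<alpha> i) \<or>
        b = - (\<Sum>i=1..DIM('v). real (c i) *\<^sub>R \<alpha> i))"

(* Elements of the complexification of V are pairs (x, y), standing for x + iy;
   this is the bilinear extension of the inner product, with a real second argument. *)
definition cpair :: "'v::euclidean_space \<times> 'v \<Rightarrow> 'v \<Rightarrow> complex" where
  "cpair z v = Complex (fst z \<bullet> v) (snd z \<bullet> v)"

(* Residues at 0 in the variables ks, taken successively, the head of the list first. *)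
primrec iterated_residue ::
  "nat list \<Rightarrow> ((nat \<Rightarrow> complex) \<Rightarrow> complex) \<Rightarrow> (nat \<Rightarrow> complex) \<Rightarrow> complex" where
  "iterated_residue [] f = f"
| "iterated_residue (k # ks) f =
     iterated_residue ks (\<lambda>s. residue (\<lambda>z. f (s(k := z))) 0)"

context
  fixes \<Phi> :: "'v::euclidean_space set" and \<alpha> :: "nat \<Rightarrow> 'v"
begin

definition simple_roots :: "'v set" where
  "simple_roots = \<alpha> ` {1..DIM('v)}"

definition positive_roots :: "'v set" where
  "positive_roots = {b\<in>\<Phi>. \<exists>c :: nat \<Rightarrow> nat. b = (\<Sum>i=1..DIM('v). real (c i) *\<^sub>R \<alpha> i)}"

definition negative_roots :: "'v set" where
  "negative_roots = uminus ` positive_roots"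

definition fundamental_weight :: "nat \<Rightarrow> 'v" where
  "fundamental_weight j =
     (THE v. \<forall>i\<in>{1..DIM('v)}. coroot (\<alpha> i) \<bullet> v = (if i = j then 1 else 0))"

definition rho :: 'v where
  "rho = (1 / 2) *\<^sub>R (\<Sum>a\<in>positive_roots. a)"

(* The height of the coroot of a, not of the root a. *)
definition coroot_height :: "'v \<Rightarrow> real" where
  "coroot_height a = rho \<bullet> coroot a"

inductive_set weyl_group :: "('v \<Rightarrow> 'v) set" where
  "id \<in> weyl_group"
| "a \<in> \<Phi> \<Longrightarrow> w \<in> weyl_group \<Longrightarrow> refl a \<circ> w \<in> weyl_group"

definition weyl_length :: "('v \<Rightarrow> 'v) \<Rightarrow> nat" where
  "weyl_length w = (LEAST n. \<exists>is. length is = n \<and> set is \<subseteq> {1..DIM('v)} \<and>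
                       w = foldr (\<lambda>i f. refl (\<alpha> i) \<circ> f) is id)"

definition longest_element :: "('v \<Rightarrow> 'v) \<Rightarrow> bool" where
  "longest_element w \<longleftrightarrow>
     w \<in> weyl_group \<and> (\<forall>u\<in>weyl_group. weyl_length u \<le> weyl_length w)"

(* Weyl group elements are bijections, so the inverse image is the image under the inverse. *)
definition inversions :: "('v \<Rightarrow> 'v) \<Rightarrow> 'v set" where
  "inversions w = positive_roots \<inter> w -` negative_roots"

(* The Dynkin diagram: number of edges between two vertices, and arrows, which sit on multiple
   edges and point from the longer root to the shorter one. *)
definition dynkin_edges :: "nat \<Rightarrow> nat \<Rightarrow> real" where
  "dynkin_edges i j =
     (if i = j then 0 else (coroot (\<alpha> i) \<bullet> \<alpha> j) * (coroot (\<alpha> j) \<bullet> \<alpha> i))"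

definition dynkin_arrow :: "nat \<Rightarrow> nat \<Rightarrow> bool" where
  "dynkin_arrow i j \<longleftrightarrow> dynkin_edges i j > 1 \<and> norm (\<alpha> i) > norm (\<alpha> j)"

definition diagram_auts :: "(nat \<Rightarrow> nat) set" where
  "diagram_auts = {\<sigma>. \<sigma> permutes {1..DIM('v)} \<and>
     (\<forall>i\<in>{1..DIM('v)}. \<forall>j\<in>{1..DIM('v)}.
        dynkin_edges (\<sigma> i) (\<sigma> j) = dynkin_edges i j \<and>
        (dynkin_arrow (\<sigma> i) (\<sigma> j) \<longleftrightarrow> dynkin_arrow i j))}"

definition diagram_action :: "(nat \<Rightarrow> nat) \<Rightarrow> 'v \<Rightarrow> 'v" where
  "diagram_action \<sigma> = (THE f. linear f \<and> (\<forall>i\<in>{1..DIM('v)}. f (\<alpha> i) = \<alpha> (\<sigma> i)))"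

definition parabolic_simple_roots :: "nat \<Rightarrow> 'v set" where
  "parabolic_simple_roots p = simple_roots - {\<alpha> p}"

definition parabolic_roots :: "nat \<Rightarrow> 'v set" where
  "parabolic_roots p = {a\<in>\<Phi>. fundamental_weight p \<bullet> a = 0}"

definition rho_parabolic :: "nat \<Rightarrow> 'v" where
  "rho_parabolic p = (1 / 2) *\<^sub>R (\<Sum>a\<in>parabolic_roots p \<inter> positive_roots. a)"

definition c_parabolic :: "nat \<Rightarrow> real" where
  "c_parabolic p = 2 * ((fundamental_weight p - rho_parabolic p) \<bullet> coroot (\<alpha> p))"

subsection \<open>Periods\<close>

definition omega_G :: "'v \<times> 'v \<Rightarrow> 'v \<Rightarrow> complex" where
  "omega_G l T = (\<Sum>w\<in>weyl_group.
     exp (cpair (map_prod w w l - (rho, 0)) T) *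
     (\<Prod>a\<in>simple_roots. 1 / cpair (map_prod w w l - (rho, 0)) (coroot a)) *
     (\<Prod>a\<in>inversions w. xi (cpair l (coroot a)) / xi (cpair l (coroot a) + 1)))"

(* The point rho + sum_k s_k lambda_k. *)
definition spectral_point :: "(nat \<Rightarrow> complex) \<Rightarrow> 'v \<times> 'v" where
  "spectral_point s =
     (rho + (\<Sum>k=1..DIM('v). Re (s k) *\<^sub>R fundamental_weight k),
      (\<Sum>k=1..DIM('v). Im (s k) *\<^sub>R fundamental_weight k))"

(* The residues are taken in increasing order of the index.  The order is immaterial: near
   s_k = 0 (k \<noteq> p) and for generic s_p, each term is singular only along the hyperplanes
   s_k = 0, with at most simple poles. *)
definition omega_GP :: "nat \<Rightarrow> complex \<Rightarrow> 'v \<Rightarrow> complex" where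
  "omega_GP p s T =
     iterated_residue (filter (\<lambda>k. k \<noteq> p) [1..<Suc DIM('v)])
       (\<lambda>t. omega_G (spectral_point t) T) ((\<lambda>_. 0)(p := s))"

subsection \<open>Weng's zeta function\<close>

definition admissible :: "nat \<Rightarrow> ('v \<Rightarrow> 'v) set" where
  "admissible p =
     {w\<in>weyl_group. parabolic_simple_roots p \<subseteq> w -` (simple_roots \<union> negative_roots)}"

(* The exponent of xi(k s + h) in the w-term of omega_GP after formal cancellation. *)
definition xi_exponent :: "nat \<Rightarrow> ('v \<Rightarrow> 'v) \<Rightarrow> nat \<Rightarrow> nat \<Rightarrow> int" where
  "xi_exponent p w k h =
     int (card {a \<in> inversions w - parabolic_simple_roots p.
                  fundamental_weight p \<bullet> coroot a = real k \<and> coroot_height a = real h}) -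
     int (card {a \<in> inversions w.
                  fundamental_weight p \<bullet> coroot a = real k \<and> coroot_height a = real h - 1})"

definition xi_multiplicity :: "nat \<Rightarrow> nat \<Rightarrow> nat \<Rightarrow> nat" where
  "xi_multiplicity p k h = nat (Max ((\<lambda>w. max 0 (- xi_exponent p w k h)) ` admissible p))"

definition xi_GP :: "nat \<Rightarrow> complex \<Rightarrow> 'v \<Rightarrow> complex" where
  "xi_GP p s T = omega_GP p s T *
     (\<Prod>(k, h) \<in> {(k, h). h \<ge> 1 \<and> xi_multiplicity p k h \<noteq> 0}.
        xi (of_nat k * s + of_nat h) ^ xi_multiplicity p k h)"

end

end

theory Submission
  imports Defs
begin

text \<open>Write \<open>\<lambda> = \<rho> + s \<lambda>\<^sub>p\<close> and \<open>s' = - c\<^sub>p - s\<close>. The pairing of \<open>\<lambda>\<^sub>p\<close> with the coroot of a root is called the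
level of the root, and the pairing of \<open>\<rho>\<close> with the coroot its height. The proof rests on three things: the functional
equation \<open>\<xi>(s) = \<xi>(1 - s)\<close>, the evaluation of the iterated residue as a finite sum over the
admissible elements of the Weyl group (\<open>omega_GP_eq\<close>), and a substitution \<open>w \<mapsto> w'\<close> in that sum.

\<^bold>\<open>The function \<open>\<xi>\<close>.\<close> The Mellin transform of \<open>1 / (exp x - 1)\<close>, with polar terms removed,
is holomorphic for \<open>Re s > -1\<close>. For real \<open>s > 1\<close> it is computed from the geometric series and
gives \<open>\<Gamma>(s) \<zeta>(s)\<close>; for real \<open>-1 < s < 0\<close> it is computed from the partial fractions of the
hyperbolic cotangent and gives a multiple of \<open>\<zeta>(1 - s)\<close>. In both cases all terms are positive, so
monotone convergence suffices, and the identity theorem does the rest.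

\<^bold>\<open>The residue.\<close> For generic \<open>s\<close>, each \<open>w\<close>-term of the period is, near \<open>s\<^sub>k = 0\<close> (\<open>k \<noteq> p\<close>), a
function that is holomorphic in each variable, times \<open>1 / s\<^sub>k\<close> for those \<open>k\<close> with
\<open>w \<alpha>\<^sub>k\<close> simple or negative. Hence only those \<open>w\<close> survive for which this holds for all \<open>k \<noteq> p\<close>,
which is admissibility (\<open>iterated_residue_sum\<close>, \<open>term_eq_regular_part\<close>).

\<^bold>\<open>Diagram automorphisms.\<close> An isometry \<open>h\<close> that permutes the simple roots preserves every ingredient,
so \<open>w \<mapsto> h w h\<^sup>-\<^sup>1\<close> matches the two sums term by term (\<open>xi_GP_diagram_isometry\<close>).

\<^bold>\<open>The functional equation.\<close> Let \<open>v\<close> be the longest element of the Weyl group of \<open>\<Phi>\<^sub>p\<close>. It fixes \<open>\<lambda>\<^sub>p\<close>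
and sends \<open>\<rho>\<close> to \<open>c\<^sub>p \<lambda>\<^sub>p - \<rho>\<close>, so \<open>v (\<rho> + s' \<lambda>\<^sub>p) = - (\<rho> + s \<lambda>\<^sub>p)\<close>. Put \<open>w' = w\<^sub>0\<^sup>-\<^sup>1 w v\<close>; here
\<open>w\<^sub>0\<^sup>-\<^sup>1 = - h\<close>, where \<open>h\<close> is the action of \<open>\<pi>0\<close>. The exponential and rational factors of the
\<open>w'\<close>-term at \<open>(s', h T)\<close> equal those of the \<open>w\<close>-term at \<open>(s, T)\<close>. Among the roots of \<open>\<Phi>\<^sub>p\<close>, the map
\<open>b \<mapsto> - v b\<close> carries the inversions of \<open>w'\<close> to those of \<open>w\<close>; among the other positive roots, \<open>v\<close> carries
the inversions of \<open>w'\<close> to the \<^emph>\<open>non\<close>-inversions of \<open>w\<close>. With \<open>\<xi>(s) = \<xi>(1 - s)\<close> the \<open>w'\<close>-term is therefore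
the \<open>w\<close>-term times a factor \<open>R(s)\<close>, a product over all positive roots outside \<open>\<Phi>\<^sub>p\<close>, which does not
depend on \<open>w\<close> (\<open>residue_term_twist\<close>).

\<^bold>\<open>The denominators.\<close> It remains to see that the normalizing product \<open>D\<close> satisfies \<open>D(s') R(s) = D(s)\<close>.
The same bijections of roots give, for \<open>k \<ge> 1\<close> and with \<open>N(k, m)\<close> the number of positive roots of level \<open>k\<close> and height
\<open>m\<close>, that \<open>e\<^sub>w\<^sub>'(k, k c\<^sub>p + 1 - m) = e\<^sub>w(k, m) + N(k, m - 1) - N(k, m)\<close>. The identity element is
admissible with all exponents 0, so the multiplicity of \<open>\<xi>(k s + m)\<close> is the maximum of \<open>- e\<^sub>w(k, m)\<close>
over the admissible \<open>w\<close>, and this maximum is shifted by the same amount (\<open>xi_multiplicity_reflected\<close>).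
This is exactly the change of exponents effected by \<open>R\<close>; the factors with \<open>k = 0\<close> are constant.\<close>

section \<open>Integrals depending holomorphically on a parameter\<close>

text \<open>Cauchy's inequality turns the dominating function into a bound for the difference quotients on a
ball of half the radius, so that differentiation under the integral sign is dominated convergence.\<close>
lemma holomorphic_on_dominated_integral:
  fixes f :: "complex \<Rightarrow> 'a \<Rightarrow> complex"
  assumes hol: "\<And>x. (\<lambda>s. f s x) holomorphic_on U" and U: "open U"
    and meas: "\<And>s. s \<in> U \<Longrightarrow> f s \<in> borel_measurable M"
    and dom: "\<And>s. s \<in> U \<Longrightarrow> \<exists>r>0. \<exists>G. integrable M G \<and> cball s r \<subseteq> U \<and>
                 (\<forall>z\<in>cball s r. \<forall>x. norm (f z x) \<le> (G x :: real))"
  shows "(\<lambda>s. \<integral>x. f s x \<partial>M) holomorphic_on U"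
proof -
  have "\<exists>D. ((\<lambda>s. \<integral>x. f s x \<partial>M) has_field_derivative D) (at s)" if s: "s \<in> U" for s
  proof -
    obtain r G where r: "r > 0" and G: "integrable M G" and sub: "cball s r \<subseteq> U"
      and bd: "\<And>z x. z \<in> cball s r \<Longrightarrow> norm (f z x) \<le> G x"
      using dom[OF s] by auto
    let ?B = "ball s (r/2)"
    have subB: "?B \<subseteq> cball s r" using r by auto
    have der: "((\<lambda>s. f s x) has_field_derivative deriv (\<lambda>s. f s x) z) (at z)" if "z \<in> U" for z x
      using hol U that by (meson holomorphic_derivI)
    have derbd: "norm (deriv (\<lambda>s. f s x) z) \<le> 2 * G x / r" if z: "z \<in> ?B" for z x
    proof -
      have sub2: "cball z (r/2) \<subseteq> cball s r"
      proof
        fix u assume "u \<in> cball z (r/2)"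
        with z show "u \<in> cball s r" using dist_triangle[of s u z] by (auto simp: dist_commute)
      qed
      have "norm ((deriv ^^ 1) (\<lambda>s. f s x) z) \<le> fact 1 * G x / (r/2) ^ 1"
      proof (rule Cauchy_inequality)
        show "(\<lambda>s. f s x) holomorphic_on ball z (r/2)"
          using holomorphic_on_subset[OF hol] sub sub2 ball_subset_cball by (meson subset_trans)
        show "continuous_on (cball z (r/2)) (\<lambda>s. f s x)"
          using holomorphic_on_imp_continuous_on[OF hol] sub sub2 continuous_on_subset by (metis subset_trans)
      next
        fix u assume "norm (z - u) = r/2"
        then have "u \<in> cball z (r/2)" by (simp add: dist_norm)
        then show "norm (f u x) \<le> G x" using sub2 bd by blast
      qed (use r in auto)
      then show ?thesis using r by (simp add: field_simps)
    qed
    have qbd: "norm ((f z x - f s x) / (z - s)) \<le> 2 * G x / r" if z: "z \<in> ?B" "z \<noteq> s" for z x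
    proof -
      have "norm (f z x - f s x) \<le> 2 * G x / r * norm (z - s)"
      proof (rule field_differentiable_bound[of ?B])
        show "((\<lambda>s. f s x) has_field_derivative deriv (\<lambda>s. f s x) u) (at u within ?B)" if "u \<in> ?B" for u
          using der[of u] that subB sub by (meson has_field_derivative_at_within subsetD)
      qed (use z r derbd in auto)
      then show ?thesis using z by (simp add: norm_divide field_simps)
    qed
    define D where "D = (\<integral>x. deriv (\<lambda>s. f s x) s \<partial>M)"
    have intf: "integrable M (f z)" if "z \<in> cball s r" for z
      by (rule Bochner_Integration.integrable_bound[OF G]) (use that bd meas sub in \<open>auto intro!: AE_I2 order_trans[OF bd abs_ge_self]\<close>)
    have "((\<lambda>z. ((\<integral>x. f z x \<partial>M) - (\<integral>x. f s x \<partial>M)) / (z - s)) \<longlongrightarrow> D) (at s within ?B)"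
      unfolding tendsto_at_iff_sequentially comp_def
    proof (intro allI impI)
      fix X :: "nat \<Rightarrow> complex"
      assume X: "\<forall>i. X i \<in> ?B - {s}" and lim: "X \<longlonglongrightarrow> s"
      have eq: "((\<integral>x. f (X i) x \<partial>M) - (\<integral>x. f s x \<partial>M)) / (X i - s) =
            (\<integral>x. (f (X i) x - f s x) / (X i - s) \<partial>M)" for i
      proof -
        have "integrable M (f (X i))" "integrable M (f s)"
          using X subB r by (auto intro!: intf)
        then show ?thesis by simp
      qed
      have ptw: "(\<lambda>i. (f (X i) x - f s x) / (X i - s)) \<longlonglongrightarrow> deriv (\<lambda>s. f s x) s" for x
      proof -
        have "((\<lambda>z. (f z x - f s x) / (z - s)) \<longlongrightarrow> deriv (\<lambda>s. f s x) s) (at s)"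
          using der[OF s, of x] by (simp add: has_field_derivative_iff)
        then show ?thesis
          using X lim by (auto simp: tendsto_at_iff_sequentially comp_def)
      qed
      have mq: "(\<lambda>x. (f (X i) x - f s x) / (X i - s)) \<in> borel_measurable M" for i
      proof -
        have "X i \<in> U" using X subB sub by blast
        then show ?thesis using meas[of "X i"] meas[OF s] by auto
      qed
      show "(\<lambda>i. ((\<integral>x. f (X i) x \<partial>M) - (\<integral>x. f s x \<partial>M)) / (X i - s)) \<longlonglongrightarrow> D"
        unfolding eq D_def
      proof (rule integral_dominated_convergence)
        show "(\<lambda>x. deriv (\<lambda>s. f s x) s) \<in> borel_measurable M"
          by (rule borel_measurable_LIMSEQ_metric[OF mq ptw])
        show "integrable M (\<lambda>x. 2 * G x / r)" using G by auto
      qed (use mq ptw qbd X in auto)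
    qed
    then have "((\<lambda>s. \<integral>x. f s x \<partial>M) has_field_derivative D) (at s)"
      using r by (simp add: has_field_derivative_iff at_within_open[of s ?B])
    then show ?thesis ..
  qed
  then show ?thesis
    using U by (auto simp: holomorphic_on_open)
qed

section \<open>The Mellin transform of the Bose kernel\<close>

text \<open>The Bose function \<open>1 / (exp x - 1)\<close> minus the first two terms of its expansion at 0.\<close>
definition bose_kernel :: "real \<Rightarrow> real" where
  "bose_kernel x = 1 / (exp x - 1) - 1 / x + 1 / 2"

text \<open>Euler's product for the sine, on the imaginary axis.\<close>
lemma sinh_product:
  fixes y :: real assumes "y > 0"
  shows "(\<lambda>n. \<Prod>k=1..n. 1 + y\<^sup>2 / real k ^ 2) \<longlonglongrightarrow> sinh (pi * y) / (pi * y)"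
proof -
  have "(\<lambda>n. of_real pi * (\<i> * of_real y) * (\<Prod>k=1..n. 1 - (\<i> * of_real y)^2 / of_nat k^2))
          \<longlonglongrightarrow> sin (of_real pi * (\<i> * of_real y))"
    by (rule sin_product_formula_complex)
  moreover have "sin (of_real pi * (\<i> * of_real y)) = \<i> * of_real (sinh (pi * y))"
  proof -
    have "sin (of_real pi * (\<i> * of_real y)) = - \<i> * sinh (- of_real (pi * y))"
      by (subst sin_conv_sinh) (simp add: mult.left_commute flip: mult.assoc)
    also have "\<dots> = \<i> * of_real (sinh (pi * y))"
      by (simp add: sinh_def exp_of_real[symmetric] exp_minus scaleR_conv_of_real algebra_simps del: exp_of_real)
    finally show ?thesis .
  qed
  moreover have "(\<lambda>n. of_real pi * (\<i> * of_real y) * (\<Prod>k=1..n. 1 - (\<i> * of_real y)^2 / of_nat k^2))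
       = (\<lambda>n. \<i> * of_real (pi * y * (\<Prod>k=1..n. 1 + y\<^sup>2 / real k ^ 2)))"
    by (simp add: power_mult_distrib mult_ac)
  ultimately have "(\<lambda>n. \<i> * complex_of_real (pi * y * (\<Prod>k=1..n. 1 + y\<^sup>2 / real k ^ 2))) \<longlonglongrightarrow> \<i> * of_real (sinh (pi * y))"
    by simp
  from tendsto_mult[OF tendsto_const[of "-\<i>"] this]
  have "(\<lambda>n. pi * y * (\<Prod>k=1..n. 1 + y\<^sup>2 / real k ^ 2)) \<longlonglongrightarrow> sinh (pi * y)"
    by (simp del: of_real_mult of_real_prod of_real_add flip: mult.assoc)
       (simp only: tendsto_of_real_iff)
  from tendsto_divide[OF this tendsto_const[of "pi * y"]] assms show ?thesis by simp
qed

lemma summable_inverse_two_pi_squares: "summable (\<lambda>n. 1 / (2 * pi * real (Suc n))\<^sup>2)"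
proof -
  have "summable (\<lambda>n. 1 / (2*pi)^2 * (1 / (real (Suc n))\<^sup>2))"
    using inverse_squares_sums by (intro summable_mult) (auto simp: sums_iff)
  then show ?thesis by (simp add: power_mult_distrib)
qed

text \<open>The partial fractions of the hyperbolic cotangent, obtained as the logarithmic derivative of the
product for \<open>sinh (x / 2)\<close>.\<close>
lemma bose_kernel_sums:
  assumes "x > 0"
  shows "(\<lambda>n. 2 * x / (x\<^sup>2 + (2 * pi * real (Suc n))\<^sup>2)) sums bose_kernel x"
proof -
  define f where "f = (\<lambda>n (x::real). ln (1 + x\<^sup>2 / (2 * pi * real (Suc n))\<^sup>2))"
  define f' where "f' = (\<lambda>n (x::real). 2 * x / (x\<^sup>2 + (2 * pi * real (Suc n))\<^sup>2))"
  define L where "L = (\<lambda>x::real. ln (sinh (x/2) / (x/2)))"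
  have fsums: "(\<lambda>n. f n y) sums L y" if y: "y > 0" for y
  proof -
    have "(\<lambda>n. \<Prod>k=1..n. 1 + (y / (2*pi))\<^sup>2 / real k ^ 2) \<longlonglongrightarrow> sinh (pi * (y / (2*pi))) / (pi * (y/(2*pi)))"
      using y by (intro sinh_product) auto
    then have "(\<lambda>n. \<Prod>k=1..n. 1 + y\<^sup>2 / (2*pi*real k) ^ 2) \<longlonglongrightarrow> sinh (y/2) / (y/2)"
      by (simp add: power_mult_distrib power_divide)
    moreover have "sinh (y/2) / (y/2) > 0" using y by auto
    ultimately have "(\<lambda>n. ln (\<Prod>k=1..n. 1 + y\<^sup>2 / (2*pi*real k) ^ 2)) \<longlonglongrightarrow> L y"
      unfolding L_def by (intro tendsto_ln) auto
    moreover have "ln (\<Prod>k=1..n. 1 + y\<^sup>2 / (2*pi*real k) ^ 2) = (\<Sum>k<n. f k y)" for n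
    proof -
      have pos: "1 + y\<^sup>2 / (2*pi*real k) ^ 2 > 0" for k by (intro add_pos_nonneg) auto
      have "ln (\<Prod>k=1..n. 1 + y\<^sup>2 / (2*pi*real k) ^ 2) = (\<Sum>k=1..n. ln (1 + y\<^sup>2 / (2*pi*real k) ^ 2))"
        using pos by (intro ln_prod) (auto simp: less_imp_neq[symmetric])
      also have "\<dots> = (\<Sum>k<n. f k y)"
        unfolding f_def by (intro sum.reindex_bij_witness[of _ Suc "\<lambda>k. k - 1"]) auto
      finally show ?thesis .
    qed
    ultimately show ?thesis by (simp add: sums_def)
  qed
  define S where "S = {0<..<x+1}"
  have der: "(f n has_field_derivative f' n y) (at y within S)" if "y \<in> S" for n y
  proof -
    have "(2 * pi * real (Suc n))\<^sup>2 > 0" by simp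
    moreover have "1 + y\<^sup>2 / (2 * pi * real (Suc n))\<^sup>2 > 0" by (intro add_pos_nonneg) auto
    moreover have "y\<^sup>2 + (2 * pi * real (Suc n))\<^sup>2 > 0" by (intro add_nonneg_pos) auto
    ultimately show ?thesis unfolding f_def f'_def
      by (auto intro!: derivative_eq_intros simp del: of_nat_Suc simp: field_simps)
  qed
  have uc: "uniformly_convergent_on S (\<lambda>n x. \<Sum>i<n. f' i x)"
  proof (rule Weierstrass_m_test')
    show "norm (f' n y) \<le> 2 * (x+1) * (1 / (2 * pi * real (Suc n))\<^sup>2)" if "y \<in> S" for n y
    proof -
      have "2 * y / (y\<^sup>2 + (2 * pi * real (Suc n))\<^sup>2) \<le> 2 * (x+1) / (2 * pi * real (Suc n))\<^sup>2"
        using that unfolding S_def by (intro frac_le) auto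
      then show ?thesis using that unfolding f'_def S_def by simp
    qed
    show "summable (\<lambda>n. 2 * (x+1) * (1 / (2 * pi * real (Suc n))\<^sup>2))"
      by (rule summable_mult[OF summable_inverse_two_pi_squares])
  qed
  have xS: "x \<in> S" "x \<in> interior S" using assms by (auto simp: S_def interior_open)
  have D1: "((\<lambda>x. \<Sum>n. f n x) has_field_derivative (\<Sum>n. f' n x)) (at x)"
    by (rule has_field_derivative_series'(2)[OF _ der uc, of x x])
       (use xS fsums[OF assms] in \<open>auto simp: S_def sums_iff\<close>)
  have "(L has_field_derivative (\<Sum>n. f' n x)) (at x)"
    by (rule has_field_derivative_transform_within_open[OF D1, of "{0<..}"])
       (use assms fsums in \<open>auto simp: sums_iff\<close>)
  moreover have "(L has_field_derivative bose_kernel x) (at x)"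
  proof -
    have e: "exp x = exp (x/2) * exp (x/2)" by (simp flip: exp_add)
    have "exp (x/2) > 1" using assms by simp
    then have e1: "exp (x/2) * exp (x/2) > 1" "exp (x/2) * exp (x/2) \<noteq> 0" 
      by (auto simp: less_1_mult)
    have s: "sinh (x/2) > 0" using assms by simp
    have "(L has_field_derivative cosh (x/2) / (2 * sinh (x/2)) - 1/x) (at x)"
      unfolding L_def using assms s
      by (auto intro!: derivative_eq_intros simp: field_simps power2_eq_square)
    also have "cosh (x/2) / (2 * sinh (x/2)) = 1 / (exp x - 1) + 1/2"
      using e1 unfolding cosh_def sinh_def e exp_minus
      by (simp add: field_simps)
    finally show ?thesis by (simp add: bose_kernel_def algebra_simps)
  qed
  ultimately have "(\<Sum>n. f' n x) = bose_kernel x" by (rule DERIV_unique)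
  moreover have "summable (\<lambda>n. f' n x)"
  proof (rule summable_comparison_test'[of _ 0])
    show "summable (\<lambda>n. 2 * x * (1 / (2 * pi * real (Suc n))\<^sup>2))"
      by (rule summable_mult[OF summable_inverse_two_pi_squares])
    show "norm (f' n x) \<le> 2 * x * (1 / (2 * pi * real (Suc n))\<^sup>2)" if "0 \<le> n" for n
    proof -
      have "2 * x / (x\<^sup>2 + (2 * pi * real (Suc n))\<^sup>2) \<le> 2 * x / (2 * pi * real (Suc n))\<^sup>2"
        using assms by (intro frac_le) auto
      then show ?thesis using assms unfolding f'_def by simp
    qed
  qed
  ultimately show ?thesis by (simp add: sums_iff f'_def)
qed

lemma bose_kernel_bounds:
  assumes "x > 0"
  shows "0 \<le> bose_kernel x" "bose_kernel x \<le> 2 * (\<Sum>n. 1 / (2 * pi * real (Suc n))\<^sup>2) * x"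
proof -
  note S = bose_kernel_sums[OF assms]
  show "0 \<le> bose_kernel x"
    using S assms by (intro sums_le[OF _ sums_zero S]) auto
  have "(\<lambda>n. 2 * x * (1 / (2 * pi * real (Suc n))\<^sup>2)) sums (2 * x * (\<Sum>n. 1 / (2 * pi * real (Suc n))\<^sup>2))"
    by (intro sums_mult summable_sums summable_inverse_two_pi_squares)
  moreover have "2 * x / (x\<^sup>2 + (2 * pi * real (Suc n))\<^sup>2) \<le> 2 * x * (1 / (2 * pi * real (Suc n))\<^sup>2)" for n
  proof -
    have "2 * x / (x\<^sup>2 + (2 * pi * real (Suc n))\<^sup>2) \<le> 2 * x / (2 * pi * real (Suc n))\<^sup>2"
      using assms by (intro frac_le) auto
    then show ?thesis by simp
  qed
  ultimately have "bose_kernel x \<le> 2 * x * (\<Sum>n. 1 / (2 * pi * real (Suc n))\<^sup>2)"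
    by (intro sums_le[OF _ S])
  then show "bose_kernel x \<le> 2 * (\<Sum>n. 1 / (2 * pi * real (Suc n))\<^sup>2) * x" by (simp add: mult_ac)
qed

text \<open>The substitution \<open>t = x\<^sup>2 / (x\<^sup>2 + a\<^sup>2)\<close> turns this into a Beta integral with parameters
\<open>(1 + s) / 2\<close> and \<open>(1 - s) / 2\<close>, whose sum is 1.\<close>
lemma has_integral_bose_term:
  assumes "a > 0" "-1 < s" "s < (1::real)"
  shows "((\<lambda>x. x powr (s-1) * (2 * x / (x\<^sup>2 + a\<^sup>2))) has_integral
            (a powr (s-1) * (Gamma ((1+s)/2) * Gamma ((1-s)/2)))) {0<..}"
proof -
  define b where "b = Beta ((1+s)/2) ((1-s)/2)"
  define f where "f = (\<lambda>t. t powr ((1+s)/2-1) * (1-t) powr ((1-s)/2-1))"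
  define g where "g = (\<lambda>x::real. x\<^sup>2 / (x\<^sup>2 + a\<^sup>2))"
  define g' where "g' = (\<lambda>x::real. 2 * x * a\<^sup>2 / (x\<^sup>2 + a\<^sup>2)\<^sup>2)"
  have pos: "x\<^sup>2 + a\<^sup>2 > 0" for x using assms by (intro add_nonneg_pos) auto
  have B: "(f has_integral b) {0<..<1}"
    using has_integral_Beta_real[of "(1+s)/2" "(1-s)/2"] assms
    by (simp add: f_def b_def has_integral_Icc_iff_Ioo)
  then have Ba: "f absolutely_integrable_on {0<..<1} \<and> integral {0<..<1} f = b"
    by (auto simp: has_integral_iff f_def intro!: nonnegative_absolutely_integrable_1)
  have img: "g ` {0<..} = {0<..<1}"
  proof safe
    fix x :: real assume "x > 0"
    then show "g x \<in> {0<..<1}" using pos[of x] assms by (auto simp: g_def field_simps)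
  next
    fix t :: real assume t: "t \<in> {0<..<1}"
    define x where "x = a * sqrt (t / (1-t))"
    have "x > 0" using t assms by (auto simp: x_def)
    moreover have "x\<^sup>2 = a\<^sup>2 * (t / (1-t))" using t by (simp add: x_def power_mult_distrib)
    then have "g x = t" using t assms by (simp add: g_def field_simps)
    ultimately show "t \<in> g ` {0<..}" by force
  qed
  have inj: "inj_on g {0<..}"
  proof (rule inj_onI)
    fix x y :: real assume xy: "x \<in> {0<..}" "y \<in> {0<..}" "g x = g y"
    then have "x\<^sup>2 * (y\<^sup>2 + a\<^sup>2) = y\<^sup>2 * (x\<^sup>2 + a\<^sup>2)" using pos[of x] pos[of y] by (simp add: g_def field_simps)
    then have "x\<^sup>2 = y\<^sup>2" using assms by (simp add: algebra_simps)
    then show "x = y" using xy by (simp add: power2_eq_iff)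
  qed
  have der: "(g has_field_derivative g' x) (at x within {0<..})" for x
    unfolding g_def g'_def using pos[of x]
    by (auto intro!: derivative_eq_intros simp: power2_eq_square algebra_simps)
  have C: "(\<lambda>x. \<bar>g' x\<bar> * f (g x)) absolutely_integrable_on {0<..} \<and>
           integral {0<..} (\<lambda>x. \<bar>g' x\<bar> * f (g x)) = b"
    using has_absolute_integral_change_of_variables_1'[OF _ der inj, of f b] Ba img by simp
  have eq: "\<bar>g' x\<bar> * f (g x) = a powr (1-s) * (x powr (s-1) * (2 * x / (x\<^sup>2 + a\<^sup>2)))" if "x > 0" for x
  proof -
    define u where "u = x\<^sup>2 + a\<^sup>2"
    have u: "u > 0" unfolding u_def by (rule pos)
    have 1: "1 - g x = a\<^sup>2 / u" unfolding g_def u_def using pos[of x] by (metis add_diff_cancel_left' diff_divide_distrib divide_self less_irrefl)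
    have 2: "g x = x\<^sup>2 / u" by (simp add: g_def u_def)
    have x2: "(x\<^sup>2) powr ((1+s)/2-1) = x powr (s-1)"
    proof -
      have "2 * ((1+s)/2-1) = s-1" by (simp add: field_simps)
      then show ?thesis using that by (simp only: powr_powr flip: powr_numeral)
    qed
    have a2: "(a\<^sup>2) powr ((1-s)/2-1) = a powr (-1-s)"
    proof -
      have "2 * ((1-s)/2-1) = -1-s" by (simp add: field_simps)
      then show ?thesis using assms by (simp only: powr_powr flip: powr_numeral)
    qed
    have "(1+s)/2-1 + ((1-s)/2-1) = -1" by (simp add: field_simps)
    then have "u powr ((1+s)/2-1) * u powr ((1-s)/2-1) = u powr (-1)"
      by (simp only: flip: powr_add)
    then have uu: "u powr ((1+s)/2-1) * u powr ((1-s)/2-1) = 1 / u" using u by (simp add: powr_minus_divide)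
    have "f (g x) = x powr (s-1) * a powr (-1-s) / (u powr ((1+s)/2-1) * u powr ((1-s)/2-1))"
    proof -
      have "(z / u) powr e = z powr e / u powr e" if "z \<ge> 0" for z e
        using u that by (simp add: powr_divide)
      then show ?thesis unfolding f_def 1 unfolding 2 by (simp only: zero_le_power2 x2 a2 times_divide_times_eq)
    qed
    also have "\<dots> = x powr (s-1) * a powr (-1-s) * u" unfolding uu by simp
    moreover have "\<bar>g' x\<bar> = 2 * x * a\<^sup>2 / u\<^sup>2"
      using that u by (simp add: g'_def u_def[symmetric])
    ultimately have "\<bar>g' x\<bar> * f (g x) = (a\<^sup>2 * a powr (-1-s)) * (x powr (s-1) * (2 * x / u))"
      using that u by (simp add: power2_eq_square)
    also have "a\<^sup>2 * a powr (-1-s) = a powr (1-s)"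
      using assms by (simp flip: powr_numeral powr_add)
    finally show ?thesis by (simp add: u_def)
  qed
  have "((\<lambda>x. \<bar>g' x\<bar> * f (g x)) has_integral b) {0<..}"
    using C by (metis absolutely_integrable_on_def has_integral_iff set_lebesgue_integral_eq_integral(1))
  then have "((\<lambda>x. a powr (1-s) * (x powr (s-1) * (2 * x / (x\<^sup>2 + a\<^sup>2)))) has_integral b) {0<..}"
    by (rule has_integral_eq[rotated]) (use eq in auto)
  from has_integral_mult_right[OF this, of "a powr (s-1)"]
  have "((\<lambda>x. a powr (s-1) * (a powr (1-s) * (x powr (s-1) * (2 * x / (x\<^sup>2 + a\<^sup>2))))) has_integral a powr (s-1) * b) {0<..}" .
  moreover have "a powr (s-1) * (a powr (1-s) * z) = z" for z
    using assms by (simp flip: powr_add mult.assoc)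
  moreover have "(1+s)/2 + (1-s)/2 = 1" by (simp add: field_simps)
  then have "b = Gamma ((1+s)/2) * Gamma ((1-s)/2)" by (simp add: b_def Beta_def)
  ultimately show ?thesis by simp
qed

text \<open>Monotone convergence. To have nonnegative terms, the Mellin integrals below are evaluated
at real exponents.\<close>
lemma has_integral_sums_nonneg:
  fixes f :: "nat \<Rightarrow> real \<Rightarrow> real"
  assumes nonneg: "\<And>n x. x \<in> A \<Longrightarrow> 0 \<le> f n x" and int: "\<And>n. (f n has_integral I n) A"
    and S: "I sums S" and F: "\<And>x. x \<in> A \<Longrightarrow> (\<lambda>n. f n x) sums F x"
  shows "(F has_integral S) A"
proof (rule has_integral_monotone_convergence_increasing)
  show "((\<lambda>x. \<Sum>n<k. f n x) has_integral (\<Sum>n<k. I n)) A" for k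
    by (intro has_integral_sum) (auto intro: int)
  show "(\<lambda>k. \<Sum>n<k. f n x) \<longlonglongrightarrow> F x" if "x \<in> A" for x
    using F[OF that] by (simp add: sums_def)
  show "(\<lambda>k. \<Sum>n<k. I n) \<longlonglongrightarrow> S" using S by (simp add: sums_def)
qed (auto intro: nonneg)

lemma has_integral_powr_exp:
  assumes "s > 0" "c > (0::real)"
  shows "((\<lambda>x. x powr (s-1) * exp (- (c * x))) has_integral Gamma s / c powr s) {0<..}"
proof -
  define f where "f = (\<lambda>t::real. t powr (s-1) / exp t)"
  have G: "(f has_integral Gamma s) {0<..}"
  proof -
    have "(f has_integral Gamma s) {0..}" using Gamma_integral_real[of s] assms by (simp add: f_def)
    then have "((\<lambda>t. if t \<in> {0<..} then f t else 0) has_integral Gamma s) {0..}"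
      by (rule has_integral_spike [of "{0}", rotated 2]) auto
    then show ?thesis by (subst (asm) has_integral_restrict) auto
  qed
  have "bij_betw (times c) {0<..} {0<..}"
    by (rule bij_betwI[of _ _ _ "\<lambda>x. x / c"]) (use assms in auto)
  then have img: "times c ` {0<..} = {0<..}" by (simp add: bij_betw_def)
  have inj: "inj_on (times c) {0<..}" using assms by (auto intro: inj_onI)
  have Ga: "f absolutely_integrable_on {0<..} \<and> integral {0<..} f = Gamma s"
    using G by (auto simp: has_integral_iff f_def intro!: nonnegative_absolutely_integrable_1)
  have "(\<lambda>x. \<bar>c\<bar> * f (c * x)) absolutely_integrable_on {0<..} \<and>
           integral {0<..} (\<lambda>x. \<bar>c\<bar> * f (c * x)) = Gamma s"
    using has_absolute_integral_change_of_variables_1'[of "{0<..}" "times c" "\<lambda>_. c" f "Gamma s"] Ga img inj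
    by (auto intro!: derivative_eq_intros)
  then have "((\<lambda>x. \<bar>c\<bar> * f (c * x)) has_integral Gamma s) {0<..}"
    by (metis absolutely_integrable_on_def has_integral_iff set_lebesgue_integral_eq_integral(1))
  then have "((\<lambda>x. c powr s * (x powr (s-1) * exp (- (c * x)))) has_integral Gamma s) {0<..}"
  proof (rule has_integral_eq[rotated])
    fix x :: real assume x: "x \<in> {0<..}"
    have "c powr s = c * c powr (s-1)" using assms by (simp add: powr_mult_base)
    then show "\<bar>c\<bar> * f (c * x) = c powr s * (x powr (s-1) * exp (- (c * x)))"
      using x assms by (simp add: f_def powr_mult exp_minus field_simps)
  qed
  from has_integral_mult_right[OF this, of "1 / c powr s"] assms
  show ?thesis by simp
qed

lemma bose_geometric_sums:
  assumes "x > (0::real)"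
  shows "(\<lambda>n. exp (- (real (Suc n) * x))) sums (1 / (exp x - 1))"
proof -
  have "norm (exp (-x)) < 1" using assms by simp
  from sums_mult[OF geometric_sums[OF this], of "exp (-x)"]
  have "(\<lambda>n. exp (-x) * exp (-x) ^ n) sums (exp (-x) * (1 / (1 - exp (-x))))" .
  moreover have "exp (-x) * (1 / (1 - exp (-x))) = 1 / (exp x - 1)"
    using assms by (simp add: exp_minus field_simps)
  moreover have "exp (-x) * exp (-x) ^ n = exp (- (real (Suc n) * x))" for n
    by (simp flip: exp_of_nat_mult exp_add add: algebra_simps)
  ultimately show ?thesis by simp
qed

text \<open>Removing the two polar terms on \<open>(0, 1)\<close> only keeps the decay at infinity, so that the Mellin
transform converges for all \<open>Re s > -1\<close>.\<close>
definition cutoff_bose_kernel :: "real \<Rightarrow> real" where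
  "cutoff_bose_kernel x = (if x < 1 then bose_kernel x else 1 / (exp x - 1))"

definition real_dirichlet :: "real \<Rightarrow> real" where
  "real_dirichlet s = (\<Sum>n. real (Suc n) powr (-s))"

lemma real_dirichlet_sums:
  assumes "s > 1" shows "(\<lambda>n. real (Suc n) powr (-s)) sums real_dirichlet s"
proof -
  have "summable (\<lambda>n. real n powr (-s))" using assms by (simp add: summable_real_powr_iff)
  then have "summable (\<lambda>n. real (Suc n) powr (-s))" by (subst summable_Suc_iff)
  then show ?thesis unfolding real_dirichlet_def by (rule summable_sums)
qed

lemma real_dirichlet_pos:
  assumes "s > 1" shows "real_dirichlet s > 0"
  unfolding real_dirichlet_def
  by (rule suminf_pos) (use real_dirichlet_sums[OF assms] in \<open>auto simp: sums_iff\<close>)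

text \<open>For \<open>s > 1\<close> the function \<open>1 / (exp x - 1)\<close> is integrated as a geometric series; the terms
subtracted on \<open>(0, 1)\<close> contribute the two rational functions.\<close>
lemma has_integral_cutoff_right:
  assumes "s > (1::real)"
  shows "((\<lambda>x. x powr (s-1) * cutoff_bose_kernel x) has_integral
           (Gamma s * real_dirichlet s - 1 / (s-1) + 1 / (2 * s))) {0<..}"
proof -
  have 1: "((\<lambda>x. x powr (s-1) * (1 / (exp x - 1))) has_integral Gamma s * real_dirichlet s) {0<..}"
  proof (rule has_integral_sums_nonneg)
    show "((\<lambda>x. x powr (s-1) * exp (- (real (Suc n) * x))) has_integral Gamma s / real (Suc n) powr s) {0<..}" for n
      using assms by (intro has_integral_powr_exp) auto
    have "(\<lambda>n. Gamma s * real (Suc n) powr (-s)) sums (Gamma s * real_dirichlet s)"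
      by (intro sums_mult real_dirichlet_sums assms)
    then show "(\<lambda>n. Gamma s / real (Suc n) powr s) sums (Gamma s * real_dirichlet s)"
      by (simp add: powr_minus divide_inverse)
    show "(\<lambda>n. x powr (s-1) * exp (- (real (Suc n) * x))) sums (x powr (s-1) * (1 / (exp x - 1)))"
      if "x \<in> {0<..}" for x
      using that by (intro sums_mult bose_geometric_sums) auto
  qed auto
  have 2: "((\<lambda>x. x powr (s-2) - x powr (s-1) / 2) has_integral (1/(s-1) - 1/s/2)) {0<..<1}"
  proof -
    have "((\<lambda>x. x powr (s-2) - x powr (s-1) / 2) has_integral (1 powr (s-2+1)/(s-2+1) - 1 powr (s-1+1)/(s-1+1)/2)) {0..1}"
      using assms by (intro has_integral_diff has_integral_divide has_integral_powr_from_0) auto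
    then show ?thesis by (simp add: has_integral_Icc_iff_Ioo)
  qed
  have "((\<lambda>x. if x \<in> {0<..<1} then x powr (s-2) - x powr (s-1) / 2 else 0) has_integral (1/(s-1) - 1/s/2)) {0<..}"
    by (subst has_integral_restrict) (use 2 in auto)
  from has_integral_diff[OF 1 this]
  have "((\<lambda>x. x powr (s-1) * (1 / (exp x - 1)) - (if x \<in> {0<..<1} then x powr (s-2) - x powr (s-1) / 2 else 0))
          has_integral (Gamma s * real_dirichlet s - (1/(s-1) - 1/s/2))) {0<..}" .
  then have "((\<lambda>x. x powr (s-1) * cutoff_bose_kernel x) has_integral (Gamma s * real_dirichlet s - (1/(s-1) - 1/s/2))) {0<..}"
  proof (rule has_integral_eq[rotated])
    fix x :: real assume x: "x \<in> {0<..}"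
    have "x powr (s-2) = x powr (s-1) / x" using x powr_diff[of x "s-1" 1] by simp
    then show "x powr (s-1) * (1 / (exp x - 1)) - (if x \<in> {0<..<1} then x powr (s-2) - x powr (s-1) / 2 else 0)
       = x powr (s-1) * cutoff_bose_kernel x"
      using x by (simp add: cutoff_bose_kernel_def bose_kernel_def algebra_simps)
  qed
  then show ?thesis by (simp add: algebra_simps)
qed

text \<open>For \<open>-1 < s < 0\<close> the kernel with both polar terms removed everywhere is integrable, and its
partial fractions produce the Dirichlet series at \<open>1 - s\<close>. Its difference from the cut-off kernel lives
on \<open>[1, \<infinity>)\<close> and contributes the same two rational functions as for \<open>s > 1\<close>.\<close>
lemma has_integral_cutoff_left:
  assumes "-1 < s" "s < (0::real)"
  shows "((\<lambda>x. x powr (s-1) * cutoff_bose_kernel x) has_integral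
           ((2*pi) powr (s-1) * (Gamma ((1+s)/2) * Gamma ((1-s)/2)) * real_dirichlet (1-s) 
             - 1 / (s-1) + 1 / (2 * s))) {0<..}"
proof -
  let ?G = "Gamma ((1+s)/2) * Gamma ((1-s)/2)"
  have 1: "((\<lambda>x. x powr (s-1) * bose_kernel x) has_integral (2*pi) powr (s-1) * ?G * real_dirichlet (1-s)) {0<..}"
  proof (rule has_integral_sums_nonneg)
    show "((\<lambda>x. x powr (s-1) * (2 * x / (x\<^sup>2 + (2 * pi * real (Suc n))\<^sup>2))) has_integral 
        (2 * pi * real (Suc n)) powr (s-1) * ?G) {0<..}" for n
      using assms by (intro has_integral_bose_term) auto
    have "(\<lambda>n. (2*pi) powr (s-1) * ?G * real (Suc n) powr (-(1-s))) sums ((2*pi) powr (s-1) * ?G * real_dirichlet (1-s))"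
      using assms by (intro sums_mult real_dirichlet_sums) auto
    then show "(\<lambda>n. (2 * pi * real (Suc n)) powr (s-1) * ?G) sums ((2*pi) powr (s-1) * ?G * real_dirichlet (1-s))"
      by (simp add: powr_mult mult_ac del: of_nat_Suc)
    show "(\<lambda>n. x powr (s-1) * (2 * x / (x\<^sup>2 + (2 * pi * real (Suc n))\<^sup>2))) sums (x powr (s-1) * bose_kernel x)"
      if "x \<in> {0<..}" for x
      using that by (intro sums_mult bose_kernel_sums) auto
  qed auto
  have 2: "((\<lambda>x. x powr (s-2) - x powr (s-1) / 2) has_integral (-1/(s-1) - (-1/s)/2)) {1..}"
  proof -
    have "((\<lambda>x. x powr (s-2) - x powr (s-1) / 2) has_integral (-(1 powr (s-2+1))/(s-2+1) - -(1 powr (s-1+1))/(s-1+1)/2)) {1..}"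
      using assms by (intro has_integral_diff has_integral_divide has_integral_powr_to_inf) auto
    then show ?thesis by simp
  qed
  have "((\<lambda>x. if x \<in> {1..} then x powr (s-2) - x powr (s-1) / 2 else 0) has_integral (-1/(s-1) - (-1/s)/2)) {0<..}"
    by (subst has_integral_restrict) (use 2 in auto)
  from has_integral_add[OF 1 this]
  have "((\<lambda>x. x powr (s-1) * bose_kernel x + (if x \<in> {1..} then x powr (s-2) - x powr (s-1) / 2 else 0))
          has_integral ((2*pi) powr (s-1) * ?G * real_dirichlet (1-s) + (-1/(s-1) - (-1/s)/2))) {0<..}" .
  then have "((\<lambda>x. x powr (s-1) * cutoff_bose_kernel x) has_integral ((2*pi) powr (s-1) * ?G * real_dirichlet (1-s) + (-1/(s-1) - (-1/s)/2))) {0<..}"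
  proof (rule has_integral_eq[rotated])
    fix x :: real assume x: "x \<in> {0<..}"
    have "x powr (s-2) = x powr (s-1) / x" using x powr_diff[of x "s-1" 1] by simp
    then show "x powr (s-1) * bose_kernel x + (if x \<in> {1..} then x powr (s-2) - x powr (s-1) / 2 else 0)
       = x powr (s-1) * cutoff_bose_kernel x"
      using x by (simp add: cutoff_bose_kernel_def bose_kernel_def algebra_simps)
  qed
  then show ?thesis by (simp add: algebra_simps)
qed

lemma cutoff_bose_kernel_bounds:
  obtains C where "C \<ge> 0" "\<And>x. x > 0 \<Longrightarrow> 0 \<le> cutoff_bose_kernel x"
    "\<And>x. x > 0 \<Longrightarrow> cutoff_bose_kernel x \<le> C * (x * exp (-x))"
proof -
  define C0 where "C0 = 2 * (\<Sum>n. 1 / (2 * pi * real (Suc n))\<^sup>2)"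
  have C0: "C0 \<ge> 0" unfolding C0_def using summable_inverse_two_pi_squares by (simp add: suminf_nonneg)
  define C where "C = C0 * exp 1 + 2"
  have "0 \<le> cutoff_bose_kernel x \<and> cutoff_bose_kernel x \<le> C * (x * exp (-x))" if x: "x > 0" for x
  proof (cases "x < 1")
    case True
    have "bose_kernel x \<le> C0 * x" using bose_kernel_bounds[OF x] by (simp add: C0_def)
    also have "\<dots> = C0 * x * 1" by simp
    also have "\<dots> \<le> C0 * x * (exp 1 * exp (-x))"
      using True x C0 by (intro mult_left_mono) (auto simp flip: exp_add)
    also have "\<dots> \<le> C * (x * exp (-x))"
      using x by (simp add: C_def algebra_simps)
    finally show ?thesis using True bose_kernel_bounds[OF x] by (simp add: cutoff_bose_kernel_def)
  next
    case False
    have e: "exp x \<ge> 2" using False exp_ge_add_one_self[of x] by linarith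
    then have "1 / (exp x - 1) \<le> 1 / (exp x / 2)" by (intro frac_le) auto
    then have "1 / (exp x - 1) \<le> 2 * exp (-x)" by (simp add: exp_minus inverse_eq_divide)
    also have "\<dots> \<le> 2 * (x * exp (-x))" using False by simp
    also have "\<dots> \<le> C * (x * exp (-x))"
      using x C0 by (intro mult_right_mono) (auto simp: C_def)
    finally show ?thesis using False e by (simp add: cutoff_bose_kernel_def)
  qed
  moreover have "C \<ge> 0" using C0 by (simp add: C_def)
  ultimately show ?thesis using that by blast
qed

text \<open>The power \<open>x powr (s - 1)\<close> is written as an exponential, which is visibly entire in \<open>s\<close>.\<close>
definition bose_mellin_integrand :: "complex \<Rightarrow> real \<Rightarrow> complex" where
  "bose_mellin_integrand s x = 
     (if x > 0 then exp ((s - 1) * of_real (ln x)) * of_real (cutoff_bose_kernel x) else 0)"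

definition bose_mellin :: "complex \<Rightarrow> complex" where
  "bose_mellin s = (\<integral>x. bose_mellin_integrand s x \<partial>lborel)"

lemma bose_mellin_integrand_measurable [measurable]:
  "bose_mellin_integrand s \<in> borel_measurable borel"
  unfolding bose_mellin_integrand_def cutoff_bose_kernel_def bose_kernel_def by measurable

lemma norm_bose_mellin_integrand:
  "norm (bose_mellin_integrand s x) = (if x > 0 then x powr (Re s - 1) * \<bar>cutoff_bose_kernel x\<bar> else 0)"
  by (simp add: bose_mellin_integrand_def norm_mult powr_def)

lemma integrable_powr_exp:
  assumes "a > (-1::real)"
  shows "integrable lborel (\<lambda>x. if x > 0 then x powr a * exp (-x) else 0)"
proof (rule integrableI_nn_integral_finite)
  have "((\<lambda>x. x powr (a+1-1) * exp (- (1 * x))) has_integral Gamma (a+1) / 1 powr (a+1)) {0<..}"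
    using assms by (intro has_integral_powr_exp) auto
  then have "((\<lambda>x. x powr a * exp (- x)) has_integral Gamma (a+1)) {0<..}" by simp
  then have "integral\<^sup>N lborel (\<lambda>x. indicator {0<..} x * (x powr a * exp (- x))) = Gamma (a+1)"
    by (intro nn_integral_has_integral_lebesgue) auto
  also have "integral\<^sup>N lborel (\<lambda>x. indicator {0<..} x * (x powr a * exp (- x))) =
     integral\<^sup>N lborel (\<lambda>x. ennreal (if x > 0 then x powr a * exp (-x) else 0))"
    by (intro nn_integral_cong) (auto simp: indicator_def)
  finally show "integral\<^sup>N lborel (\<lambda>x. ennreal (if x > 0 then x powr a * exp (-x) else 0)) = ennreal (Gamma (a+1))" .
qed (auto intro!: AE_I2)

text \<open>On a vertical strip \<open>x powr Re s\<close> is at most the sum of its values at the two edges.\<close>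
lemma bose_mellin_integrand_dominated:
  assumes "a > -1"
  shows "\<exists>G. integrable lborel G \<and>
    (\<forall>s x. a \<le> Re s \<longrightarrow> Re s \<le> b \<longrightarrow> norm (bose_mellin_integrand s x) \<le> G x)"
proof -
  obtain C where C: "C \<ge> 0" "\<And>x. x > 0 \<Longrightarrow> 0 \<le> cutoff_bose_kernel x"
    "\<And>x. x > 0 \<Longrightarrow> cutoff_bose_kernel x \<le> C * (x * exp (-x))"
    using cutoff_bose_kernel_bounds by blast
  define G where "G = (\<lambda>x. C * ((if x > 0 then x powr a * exp (-x) else 0) + (if x > 0 then x powr (max 0 b) * exp (-x) else 0)))"
  have "integrable lborel G" unfolding G_def
    using assms by (intro integrable_mult_right Bochner_Integration.integrable_add integrable_powr_exp) auto
  moreover have "norm (bose_mellin_integrand s x) \<le> G x" if s: "a \<le> Re s" "Re s \<le> b" for s x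
  proof (cases "x > 0")
    case True
    have "x powr Re s \<le> x powr a + x powr (max 0 b)"
    proof (cases "x \<le> 1")
      case True
      then have "x powr Re s \<le> x powr a" using \<open>x > 0\<close> s by (intro powr_mono') auto
      then show ?thesis by (simp add: add_increasing2)
    next
      case False
      then have "x powr Re s \<le> x powr (max 0 b)" using s by (intro powr_mono) auto
      then show ?thesis by (simp add: add_increasing)
    qed
    then have *: "C * (x powr Re s * exp (-x)) \<le> G x"
      using True C unfolding G_def by (simp flip: distrib_right add: mult_left_mono)
    have "norm (bose_mellin_integrand s x) \<le> x powr (Re s - 1) * (C * (x * exp (-x)))"
      using True C by (simp add: norm_bose_mellin_integrand mult_left_mono)
    also have "\<dots> = C * (x powr Re s * exp (-x))"
      using True powr_mult_base[of x "Re s - 1"] by (simp add: algebra_simps)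
    finally show ?thesis using * by linarith
  qed (simp add: norm_bose_mellin_integrand G_def)
  ultimately show ?thesis by blast
qed

lemma bose_mellin_holomorphic: "bose_mellin holomorphic_on {s. Re s > -1}"
  unfolding bose_mellin_def
proof (rule holomorphic_on_dominated_integral)
  show "(\<lambda>s. bose_mellin_integrand s x) holomorphic_on {s. Re s > -1}" for x
  proof (cases "x > 0")
    case True
    have "(\<lambda>s. exp ((s - 1) * of_real (ln x)) * of_real (cutoff_bose_kernel x)) holomorphic_on {s. Re s > -1}"
      by (intro holomorphic_intros)
    then show ?thesis by (simp add: bose_mellin_integrand_def True)
  qed (simp add: bose_mellin_integrand_def)
  show "open {s. Re s > -1}" by (simp add: open_halfspace_Re_gt)
  fix s assume s: "s \<in> {s. Re s > -1}"
  define r where "r = (Re s + 1) / 2"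
  have r: "r > 0" using s by (simp add: r_def)
  have r1: "Re s - r > -1" using s by (simp add: r_def field_simps)
  then obtain G where G: "integrable lborel G"
    "\<And>z x. Re s - r \<le> Re z \<Longrightarrow> Re z \<le> Re s + r \<Longrightarrow> norm (bose_mellin_integrand z x) \<le> G x"
    using bose_mellin_integrand_dominated[of _ "Re s + r"] by blast
  have strip: "Re s - r \<le> Re z \<and> Re z \<le> Re s + r" if "z \<in> cball s r" for z
    using that abs_Re_le_cmod[of "s - z"] by (auto simp: dist_norm)
  then have "cball s r \<subseteq> {s. Re s > -1}" using r1 by fastforce
  moreover have "norm (bose_mellin_integrand z x) \<le> G x" if "z \<in> cball s r" for z x
    using G(2) strip[OF that] by blast
  ultimately show "\<exists>r>0. \<exists>G. integrable lborel G \<and> cball s r \<subseteq> {s. Re s > -1} \<and>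
              (\<forall>z\<in>cball s r. \<forall>x. norm (bose_mellin_integrand z x) \<le> G x)"
    using r G(1) by blast
  show "bose_mellin_integrand s \<in> borel_measurable lborel" by simp
qed

lemma bose_mellin_of_real:
  assumes "s > -1" "((\<lambda>x. x powr (s-1) * cutoff_bose_kernel x) has_integral I) {0<..}"
  shows "bose_mellin (of_real s) = of_real I"
proof -
  obtain G where G': "integrable lborel G"
    "\<And>z x. s \<le> Re z \<Longrightarrow> Re z \<le> s \<Longrightarrow> norm (bose_mellin_integrand z x) \<le> G x"
    using bose_mellin_integrand_dominated[OF assms(1), of s] by blast
  then have G: "integrable lborel G" "\<And>x. norm (bose_mellin_integrand (of_real s) x) \<le> G x"
    by auto
  define h where "h = (\<lambda>x. if x \<in> {0<..} then x powr (s-1) * cutoff_bose_kernel x else 0)"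
  have eq: "bose_mellin_integrand (of_real s) x = of_real (h x)" for x
    by (auto simp: bose_mellin_integrand_def h_def powr_def exp_of_real[symmetric] simp del: exp_of_real)
  have "integrable lborel (bose_mellin_integrand (of_real s))"
    by (rule Bochner_Integration.integrable_bound[OF G(1)])
       (auto intro!: AE_I2 order_trans[OF G(2) abs_ge_self])
  then have int: "integrable lborel h"
    using complex_of_real_integrable_eq[of lborel h] by (simp add: eq[abs_def])
  have "(h has_integral (integral\<^sup>L lborel h)) UNIV"
    by (rule has_integral_integral_lborel[OF int])
  moreover have "(h has_integral I) UNIV"
    using assms(2) unfolding h_def by (subst has_integral_restrict_UNIV)
  ultimately have "integral\<^sup>L lborel h = I" by (rule has_integral_unique)
  then show ?thesis by (simp add: bose_mellin_def eq)
qed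

section \<open>Analytic continuation of zeta\<close>

text \<open>The polar term \<open>-1 / (2 s)\<close> of the Mellin transform is multiplied out: \<open>rGamma s / s = rGamma (s + 1)\<close>,
so there is no singularity at 0.\<close>
definition zeta_right :: "complex \<Rightarrow> complex" where
  "zeta_right s = rGamma s * (bose_mellin s + 1 / (s - 1)) - rGamma (s + 1) / 2"

text \<open>The functional equation, solved for the value at \<open>s\<close>.\<close>
definition zeta_left :: "complex \<Rightarrow> complex" where
  "zeta_left s = of_real pi powr (s - 1 / 2) * Gamma ((1 - s) / 2) * rGamma (s / 2) * zeta_right (1 - s)"

lemma zeta_right_holomorphic: "zeta_right holomorphic_on ({s. Re s > -1} - {1})"
  unfolding zeta_right_def
  by (intro holomorphic_intros holomorphic_on_subset[OF bose_mellin_holomorphic]) auto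

lemma zeta_right_of_real:
  assumes "s > 1"
  shows "zeta_right (of_real s) = of_real (real_dirichlet s)"
proof -
  have "bose_mellin (of_real s) = of_real (Gamma s * real_dirichlet s - 1 / (s-1) + 1 / (2 * s))"
    using assms by (intro bose_mellin_of_real has_integral_cutoff_right) auto
  then have "zeta_right (of_real s) = of_real (rGamma s * (Gamma s * real_dirichlet s + 1 / (2 * s)) - rGamma (s + 1) / 2)"
    unfolding zeta_right_def using rGamma_complex_of_real[of "s+1"] by (simp add: rGamma_complex_of_real)
  also have "rGamma s * (Gamma s * real_dirichlet s + 1 / (2 * s)) - rGamma (s + 1) / 2 = real_dirichlet s"
  proof -
    have "rGamma s = s * rGamma (s + 1)" using rGamma_plus1[of s] by simp
    moreover have "rGamma s * Gamma s = 1" 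
    proof -
      have "Gamma s > 0" using assms by (intro Gamma_real_pos) simp
      then show ?thesis by (simp add: rGamma_inverse_Gamma)
    qed
    ultimately show ?thesis using assms
      by (simp add: distrib_left flip: mult.assoc)
  qed
  finally show ?thesis .
qed

text \<open>Both sides are explicit for real \<open>s\<close>; Legendre's duplication formula at \<open>s / 2\<close> matches the
Gamma factors.\<close>
lemma zeta_right_eq_zeta_left_real:
  assumes "-1 < s" "s < 0"
  shows "zeta_right (of_real s) = zeta_left (of_real s)"
proof -
  let ?G = "Gamma ((1+s)/2) * Gamma ((1-s)/2)"
  let ?D = "real_dirichlet (1-s)"
  have "bose_mellin (of_real s) = of_real ((2*pi) powr (s-1) * ?G * ?D - 1 / (s-1) + 1 / (2 * s))"
    using assms by (intro bose_mellin_of_real has_integral_cutoff_left) auto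
  then have "zeta_right (of_real s) = of_real (rGamma s * ((2*pi) powr (s-1) * ?G * ?D + 1 / (2 * s)) - rGamma (s + 1) / 2)"
    unfolding zeta_right_def using rGamma_complex_of_real[of "s+1"] by (simp add: rGamma_complex_of_real)
  also have "rGamma s * ((2*pi) powr (s-1) * ?G * ?D + 1 / (2 * s)) - rGamma (s + 1) / 2 =
     rGamma s * (2*pi) powr (s-1) * ?G * ?D"
  proof -
    have "rGamma s = s * rGamma (s + 1)" using rGamma_plus1[of s] by simp
    then show ?thesis using assms by (simp add: algebra_simps)
  qed
  also have "\<dots> = pi powr (s - 1/2) * Gamma ((1-s)/2) * rGamma (s/2) * ?D"
  proof -
    have nn: "s \<notin> \<int>\<^sub>\<le>\<^sub>0" "s/2 \<notin> \<int>\<^sub>\<le>\<^sub>0" "s/2 + 1/2 \<notin> \<int>\<^sub>\<le>\<^sub>0"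
      using assms by (auto elim!: nonpos_Ints_cases)
    then have nc: "complex_of_real (s/2) \<notin> \<int>\<^sub>\<le>\<^sub>0" "complex_of_real (s/2) + 1/2 \<notin> \<int>\<^sub>\<le>\<^sub>0"
    proof -
      show "complex_of_real (s/2) \<notin> \<int>\<^sub>\<le>\<^sub>0" using nn(2) by (simp only: of_real_in_nonpos_Ints_iff not_False_eq_True)
      have "complex_of_real (s/2) + 1/2 = complex_of_real (s/2 + 1/2)" by simp
      then show "complex_of_real (s/2) + 1/2 \<notin> \<int>\<^sub>\<le>\<^sub>0" using nn(3) by (simp only: of_real_in_nonpos_Ints_iff not_False_eq_True)
    qed
    have "Gamma (complex_of_real (s/2)) * Gamma (complex_of_real (s/2) + 1/2) = 
        exp ((1 - 2 * complex_of_real (s/2)) * of_real (ln 2)) * of_real (sqrt pi) * Gamma (2 * complex_of_real (s/2))"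
      by (rule Gamma_legendre_duplication[OF nc])
    also have "complex_of_real (s/2) + 1/2 = complex_of_real ((1+s)/2)" by (simp add: add_divide_distrib)
    also have "2 * complex_of_real (s/2) = complex_of_real s" by simp
    also have "exp ((1 - complex_of_real s) * of_real (ln 2)) = of_real (2 powr (1-s))"
      by (simp add: powr_def exp_of_real[symmetric] del: exp_of_real)
    finally have "complex_of_real (Gamma (s/2) * Gamma ((1+s)/2)) = complex_of_real (2 powr (1-s) * sqrt pi * Gamma s)"
      by (simp only: Gamma_complex_of_real of_real_mult)
    then have dup: "Gamma (s/2) * Gamma ((1+s)/2) = 2 powr (1-s) * sqrt pi * Gamma s"
      by (simp only: of_real_eq_iff)
    have G: "Gamma s \<noteq> 0" "Gamma (s/2) \<noteq> 0" using nn by (auto simp: Gamma_eq_zero_iff)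
    have "rGamma s * Gamma ((1+s)/2) = 2 powr (1-s) * sqrt pi * rGamma (s/2)"
      using dup G by (simp add: rGamma_inverse_Gamma field_simps)
    moreover have pw: "(2*pi) powr (s-1) * (2 powr (1-s) * sqrt pi) = pi powr (s-1/2)"
    proof -
      have "(2*pi) powr (s-1) * (2 powr (1-s) * sqrt pi) = (2 powr (s-1) * 2 powr (1-s)) * (pi powr (s-1) * pi powr (1/2))"
        by (simp add: powr_mult powr_half_sqrt mult_ac)
      also have "\<dots> = 2 powr (s-1+(1-s)) * pi powr (s-1+1/2)" by (simp only: powr_add)
      also have "\<dots> = pi powr (s-1/2)" by simp
      finally show ?thesis .
    qed
    moreover have "rGamma s * (2*pi) powr (s-1) * ?G * ?D = 
        (2*pi) powr (s-1) * (rGamma s * Gamma ((1+s)/2)) * Gamma ((1-s)/2) * ?D"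
      by (simp only: mult_ac)
    ultimately show ?thesis unfolding pw[symmetric] by (simp only: mult_ac)
  qed
  also have "of_real \<dots> = zeta_left (of_real s)"
  proof -
    have "zeta_right (1 - of_real s) = of_real ?D" using zeta_right_of_real[of "1-s"] assms by simp
    moreover have "complex_of_real pi powr (of_real s - 1/2) = of_real (pi powr (s-1/2))"
      using powr_of_real[of pi "s-1/2"] by simp
    moreover have "Gamma ((1 - complex_of_real s)/2) = of_real (Gamma ((1-s)/2))"
      using Gamma_complex_of_real[of "(1-s)/2"] by simp
    moreover have "rGamma (complex_of_real s/2) = of_real (rGamma (s/2))"
      using rGamma_complex_of_real[of "s/2"] by simp
    ultimately show ?thesis unfolding zeta_left_def by simp
  qed
  finally show ?thesis .
qed

lemma zeta_left_holomorphic: "zeta_left holomorphic_on {s. Re s < 0}"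
proof -
  have 1: "(\<lambda>s. zeta_right (1 - s)) holomorphic_on {s. Re s < 0}"
  proof -
    have "zeta_right \<circ> (\<lambda>s. 1 - s) holomorphic_on {s. Re s < 0}"
      by (rule holomorphic_on_compose_gen[OF _ zeta_right_holomorphic]) (auto intro!: holomorphic_intros)
    then show ?thesis by (simp add: o_def)
  qed
  have "(1 - s) / 2 \<notin> \<int>\<^sub>\<le>\<^sub>0" if "Re s < 0" for s
  proof
    assume "(1 - s) / 2 \<in> \<int>\<^sub>\<le>\<^sub>0"
    then obtain n where "(1 - s) / 2 = of_int n" "n \<le> 0" by (auto elim!: nonpos_Ints_cases)
    then have "Re ((1 - s) / 2) = of_int n" by simp
    with \<open>n \<le> 0\<close> have "Re ((1 - s) / 2) \<le> 0" by simp
    with that show False by simp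
  qed
  then show ?thesis unfolding zeta_left_def
    by (auto intro!: holomorphic_intros 1)
qed

lemma halfspaces_connected: "connected {s. Re s > b}" "connected {s. b < Re s \<and> Re s < c}"
proof -
  show "connected {s. Re s > b}" by (intro convex_connected convex_halfspace_Re_gt)
  have "{s. b < Re s \<and> Re s < c} = {s. Re s > b} \<inter> {s. Re s < c}" by auto
  then show "connected {s. b < Re s \<and> Re s < c}"
    by (metis convex_connected convex_Int convex_halfspace_Re_gt convex_halfspace_Re_lt)
qed

lemma islimpt_of_real_Ioo:
  assumes "a < x" "x < (b::real)"
  shows "complex_of_real x islimpt (of_real ` {a<..<b})"
proof -
  have "x islimpt {a<..<b}" using assms by (intro interior_limit_point) (auto simp: interior_open)
  then show ?thesis by (rule islimpt_isCont_image) (auto simp: eventually_at_filter intro!: always_eventually)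
qed

lemma zeta_right_eq_zeta_left:
  assumes "-1 < Re s" "Re s < 0"
  shows "zeta_right s = zeta_left s"
proof -
  let ?S = "{s. -1 < Re s \<and> Re s < 0}"
  have "open ?S" by (intro open_Collect_conj open_halfspace_Re_gt open_halfspace_Re_lt)
  have "zeta_right s - zeta_left s = 0"
  proof (rule analytic_continuation[of "\<lambda>s. zeta_right s - zeta_left s" ?S "of_real ` {-1<..<0}" "of_real (-1/2)"])
    show "(\<lambda>s. zeta_right s - zeta_left s) holomorphic_on ?S"
      by (intro holomorphic_on_diff holomorphic_on_subset[OF zeta_right_holomorphic] holomorphic_on_subset[OF zeta_left_holomorphic]) auto
    show "complex_of_real (-1/2) islimpt (of_real ` {-1<..<0})" by (rule islimpt_of_real_Ioo) auto
  qed (use assms \<open>open ?S\<close> halfspaces_connected zeta_right_eq_zeta_left_real in auto)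
  then show ?thesis by simp
qed

text \<open>The values agree on the real half-line, hence on the half-plane by the identity theorem.\<close>
lemma dirichlet_sums_zeta_right:
  assumes s: "Re s > 1"
  shows "(\<lambda>n. 1 / of_nat (Suc n) powr s) sums zeta_right s"
proof -
  define D where "D = (\<lambda>s::complex. \<Sum>n. 1 / of_nat (Suc n) powr s)"
  let ?S = "{s::complex. Re s > 1}"
  have nrm: "norm (1 / of_nat (Suc n) powr z :: complex) = real (Suc n) powr (- Re z)" for n z
    by (simp add: norm_divide norm_powr_real_powr powr_minus_divide del: of_nat_Suc)
  have summ: "summable (\<lambda>n. 1 / of_nat (Suc n) powr z :: complex)" if "Re z > 1" for z
    by (rule summable_norm_cancel) (use real_dirichlet_sums[OF that] in \<open>simp only: nrm sums_iff\<close>)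
  have hol: "D holomorphic_on ?S"
  proof (rule holomorphic_uniform_sequence[of ?S "\<lambda>N s. \<Sum>n<N. 1 / of_nat (Suc n) powr s"])
    show "open ?S" by (rule open_halfspace_Re_gt)
    show "(\<lambda>s. \<Sum>n<N. 1 / of_nat (Suc n) powr s) holomorphic_on ?S" for N
      by (auto intro!: holomorphic_intros simp del: of_nat_Suc)
    fix z :: complex assume z: "z \<in> ?S"
    define d where "d = (Re z - 1) / 2"
    have d: "d > 0" using z by (simp add: d_def)
    have ge: "Re w \<ge> 1 + d" if "w \<in> cball z d" for w
      using that abs_Re_le_cmod[of "z - w"] by (auto simp: dist_norm d_def field_simps)
    have "uniform_limit (cball z d) (\<lambda>N s. \<Sum>n<N. 1 / of_nat (Suc n) powr s) D sequentially"
      unfolding D_def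
    proof (rule Weierstrass_m_test)
      show "norm (1 / of_nat (Suc n) powr w :: complex) \<le> real (Suc n) powr (-(1+d))" if "w \<in> cball z d" for n w
        unfolding nrm using ge[OF that] by (intro powr_mono) auto
      show "summable (\<lambda>n. real (Suc n) powr (-(1+d)))"
        using real_dirichlet_sums[of "1+d"] d by (simp only: sums_iff)
    qed
    moreover have "cball z d \<subseteq> ?S" using ge d by fastforce
    ultimately show "\<exists>d>0. cball z d \<subseteq> ?S \<and> uniform_limit (cball z d) (\<lambda>N s. \<Sum>n<N. 1 / of_nat (Suc n) powr s) D sequentially"
      using d by blast
  qed
  have "D s - zeta_right s = 0"
  proof (rule analytic_continuation[of "\<lambda>s. D s - zeta_right s" ?S "of_real ` {1<..<3}" "of_real 2"])
    show "(\<lambda>s. D s - zeta_right s) holomorphic_on ?S"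
      by (intro holomorphic_on_diff hol holomorphic_on_subset[OF zeta_right_holomorphic]) auto
    show "complex_of_real 2 islimpt (of_real ` {1<..<3})" by (rule islimpt_of_real_Ioo) auto
    show "D z - zeta_right z = 0" if "z \<in> complex_of_real ` {1<..<3}" for z
    proof -
      obtain x where x: "z = of_real x" "x > 1" using \<open>z \<in> _\<close> by auto
      have "complex_of_real (real (Suc n) powr (-x)) = 1 / of_nat (Suc n) powr z" for n
        using powr_of_real[of "real (Suc n)" x] by (simp add: x powr_minus_divide del: of_nat_Suc)
      then have "(\<lambda>n. 1 / of_nat (Suc n) powr z) sums complex_of_real (real_dirichlet x)"
        using sums_of_real[OF real_dirichlet_sums[OF x(2)], where 'a=complex] by simp
      then show ?thesis using zeta_right_of_real[OF x(2)] by (simp add: D_def x(1) sums_iff)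
    qed
    show "open ?S" by (rule open_halfspace_Re_gt)
    show "connected ?S" by (rule halfspaces_connected)
  qed (use s in auto)
  then have "D s = zeta_right s" by simp
  then show ?thesis using summ[OF s] by (simp add: D_def sums_iff)
qed

text \<open>The two formulas agree on the strip where both are defined.\<close>
lemma glued_zeta_holomorphic:
  "(\<lambda>s. if s \<in> {s. Re s > -1} - {1} then zeta_right s else zeta_left s) holomorphic_on - {1}"
proof -
  have "(\<lambda>s. if s \<in> {s. Re s > -1} - {1} then zeta_right s else zeta_left s) holomorphic_on
          (({s. Re s > -1} - {1}) \<union> {s. Re s < 0})"
    by (intro holomorphic_on_If_Un zeta_right_holomorphic zeta_left_holomorphic open_delete open_halfspace_Re_gt open_halfspace_Re_lt)
       (auto intro: zeta_right_eq_zeta_left)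
  moreover have "({s. Re s > -1} - {1}) \<union> {s. Re s < 0} = - {1}" by auto
  ultimately show ?thesis by simp
qed

text \<open>The glued function has the defining properties of \<open>zeta\<close>, and by the identity theorem it is the only
function that has them.\<close>
lemma zeta_eq:
  assumes "s \<noteq> 1"
  shows "zeta s = (if Re s > -1 then zeta_right s else zeta_left s)"
proof -
  let ?P = "\<lambda>f. f holomorphic_on (- {1}) \<and> f 1 = 0 \<and>
             (\<forall>s. Re s > 1 \<longrightarrow> (\<lambda>n. 1 / of_nat (Suc n) powr s) sums f s)"
  define Z :: "complex \<Rightarrow> complex" where "Z = (\<lambda>s. if s = 1 then 0 else if Re s > -1 then zeta_right s else zeta_left s)"
  note glued_zeta_holomorphic
  then have "Z holomorphic_on -{1}" by (rule holomorphic_transform) (auto simp: Z_def)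
  moreover have "(\<lambda>n. 1 / of_nat (Suc n) powr s) sums Z s" if "Re s > 1" for s
    using dirichlet_sums_zeta_right[OF that] that by (auto simp: Z_def)
  ultimately have PZ: "?P Z" by (simp add: Z_def)
  have zetaZ: "zeta = Z" unfolding zeta_def
  proof (rule the_equality[where P="?P", OF PZ])
    fix f assume f: "?P f"
    have "f s - Z s = 0" if s: "s \<noteq> 1" for s
    proof (rule analytic_continuation_open[of "{s. Re s > 1}" "- {1}" "\<lambda>s. f s - Z s" "\<lambda>_. 0" s])
      show "connected (- {1::complex})" by (rule connected_punctured_universe) simp
      have "2 \<in> {s. Re s > 1}" by simp
      then show "{s::complex. Re s > 1} \<noteq> {}" by blast
      show "(\<lambda>s. f s - Z s) holomorphic_on - {1}" using f PZ by (intro holomorphic_on_diff) auto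
      show "f s - Z s = 0" if "s \<in> {s. Re s > 1}" for s
        using f PZ that sums_unique2[of _ "f s" "Z s"] by auto
    qed (use s in \<open>auto simp: open_halfspace_Re_gt\<close>)
    then show "f = Z" using f PZ by (metis eq_iff_diff_eq_0 ext)
  qed
  show ?thesis using assms unfolding zetaZ Z_def by simp
qed

lemma zeta_holomorphic: "zeta holomorphic_on -{1}"
proof -
  note glued_zeta_holomorphic
  then show ?thesis by (rule holomorphic_transform) (auto simp: zeta_eq)
qed

section \<open>The completed zeta function\<close>

lemma not_pi_le_zero: "\<not> pi \<le> 0"
  using pi_gt_zero by linarith

lemma zeta_analytic_at: "s \<noteq> 1 \<Longrightarrow> zeta analytic_on {s}"
  using zeta_holomorphic by (subst analytic_at) (intro exI[of _ "-{1}"], auto)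

lemma zeta_meromorphic: "zeta meromorphic_on UNIV"
proof -
  have "zeta meromorphic_on {s}" for s
  proof (cases "s = 1")
    case True
    have "bose_mellin analytic_on {1}"
      using bose_mellin_holomorphic open_halfspace_Re_gt[of "-1"] by (subst analytic_at) (intro exI[of _ "{s. Re s > -1}"], auto)
    then have "zeta_right meromorphic_on {1}"
      unfolding zeta_right_def
      by (intro meromorphic_intros analytic_on_imp_meromorphic_on) (auto intro!: analytic_intros)
    moreover have "eventually (\<lambda>w::complex. w \<in> {s. Re s > -1} - {1}) (at 1)"
      by (rule eventually_at_in_open) (auto simp: open_halfspace_Re_gt)
    then have "eventually (\<lambda>w. zeta_right w = zeta w) (at 1)"
      by eventually_elim (auto simp: zeta_eq)
    ultimately show ?thesis using True meromorphic_on_cong[of "{1}" zeta_right zeta "{1}"] by auto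
  qed (use zeta_analytic_at in \<open>auto intro: analytic_on_imp_meromorphic_on\<close>)
  then show ?thesis by (subst meromorphic_on_meromorphic_at) auto
qed

lemma xi_meromorphic: "xi meromorphic_on UNIV"
proof -
  have G: "Gamma = (\<lambda>z::complex. inverse (rGamma z))" by (auto simp: rGamma_inverse_Gamma)
  have "(\<lambda>s. of_real pi powr (- s / 2) * inverse (rGamma (s / 2)) * zeta s) meromorphic_on UNIV"
    by (intro meromorphic_intros zeta_meromorphic analytic_on_imp_meromorphic_on) (auto intro!: analytic_intros simp: not_pi_le_zero)
  then show ?thesis unfolding xi_def[abs_def] G by simp
qed

lemma xi_meromorphic_affine: "(\<lambda>s. xi (a * s + b)) meromorphic_on UNIV"
  by (rule meromorphic_on_compose[OF xi_meromorphic]) (auto intro!: analytic_intros)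

text \<open>The second hypothesis excludes the poles of \<open>\<Gamma>(s / 2)\<close>, where the default value 0 of \<open>Gamma\<close>
makes \<open>xi s = 0\<close>.\<close>
lemma xi_zeta_left:
  assumes "Re s < 0" "s / 2 \<notin> \<int>\<^sub>\<le>\<^sub>0"
  shows "xi s = xi (1 - s)"
proof -
  have z: "zeta s = zeta_left s" using assms zeta_right_eq_zeta_left[of s] by (cases "s = 1") (auto simp: zeta_eq)
  have "1 - s \<noteq> 1" "Re (1 - s) > -1" using assms by auto
  then have z1: "zeta (1 - s) = zeta_right (1 - s)" by (subst zeta_eq) auto
  have G: "Gamma (s/2) * rGamma (s/2) = 1" using assms by (simp add: rGamma_inverse_Gamma Gamma_eq_zero_iff)
  have "xi s = (of_real pi powr (- s / 2) * of_real pi powr (s - 1/2)) * (Gamma (s/2) * rGamma (s/2)) * (Gamma ((1 - s) / 2) * zeta (1 - s))"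
    unfolding xi_def z z1 zeta_left_def by (simp only: mult_ac)
  also have "of_real pi powr (- s / 2) * of_real pi powr (s - 1/2) = complex_of_real pi powr (- (1 - s) / 2)"
  proof -
    have "- s / 2 + (s - 1/2) = - (1 - s) / 2" by (simp add: field_simps)
    then show ?thesis by (simp only: flip: powr_add)
  qed
  finally show ?thesis unfolding G by (simp add: xi_def)
qed

text \<open>Near \<open>-1\<close> this is the definition of \<open>zeta_left\<close>; a meromorphic function on the plane that
vanishes near a point vanishes.\<close>
lemma xi_one_minus: "\<forall>\<^sub>\<approx>s\<in>UNIV. xi s = xi (1 - s)"
proof -
  have "(\<lambda>s. xi s - xi (1 - s)) meromorphic_on UNIV"
    using xi_meromorphic xi_meromorphic_affine[of "-1" 1] by (intro meromorphic_intros) auto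
  then have "(\<forall>\<^sub>\<approx>s\<in>UNIV. xi s - xi (1 - s) = 0) \<or> (\<forall>\<^sub>\<approx>s\<in>UNIV. xi s - xi (1 - s) \<noteq> 0)"
    by (rule meromorphic_imp_constant_or_avoid) auto
  moreover have "\<not> (\<forall>\<^sub>\<approx>s\<in>UNIV. xi s - xi (1 - s) \<noteq> 0)"
  proof
    assume "\<forall>\<^sub>\<approx>s\<in>UNIV. xi s - xi (1 - s) \<noteq> 0"
    then have "eventually (\<lambda>s. xi s - xi (1 - s) \<noteq> 0) (at (-1))"
      by (rule eventually_cosparse_imp_eventually_at) auto
    moreover have "eventually (\<lambda>s::complex. s \<in> ball (-1) 1 - {-1}) (at (-1))"
      by (rule eventually_at_in_open) auto
    \<comment> \<open>On this disc \<open>-2 < Re s < 0\<close>, so \<open>s / 2\<close> is not a pole of \<open>Gamma\<close>.\<close>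
    then have "eventually (\<lambda>s. xi s - xi (1 - s) = 0) (at (-1))"
    proof eventually_elim
      case (elim s)
      have re: "-2 < Re s" "Re s < 0" using elim abs_Re_le_cmod[of "-1 - s"] by (auto simp: dist_norm)
      have "s / 2 \<notin> \<int>\<^sub>\<le>\<^sub>0"
      proof
        assume "s / 2 \<in> \<int>\<^sub>\<le>\<^sub>0"
        then obtain n where n: "s / 2 = of_int n" by (auto elim!: nonpos_Ints_cases)
        have "Re s / 2 = Re (s / 2)" by simp
        then have "Re s = 2 * of_int n" unfolding n by simp
        with re have "-1 < n" "n < 0" by linarith+
        then show False by simp
      qed
      then show ?case using xi_zeta_left re by simp
    qed
    ultimately have "eventually (\<lambda>s::complex. False) (at (-1))" by eventually_elim auto
    then show False by simp
  qed
  ultimately show ?thesis by (auto elim: eventually_mono)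
qed

lemma zeta_of_nat_nonzero:
  assumes "n \<ge> 2" shows "zeta (of_nat n) \<noteq> 0"
proof -
  have "complex_of_nat n \<noteq> 1" using assms by (metis of_nat_1 of_nat_eq_iff one_less_numeral_iff not_le semiring_norm(76))
  then have "zeta (of_nat n) = zeta_right (of_real (real n))" by (simp add: zeta_eq)
  also have "\<dots> = of_real (real_dirichlet (real n))" using assms by (intro zeta_right_of_real) auto
  finally show ?thesis using real_dirichlet_pos[of "real n"] assms by auto
qed

text \<open>The factors \<open>\<xi>(ht b)\<close> that come from roots of level 0 do not depend on \<open>s\<close>, so genericity of
\<open>s\<close> cannot keep them finite and nonzero.\<close>
lemma xi_analytic_of_nat:
  assumes "n \<ge> 2" shows "xi analytic_on {of_nat n}" "xi (of_nat n) \<noteq> 0"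
proof -
  have n1: "complex_of_nat n \<noteq> 1" using assms by (metis of_nat_1 of_nat_eq_iff one_less_numeral_iff not_le semiring_norm(76))
  have pos: "complex_of_nat n / 2 \<notin> \<int>\<^sub>\<le>\<^sub>0"
  proof
    assume "complex_of_nat n / 2 \<in> \<int>\<^sub>\<le>\<^sub>0"
    then obtain m where "complex_of_nat n / 2 = of_int m" "m \<le> 0" by (auto elim!: nonpos_Ints_cases)
    then have "Re (complex_of_nat n / 2) = of_int m" by simp
    then show False using assms \<open>m \<le> 0\<close> by simp
  qed
  then show "xi analytic_on {of_nat n}" unfolding xi_def[abs_def]
    by (auto intro!: analytic_intros zeta_analytic_at n1 simp: not_pi_le_zero)
  show "xi (of_nat n) \<noteq> 0" using pos zeta_of_nat_nonzero[OF assms]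
    by (auto simp: xi_def Gamma_eq_zero_iff)
qed

lemma xi_nonzero: "\<forall>\<^sub>\<approx>s\<in>UNIV. xi s \<noteq> 0"
proof -
  have "(\<forall>\<^sub>\<approx>s\<in>UNIV. xi s = 0) \<or> (\<forall>\<^sub>\<approx>s\<in>UNIV. xi s \<noteq> 0)"
    by (rule meromorphic_imp_constant_or_avoid[OF xi_meromorphic]) auto
  moreover have "\<not> (\<forall>\<^sub>\<approx>s\<in>UNIV. xi s = 0)"
  proof
    assume "\<forall>\<^sub>\<approx>s\<in>UNIV. xi s = 0"
    then have "eventually (\<lambda>s. xi s = 0) (at (of_nat 2))"
      by (rule eventually_cosparse_imp_eventually_at) auto
    moreover have "xi \<midarrow>of_nat 2\<rightarrow> xi (of_nat 2)"
      using analytic_at_imp_isCont[OF xi_analytic_of_nat(1)[of 2]] by (simp add: isCont_def)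
    ultimately have "((\<lambda>_. 0) \<longlongrightarrow> xi (of_nat 2)) (at (of_nat 2 :: complex))"
      by (rule Lim_transform_eventually[rotated])
    then show False using xi_analytic_of_nat(2)[of 2] by (simp add: tendsto_const_iff)
  qed
  ultimately show ?thesis by auto
qed

definition xi_residue_factor :: "complex \<Rightarrow> complex" where
  "xi_residue_factor z = (if z = 0 then 1 else z * xi (1 + z))"

text \<open>That the removed value is 1 says that \<open>\<xi>\<close> has residue 1 at its pole 1, by \<open>\<Gamma>(1/2) = \<surd>\<pi>\<close>.\<close>
lemma xi_residue_factor_analytic: "xi_residue_factor analytic_on {0}"
proof -
  define f where "f = (\<lambda>z. of_real pi powr (- (1 + z) / 2) * Gamma ((1 + z) / 2) *
     (rGamma (1 + z) * (z * bose_mellin (1 + z) + 1) - z * rGamma (2 + z) / 2))"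
  have "1/2 \<notin> (\<int>\<^sub>\<le>\<^sub>0 :: complex set)"
  proof
    assume "1/2 \<in> (\<int>\<^sub>\<le>\<^sub>0 :: complex set)"
    then obtain m where m: "1 / 2 = complex_of_int m" "m \<le> 0" by (elim nonpos_Ints_cases) metis
    have "Re (1 / 2) = of_int m" unfolding m(1) by simp
    then show False using m(2) by simp
  qed
  moreover have "(\<lambda>z. bose_mellin (1 + z)) analytic_on {0}"
  proof -
    have "bose_mellin analytic_on {1}"
      using bose_mellin_holomorphic open_halfspace_Re_gt[of "-1"] by (subst analytic_at) (intro exI[of _ "{s. Re s > -1}"], auto)
    then have "bose_mellin \<circ> (\<lambda>z. 1 + z) analytic_on {0}"
      by (intro analytic_on_compose analytic_intros) auto
    then show ?thesis by (simp add: o_def)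
  qed
  ultimately have "f analytic_on {0}" unfolding f_def by (auto intro!: analytic_intros simp: not_pi_le_zero)
  moreover have "eventually (\<lambda>z. z \<in> {s. Re s > -2}) (nhds (0::complex))"
    by (rule eventually_nhds_in_open) (auto simp: open_halfspace_Re_gt)
  then have "eventually (\<lambda>z. f z = xi_residue_factor z) (nhds 0)"
  proof eventually_elim
    case (elim z)
    show ?case
    proof (cases "z = 0")
      case True
      have "complex_of_real pi powr (-1/2) * of_real (sqrt pi) = of_real (pi powr (-1/2) * pi powr (1/2))"
        using powr_of_real[of pi "-1/2"] by (simp add: powr_half_sqrt)
      also have "pi powr (-1/2) * pi powr (1/2) = 1" by (simp flip: powr_add)
      finally show ?thesis using True by (simp add: f_def xi_residue_factor_def Gamma_one_half_complex)
    next
      case False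
      then have "zeta (1 + z) = zeta_right (1 + z)" using elim by (subst zeta_eq) auto
      moreover have "rGamma (1 + z) * (z * bose_mellin (1 + z) + 1) - z * rGamma (2 + z) / 2 = z * zeta_right (1 + z)"
        using False by (simp add: zeta_right_def field_simps)
      ultimately have "f z = of_real pi powr (- (1 + z) / 2) * Gamma ((1 + z) / 2) * (z * zeta (1 + z))"
        by (simp only: f_def)
      then show ?thesis using False by (simp only: xi_residue_factor_def xi_def mult_ac if_False)
    qed
  qed
  ultimately show ?thesis using analytic_at_cong[of f xi_residue_factor 0 0] by simp
qed

section \<open>Root systems with a base\<close>

text \<open>The index sets below are \<open>{1..DIM('v)}\<close>; their lower bound is to stay in the form 1.\<close>
declare One_nat_def [simp del]

lemma coroot_coroot [simp]: "coroot (coroot a) = a"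
  by (cases "a = 0") (auto simp: coroot_def field_simps)

lemma coroot_minus [simp]: "coroot (- a) = - coroot a"
  by (simp add: coroot_def)

lemma coroot_eq_iff: "coroot a = coroot b \<longleftrightarrow> a = b"
  by (metis coroot_coroot)

lemma coroot_isometry:
  assumes "linear w" "\<And>x y. w x \<bullet> w y = x \<bullet> y"
  shows "coroot (w a) = w (coroot a)"
  using assms by (simp add: coroot_def linear_cmul)

lemma linear_refl: "linear (refl a)"
  unfolding refl_def by (auto intro!: linearI simp: algebra_simps inner_right_distrib scaleR_left_distrib)

lemma refl_self: "a \<noteq> 0 \<Longrightarrow> refl a a = - a"
  by (simp add: refl_def coroot_def scaleR_2)

lemma refl_inner: "refl a x \<bullet> refl a y = x \<bullet> y"
proof (cases "a = 0")
  case False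
  then have "coroot a \<bullet> x * (a \<bullet> a) = 2 * (a \<bullet> x)" for x by (simp add: coroot_def)
  note c = this
  have "refl a x \<bullet> refl a y = x \<bullet> y - (coroot a \<bullet> y) * (a \<bullet> x) - (coroot a \<bullet> x) * (a \<bullet> y)
         + (coroot a \<bullet> x) * (coroot a \<bullet> y * (a \<bullet> a))"
    by (simp add: refl_def inner_diff_left inner_diff_right inner_commute algebra_simps)
  also have "\<dots> = x \<bullet> y + (coroot a \<bullet> x) * (a \<bullet> y) - (coroot a \<bullet> y) * (a \<bullet> x)"
    unfolding c by (simp add: algebra_simps)
  also have "(coroot a \<bullet> x) * (a \<bullet> y) = (coroot a \<bullet> y) * (a \<bullet> x)" by (simp add: coroot_def)
  finally show ?thesis by simp
qed (simp add: refl_def)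

lemma refl_refl: "refl a (refl a x) = x"
proof (cases "a = 0")
  case False
  have "refl a (x - c *\<^sub>R a) = refl a x - c *\<^sub>R refl a a" for c
    using linear_refl[of a] by (simp add: linear_diff linear_cmul)
  then have "refl a (refl a x) = refl a x - (coroot a \<bullet> x) *\<^sub>R refl a a"
    by (subst (2) refl_def)
  also have "\<dots> = x" using refl_self[OF False] by (simp add: refl_def)
  finally show ?thesis .
qed (simp add: refl_def)

lemma refl_isometry:
  assumes "linear w" "\<And>x y. w x \<bullet> w y = x \<bullet> y"
  shows "w (refl a b) = refl (w a) (w b)"
  using assms by (simp add: refl_def coroot_isometry linear_diff linear_cmul)

locale based_root_system =
  fixes \<Phi> :: "'v::euclidean_space set" and \<alpha> :: "nat \<Rightarrow> 'v"
  assumes root_system: "root_system \<Phi>" and fundamental_system: "fundamental_system \<Phi> \<alpha>"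
begin

abbreviation (input) pos where "pos \<equiv> positive_roots \<Phi> \<alpha>"
abbreviation (input) neg where "neg \<equiv> negative_roots \<Phi> \<alpha>"
abbreviation (input) fw where "fw \<equiv> fundamental_weight \<alpha>"
abbreviation (input) \<rho> where "\<rho> \<equiv> rho \<Phi> \<alpha>"
abbreviation (input) ht where "ht \<equiv> coroot_height \<Phi> \<alpha>"

lemma finite_roots: "finite \<Phi>" and zero_not_root: "0 \<notin> \<Phi>" and span_roots: "span \<Phi> = UNIV"
  and coroot_root_int: "a \<in> \<Phi> \<Longrightarrow> b \<in> \<Phi> \<Longrightarrow> coroot a \<bullet> b \<in> \<int>"
  and reduced: "a \<in> \<Phi> \<Longrightarrow> c *\<^sub>R a \<in> \<Phi> \<Longrightarrow> c = 1 \<or> c = -1"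
  using root_system by (auto simp: root_system_def)

lemma refl_root: "a \<in> \<Phi> \<Longrightarrow> b \<in> \<Phi> \<Longrightarrow> refl a b \<in> \<Phi>"
  using root_system by (auto simp: root_system_def)

lemma uminus_root: "a \<in> \<Phi> \<Longrightarrow> - a \<in> \<Phi>"
  using refl_root[of a a] refl_self[of a] zero_not_root by metis

lemma inj_simple: "inj_on \<alpha> {1..DIM('v)}" and simple_root: "i \<in> {1..DIM('v)} \<Longrightarrow> \<alpha> i \<in> \<Phi>"
  and independent_simple: "independent (\<alpha> ` {1..DIM('v)})"
  using fundamental_system by (auto simp: fundamental_system_def)

lemma simple_nonzero: "i \<in> {1..DIM('v)} \<Longrightarrow> \<alpha> i \<noteq> 0"
  using simple_root zero_not_root by metis

lemma span_simple: "span (\<alpha> ` {1..DIM('v)}) = UNIV"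
proof -
  have "card (\<alpha> ` {1..DIM('v)}) = DIM('v)" using card_image[OF inj_simple] by simp
  then show ?thesis
    using card_eq_dim[of "\<alpha> ` {1..DIM('v)}" UNIV] independent_simple by auto
qed

lemma linear_simple_unique:
  assumes "linear f" "linear g" "\<And>i. i \<in> {1..DIM('v)} \<Longrightarrow> f (\<alpha> i) = g (\<alpha> i)"
  shows "f x = g x"
  by (rule linear_eq_on_span[of f g "\<alpha> ` {1..DIM('v)}"]) (use assms span_simple in auto)

lemma linear_simple_exists: "\<exists>f. linear f \<and> (\<forall>i\<in>{1..DIM('v)}. f (\<alpha> i) = g i)"
proof -
  obtain f where f: "linear f" "\<And>x. x \<in> \<alpha> ` {1..DIM('v)} \<Longrightarrow> f x = g (the_inv_into {1..DIM('v)} \<alpha> x)"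
    using linear_independent_extend[OF independent_simple, of "\<lambda>x. g (the_inv_into {1..DIM('v)} \<alpha> x)"] by blast
  then have "\<forall>i\<in>{1..DIM('v)}. f (\<alpha> i) = g i" by (auto simp: the_inv_into_f_f[OF inj_simple])
  with f(1) show ?thesis by blast
qed

lemma eq_zero_simple: 
  assumes "\<And>i. i \<in> {1..DIM('v)} \<Longrightarrow> \<alpha> i \<bullet> x = 0" shows "x = 0"
proof -
  have "(\<lambda>y. y \<bullet> x) x = (\<lambda>y. 0) x"
    by (rule linear_simple_unique) (use assms in \<open>auto intro!: linearI simp: inner_left_distrib\<close>)
  then show ?thesis by simp
qed

lemma eq_simple:
  assumes "\<And>i. i \<in> {1..DIM('v)} \<Longrightarrow> coroot (\<alpha> i) \<bullet> x = coroot (\<alpha> i) \<bullet> y" shows "x = y"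
proof -
  have "\<alpha> i \<bullet> (x - y) = 0" if "i \<in> {1..DIM('v)}" for i
    using assms[OF that] simple_nonzero[OF that] by (auto simp: coroot_def inner_diff_right)
  then have "x - y = 0" by (rule eq_zero_simple)
  then show ?thesis by simp
qed

text \<open>The dual basis exists because a linear functional on a Euclidean space is the inner product with a
vector, namely the adjoint applied to 1.\<close>
lemma coroot_simple_fw:
  assumes "i \<in> {1..DIM('v)}" shows "coroot (\<alpha> i) \<bullet> fw j = (if i = j then 1 else 0)"
proof -
  obtain f where f: "linear f" "\<forall>i\<in>{1..DIM('v)}. f (\<alpha> i) = (\<alpha> i \<bullet> \<alpha> i) / 2 * (if i = j then 1 else (0::real))"
    using linear_simple_exists[of "\<lambda>i. (\<alpha> i \<bullet> \<alpha> i) / 2 * (if i = j then 1 else 0)"] by blast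
  define v where "v = adjoint f 1"
  have "\<alpha> i \<bullet> v = f (\<alpha> i)" for i using adjoint_works[OF f(1), of "\<alpha> i" 1] by (simp add: v_def)
  then have "\<forall>i\<in>{1..DIM('v)}. coroot (\<alpha> i) \<bullet> v = (if i = j then 1 else 0)"
    using f(2) simple_nonzero by (auto simp: coroot_def)
  moreover have "u = v" if "\<forall>i\<in>{1..DIM('v)}. coroot (\<alpha> i) \<bullet> u = (if i = j then 1 else 0)" for u
    using that calculation by (intro eq_simple) auto
  ultimately have "\<forall>i\<in>{1..DIM('v)}. coroot (\<alpha> i) \<bullet> fw j = (if i = j then 1 else 0)"
    unfolding fundamental_weight_def by (rule theI)
  then show ?thesis using assms by blast
qed

lemma fw_coroot_simple: "i \<in> {1..DIM('v)} \<Longrightarrow> fw j \<bullet> coroot (\<alpha> i) = (if i = j then 1 else 0)"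
  using coroot_simple_fw by (simp add: inner_commute)

lemma fw_simple: "i \<in> {1..DIM('v)} \<Longrightarrow> fw j \<bullet> \<alpha> i = (if i = j then (\<alpha> i \<bullet> \<alpha> i) / 2 else 0)"
  using fw_coroot_simple[of i j] simple_nonzero[of i] by (auto simp: coroot_def field_simps split: if_splits)

lemma expand_fw: "x = (\<Sum>j\<in>{1..DIM('v)}. (coroot (\<alpha> j) \<bullet> x) *\<^sub>R fw j)"
proof (rule eq_simple)
  fix i assume i: "i \<in> {1..DIM('v)}"
  then have "coroot (\<alpha> i) \<bullet> (\<Sum>j\<in>{1..DIM('v)}. (coroot (\<alpha> j) \<bullet> x) *\<^sub>R fw j) = (\<Sum>j\<in>{1..DIM('v)}. (coroot (\<alpha> j) \<bullet> x) * (if i = j then 1 else 0))"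
    by (simp add: inner_sum_right coroot_simple_fw)
  then show "coroot (\<alpha> i) \<bullet> x = coroot (\<alpha> i) \<bullet> (\<Sum>j\<in>{1..DIM('v)}. (coroot (\<alpha> j) \<bullet> x) *\<^sub>R fw j)"
    using i by (simp add: if_distrib[of "times _"] cong: if_cong)
qed

lemma eq_fw:
  assumes "\<And>j. j \<in> {1..DIM('v)} \<Longrightarrow> fw j \<bullet> x = fw j \<bullet> y" shows "x = y"
proof -
  have "z \<bullet> x = z \<bullet> y" for z
    by (subst (1 2) expand_fw[of z]) (simp add: inner_sum_left assms)
  then show ?thesis by (metis inner_eq_zero_iff inner_diff_right right_minus_eq)
qed

lemma expand_coroot: "x = (\<Sum>j\<in>{1..DIM('v)}. (fw j \<bullet> x) *\<^sub>R coroot (\<alpha> j))"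
proof (rule eq_fw)
  fix i assume i: "i \<in> {1..DIM('v)}"
  have "fw i \<bullet> (\<Sum>j\<in>{1..DIM('v)}. (fw j \<bullet> x) *\<^sub>R coroot (\<alpha> j)) = (\<Sum>j\<in>{1..DIM('v)}. (fw j \<bullet> x) * (if j = i then 1 else 0))"
    unfolding inner_sum_right inner_scaleR_right by (intro sum.cong) (simp_all add: fw_coroot_simple)
  then show "fw i \<bullet> x = fw i \<bullet> (\<Sum>j\<in>{1..DIM('v)}. (fw j \<bullet> x) *\<^sub>R coroot (\<alpha> j))"
    using i by (simp add: if_distrib[of "times _"] cong: if_cong)
qed

lemma fw_sum_simple:
  assumes "j \<in> {1..DIM('v)}" shows "fw j \<bullet> (\<Sum>i\<in>{1..DIM('v)}. c i *\<^sub>R \<alpha> i) = c j * ((\<alpha> j \<bullet> \<alpha> j) / 2)"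
proof -
  have "fw j \<bullet> (\<Sum>i\<in>{1..DIM('v)}. c i *\<^sub>R \<alpha> i) = (\<Sum>i\<in>{1..DIM('v)}. if i = j then c j * ((\<alpha> j \<bullet> \<alpha> j) / 2) else 0)"
    unfolding inner_sum_right inner_scaleR_right by (intro sum.cong) (simp_all add: fw_simple)
  then show ?thesis using assms by simp
qed

lemma fw_zero: "(\<And>j. j \<in> {1..DIM('v)} \<Longrightarrow> fw j \<bullet> x = 0) \<Longrightarrow> x = 0"
  using eq_fw[of x 0] by simp

text \<open>Positivity is used in this form throughout: pairings with the fundamental weights replace the
coefficients with respect to the simple roots.\<close>
lemma pos_iff: "b \<in> pos \<longleftrightarrow> b \<in> \<Phi> \<and> (\<forall>j\<in>{1..DIM('v)}. 0 \<le> fw j \<bullet> b)"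
proof
  assume "b \<in> pos"
  then obtain c :: "nat \<Rightarrow> nat" where "b \<in> \<Phi>" "b = (\<Sum>i\<in>{1..DIM('v)}. real (c i) *\<^sub>R \<alpha> i)"
    by (auto simp: positive_roots_def)
  then show "b \<in> \<Phi> \<and> (\<forall>j\<in>{1..DIM('v)}. 0 \<le> fw j \<bullet> b)" by (auto simp: fw_sum_simple)
next
  assume b: "b \<in> \<Phi> \<and> (\<forall>j\<in>{1..DIM('v)}. 0 \<le> fw j \<bullet> b)"
  then obtain c :: "nat \<Rightarrow> nat" where c: "b = (\<Sum>i\<in>{1..DIM('v)}. real (c i) *\<^sub>R \<alpha> i) \<or> b = - (\<Sum>i\<in>{1..DIM('v)}. real (c i) *\<^sub>R \<alpha> i)"
    using fundamental_system unfolding fundamental_system_def by blast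
  show "b \<in> pos"
  proof (cases "b = (\<Sum>i\<in>{1..DIM('v)}. real (c i) *\<^sub>R \<alpha> i)")
    case False
    then have bm: "b = - (\<Sum>i\<in>{1..DIM('v)}. real (c i) *\<^sub>R \<alpha> i)" using c by blast
    have "fw j \<bullet> b = 0" if "j \<in> {1..DIM('v)}" for j
    proof -
      have "fw j \<bullet> b = - (real (c j) * ((\<alpha> j \<bullet> \<alpha> j) / 2))" unfolding bm inner_minus_right fw_sum_simple[OF that] ..
      then have "fw j \<bullet> b \<le> 0" by simp
      then show ?thesis using b that by force
    qed
    then have "b = 0" by (rule fw_zero)
    then show ?thesis using b zero_not_root by simp
  qed (use b in \<open>auto simp: positive_roots_def\<close>)
qed

lemma neg_iff: "b \<in> neg \<longleftrightarrow> - b \<in> pos"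
  unfolding negative_roots_def by (metis (no_types, lifting) image_iff minus_minus)

lemma root_sign: "b \<in> \<Phi> \<Longrightarrow> b \<in> pos \<or> - b \<in> pos"
proof -
  assume b: "b \<in> \<Phi>"
  then obtain c :: "nat \<Rightarrow> nat" where c: "b = (\<Sum>i\<in>{1..DIM('v)}. real (c i) *\<^sub>R \<alpha> i) \<or> b = - (\<Sum>i\<in>{1..DIM('v)}. real (c i) *\<^sub>R \<alpha> i)"
    using fundamental_system unfolding fundamental_system_def by blast
  then show ?thesis
  proof
    assume "b = - (\<Sum>i\<in>{1..DIM('v)}. real (c i) *\<^sub>R \<alpha> i)"
    then have "- b = (\<Sum>i\<in>{1..DIM('v)}. real (c i) *\<^sub>R \<alpha> i)" by simp
    then show ?thesis using uminus_root[OF b] by (auto simp: positive_roots_def)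
  qed (use b in \<open>auto simp: positive_roots_def\<close>)
qed

lemma pos_root: "b \<in> pos \<Longrightarrow> b \<in> \<Phi>" by (simp add: positive_roots_def)

lemma finite_pos: "finite pos" using finite_roots by (rule finite_subset[rotated]) (auto intro: pos_root)

lemma not_pos_and_neg: "b \<in> pos \<Longrightarrow> - b \<notin> pos"
proof
  assume "b \<in> pos" "- b \<in> pos"
  then have "fw j \<bullet> b = 0" if "j \<in> {1..DIM('v)}" for j using that by (force simp: pos_iff)
  then have "b = 0" by (rule fw_zero)
  then show False using \<open>b \<in> pos\<close> pos_root zero_not_root by blast
qed

lemma pos_if_fw_pos: "b \<in> \<Phi> \<Longrightarrow> j \<in> {1..DIM('v)} \<Longrightarrow> 0 < fw j \<bullet> b \<Longrightarrow> b \<in> pos"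
  using root_sign[of b] by (force simp: pos_iff)

lemma simple_pos: "i \<in> {1..DIM('v)} \<Longrightarrow> \<alpha> i \<in> pos"
  by (auto simp: pos_iff simple_root fw_simple)

text \<open>Since the system is reduced, \<open>b\<close> involves some simple root other than \<open>\<alpha> i\<close>; the reflection leaves
that coefficient positive, and one positive coefficient decides the sign of a root.\<close>
lemma refl_simple_pos:
  assumes i: "i \<in> {1..DIM('v)}" and b: "b \<in> pos" "b \<noteq> \<alpha> i"
  shows "refl (\<alpha> i) b \<in> pos"
proof -
  have "\<exists>j\<in>{1..DIM('v)}. j \<noteq> i \<and> fw j \<bullet> b > 0"
  proof (rule ccontr)
    assume "\<not> (\<exists>j\<in>{1..DIM('v)}. j \<noteq> i \<and> fw j \<bullet> b > 0)"
    then have z: "fw j \<bullet> b = 0" if "j \<in> {1..DIM('v)}" "j \<noteq> i" for j using b that by (force simp: pos_iff)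
    have "b = (\<Sum>j\<in>{1..DIM('v)}. (fw j \<bullet> b) *\<^sub>R coroot (\<alpha> j))" by (rule expand_coroot)
    also have "\<dots> = (\<Sum>j\<in>{1..DIM('v)}. if j = i then (fw i \<bullet> b) *\<^sub>R coroot (\<alpha> i) else 0)"
      by (intro sum.cong) (auto simp: z)
    also have "\<dots> = (fw i \<bullet> b) *\<^sub>R coroot (\<alpha> i)" using i by simp
    also have "\<dots> = (fw i \<bullet> b * (2 / (\<alpha> i \<bullet> \<alpha> i))) *\<^sub>R \<alpha> i" by (simp add: coroot_def)
    finally have e: "b = (fw i \<bullet> b * (2 / (\<alpha> i \<bullet> \<alpha> i))) *\<^sub>R \<alpha> i" .
    then have "fw i \<bullet> b * (2 / (\<alpha> i \<bullet> \<alpha> i)) = 1 \<or> fw i \<bullet> b * (2 / (\<alpha> i \<bullet> \<alpha> i)) = -1"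
      using reduced[OF simple_root[OF i]] pos_root[OF b(1)] by metis
    moreover have "fw i \<bullet> b * (2 / (\<alpha> i \<bullet> \<alpha> i)) \<ge> 0" using b i by (auto simp: pos_iff)
    ultimately have "fw i \<bullet> b * (2 / (\<alpha> i \<bullet> \<alpha> i)) = 1" by linarith
    with e have "b = \<alpha> i" by (metis scaleR_one)
    with b show False by simp
  qed
  then obtain j where j: "j \<in> {1..DIM('v)}" "j \<noteq> i" "fw j \<bullet> b > 0" by blast
  then have "fw j \<bullet> refl (\<alpha> i) b > 0" using i by (simp add: refl_def inner_diff_right fw_simple)
  then show ?thesis using pos_if_fw_pos refl_root[OF simple_root[OF i] pos_root[OF b(1)]] j(1) by blast
qed

text \<open>The reflection permutes \<open>A - {\<alpha> i}\<close>, so the sum of these roots is orthogonal to \<open>\<alpha> i\<close>, and only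
\<open>\<alpha> i\<close> itself contributes. The lemma serves both for \<open>\<rho>\<close> and for its parabolic analogue.\<close>
lemma half_sum_coroot:
  assumes i: "i \<in> {1..DIM('v)}" and A: "A \<subseteq> pos" "\<alpha> i \<in> A" "refl (\<alpha> i) ` (A - {\<alpha> i}) \<subseteq> A"
  shows "coroot (\<alpha> i) \<bullet> ((1/2) *\<^sub>R (\<Sum>a\<in>A. a)) = 1"
proof -
  let ?s = "refl (\<alpha> i)" and ?B = "A - {\<alpha> i}"
  have fin: "finite A" using A finite_pos by (meson finite_subset)
  have "?s b \<noteq> \<alpha> i" if "b \<in> ?B" for b
  proof
    assume "?s b = \<alpha> i"
    then have "b = - \<alpha> i" using refl_refl[of "\<alpha> i" b] refl_self[OF simple_nonzero[OF i]] by simp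
    then show False using that A not_pos_and_neg[OF simple_pos[OF i]] by blast
  qed
  then have sub: "?s ` ?B \<subseteq> ?B" using A(3) by auto
  have inj: "inj_on ?s ?B" by (rule inj_on_inverseI[of _ ?s]) (simp add: refl_refl)
  have "?s ` ?B = ?B" using endo_inj_surj[OF _ sub inj] fin by simp
  then have "(\<Sum>a\<in>?B. a) = (\<Sum>a\<in>?B. ?s a)" using sum.reindex[OF inj, of "\<lambda>a. a"] by simp
  also have "\<dots> = ?s (\<Sum>a\<in>?B. a)" by (simp add: linear_sum[OF linear_refl])
  finally have "(coroot (\<alpha> i) \<bullet> (\<Sum>a\<in>?B. a)) *\<^sub>R \<alpha> i = 0" by (simp add: refl_def[of _ "sum _ _"])
  then have z: "coroot (\<alpha> i) \<bullet> (\<Sum>a\<in>?B. a) = 0" using simple_nonzero[OF i] by simp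
  have "(\<Sum>a\<in>A. a) = \<alpha> i + (\<Sum>a\<in>?B. a)" using fin A by (intro sum.remove)
  moreover have "coroot (\<alpha> i) \<bullet> \<alpha> i = 2" using simple_nonzero[OF i] by (simp add: coroot_def)
  ultimately show ?thesis using z by (simp add: inner_add_right)
qed

lemma coroot_simple_rho: "i \<in> {1..DIM('v)} \<Longrightarrow> coroot (\<alpha> i) \<bullet> \<rho> = 1"
  unfolding rho_def by (rule half_sum_coroot) (auto intro: simple_pos refl_simple_pos)

lemma rho_inner: "\<rho> \<bullet> x = (\<Sum>j\<in>{1..DIM('v)}. fw j \<bullet> x)"
  by (subst expand_fw[of \<rho>]) (simp add: coroot_simple_rho inner_sum_left)

text \<open>Since \<open>b \<bullet> b > 0\<close>, a positive root has positive pairing with some simple root. If \<open>b\<close> is not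
simple, the corresponding reflection gives a positive root with a smaller sum of coefficients.\<close>
lemma positive_root_induct [consumes 1, case_names simple refl]:
  assumes b: "b \<in> pos" and simple: "\<And>i. i \<in> {1..DIM('v)} \<Longrightarrow> P (\<alpha> i)"
    and step: "\<And>i b. i \<in> {1..DIM('v)} \<Longrightarrow> b \<in> pos \<Longrightarrow> P b \<Longrightarrow> refl (\<alpha> i) b \<in> pos \<Longrightarrow> P (refl (\<alpha> i) b)"
  shows "P b"
  using b
proof (induction "card {a\<in>pos. (\<Sum>j\<in>{1..DIM('v)}. fw j \<bullet> a / (\<alpha> j \<bullet> \<alpha> j)) < (\<Sum>j\<in>{1..DIM('v)}. fw j \<bullet> b / (\<alpha> j \<bullet> \<alpha> j))}" arbitrary: b rule: less_induct)
  case (less b)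
  define H where "H = (\<lambda>a. \<Sum>j\<in>{1..DIM('v)}. fw j \<bullet> a / (\<alpha> j \<bullet> \<alpha> j))"
  have bnz: "b \<noteq> 0" using less.prems pos_root zero_not_root by blast
  have "b \<bullet> b = (\<Sum>j\<in>{1..DIM('v)}. (fw j \<bullet> b) * (coroot (\<alpha> j) \<bullet> b))"
    by (subst (1) expand_coroot[of b]) (simp add: inner_sum_left)
  moreover have "b \<bullet> b > 0" using bnz by simp
  ultimately have "\<exists>i\<in>{1..DIM('v)}. (fw i \<bullet> b) * (coroot (\<alpha> i) \<bullet> b) > 0"
    by (metis (no_types, lifting) linorder_not_less sum_nonpos)
  then obtain i where i: "i \<in> {1..DIM('v)}" "(fw i \<bullet> b) * (coroot (\<alpha> i) \<bullet> b) > 0" by blast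
  moreover have "fw i \<bullet> b \<ge> 0" using less.prems i by (auto simp: pos_iff)
  ultimately have ci: "coroot (\<alpha> i) \<bullet> b > 0" by (simp add: zero_less_mult_iff)
  show ?case
  proof (cases "b = \<alpha> i")
    case False
    define a where "a = refl (\<alpha> i) b"
    have a: "a \<in> pos" unfolding a_def by (rule refl_simple_pos[OF i(1) less.prems False])
    have Ha: "H a < H b"
    proof -
      have "H (\<alpha> i) = (\<Sum>j\<in>{1..DIM('v)}. if j = i then 1/2 else 0)"
        unfolding H_def using i by (intro sum.cong) (auto simp: fw_simple simple_nonzero)
      then have "H (\<alpha> i) = 1/2" using i by simp
      moreover have "H a = H b - (coroot (\<alpha> i) \<bullet> b) * H (\<alpha> i)"
        unfolding H_def a_def refl_def by (simp add: inner_diff_right diff_divide_distrib sum_subtractf sum_distrib_left)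
      ultimately show ?thesis using ci by simp
    qed
    have "{c\<in>pos. H c < H a} \<subset> {c\<in>pos. H c < H b}" using Ha a by force
    then have "card {c\<in>pos. H c < H a} < card {c\<in>pos. H c < H b}" using finite_pos by (intro psubset_card_mono) auto
    then have "P a" using less.hyps[OF _ a] unfolding H_def by blast
    moreover have "refl (\<alpha> i) a = b" by (simp add: a_def refl_refl)
    ultimately show ?thesis using step[OF i(1) a] less.prems by simp
  qed (use simple i in simp)
qed

text \<open>Coroots are integral combinations of simple coroots. This makes the levels \<open>k\<close> and heights \<open>m\<close> in
\<open>\<xi>(k s + m)\<close> integers.\<close>
lemma fw_coroot_int:
  assumes b: "b \<in> \<Phi>" and j: "j \<in> {1..DIM('v)}" shows "fw j \<bullet> coroot b \<in> \<int>"
proof -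
  have P: "fw j \<bullet> coroot b \<in> \<int>" if "b \<in> pos" for b
    using that
  proof (induction rule: positive_root_induct)
    case (simple i)
    then show ?case by (simp add: fw_coroot_simple)
  next
    case (refl i b)
    have "coroot (refl (\<alpha> i) b) = refl (\<alpha> i) (coroot b)"
      by (rule coroot_isometry[OF linear_refl refl_inner])
    then have "fw j \<bullet> coroot (refl (\<alpha> i) b) = fw j \<bullet> coroot b - (coroot (\<alpha> i) \<bullet> coroot b) * (fw j \<bullet> \<alpha> i)"
      by (simp add: refl_def inner_diff_right)
    also have "(coroot (\<alpha> i) \<bullet> coroot b) * (fw j \<bullet> \<alpha> i) = (if i = j then \<alpha> i \<bullet> coroot b else 0)"
      using refl(1) simple_nonzero[of i] by (simp add: fw_simple) (simp add: coroot_def)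
    finally show ?case using refl coroot_root_int[of b "\<alpha> i"] pos_root simple_root
      by (auto simp: inner_commute)
  qed
  from root_sign[OF b] show ?thesis
  proof
    assume "- b \<in> pos"
    from P[OF this] show ?thesis by simp
  qed (rule P)
qed

lemma fw_coroot_nonneg: "b \<in> pos \<Longrightarrow> j \<in> {1..DIM('v)} \<Longrightarrow> 0 \<le> fw j \<bullet> coroot b"
  by (auto simp: pos_iff coroot_def)

lemma fw_coroot_nat: 
  assumes "b \<in> pos" "j \<in> {1..DIM('v)}" shows "\<exists>n. fw j \<bullet> coroot b = real n"
proof -
  obtain z where "fw j \<bullet> coroot b = of_int z" using fw_coroot_int[of b j] assms pos_root by (auto elim: Ints_cases)
  then show ?thesis using fw_coroot_nonneg[OF assms] by (intro exI[of _ "nat z"]) simp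
qed

lemma ht_eq: "ht b = (\<Sum>j\<in>{1..DIM('v)}. fw j \<bullet> coroot b)"
  by (simp add: coroot_height_def rho_inner)

lemma ht_simple: "i \<in> {1..DIM('v)} \<Longrightarrow> ht (\<alpha> i) = 1"
  by (simp add: coroot_height_def coroot_simple_rho inner_commute)

lemma ht_minus: "ht (- b) = - ht b" by (simp add: coroot_height_def)

text \<open>The height is the sum of the coefficients of the coroot, which are natural numbers. If it is 1,
the coroot is a simple coroot.\<close>
lemma ht_nat:
  assumes "b \<in> pos" shows "\<exists>n\<ge>1. ht b = real n \<and> (n = 1 \<longrightarrow> b \<in> simple_roots \<alpha>)"
proof -
  have "\<forall>j\<in>{1..DIM('v)}. \<exists>n. fw j \<bullet> coroot b = real n" using fw_coroot_nat[OF assms] by metis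
  then obtain n where n: "\<And>j. j \<in> {1..DIM('v)} \<Longrightarrow> fw j \<bullet> coroot b = real (n j)" by metis
  then have h: "ht b = real (\<Sum>j\<in>{1..DIM('v)}. n j)" by (simp add: ht_eq)
  have "\<exists>j\<in>{1..DIM('v)}. n j \<noteq> 0"
  proof (rule ccontr)
    assume "\<not> (\<exists>j\<in>{1..DIM('v)}. n j \<noteq> 0)"
    then have "coroot b = 0" using n by (intro fw_zero) auto
    then have "b = 0" by (metis coroot_coroot coroot_def scaleR_zero_right)
    then show False using assms pos_root zero_not_root by blast
  qed
  then obtain j where j: "j \<in> {1..DIM('v)}" "n j \<noteq> 0" by blast
  have s: "(\<Sum>j\<in>{1..DIM('v)}. n j) = n j + (\<Sum>j\<in>{1..DIM('v)}-{j}. n j)" using j by (intro sum.remove) auto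
  show ?thesis
  proof (intro exI[of _ "\<Sum>j\<in>{1..DIM('v)}. n j"] conjI impI h)
    show "1 \<le> (\<Sum>j\<in>{1..DIM('v)}. n j)" using s j by simp
    assume "(\<Sum>j\<in>{1..DIM('v)}. n j) = 1"
    then have nj: "n j = 1" "(\<Sum>j\<in>{1..DIM('v)}-{j}. n j) = 0" using s j by linarith+
    then have z: "n k = 0" if "k \<in> {1..DIM('v)}" "k \<noteq> j" for k using that by (simp only: sum_eq_0_iff finite_Diff finite_atLeastAtMost) auto
    have "coroot b = coroot (\<alpha> j)"
    proof (rule eq_fw)
      fix k assume k: "k \<in> {1..DIM('v)}"
      then show "fw k \<bullet> coroot b = fw k \<bullet> coroot (\<alpha> j)"
        using n[OF k] z[OF k] nj j by (auto simp: fw_coroot_simple)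
    qed
    then show "b \<in> simple_roots \<alpha>" using j by (auto simp: coroot_eq_iff simple_roots_def)
  qed
qed

lemma ht_eq_1: 
  assumes "b \<in> \<Phi>" "ht b = 1" shows "b \<in> simple_roots \<alpha>"
  using root_sign[OF assms(1)]
proof
  assume "b \<in> pos"
  then obtain n where "ht b = real n" "n = 1 \<longrightarrow> b \<in> simple_roots \<alpha>" using ht_nat by blast
  then show ?thesis using assms(2) by simp
next
  assume "- b \<in> pos"
  then obtain n where "ht (- b) = real n" using ht_nat by blast
  then show ?thesis using assms(2) ht_minus[of b] by simp
qed

lemma pos_if_ht_pos:
  assumes "b \<in> \<Phi>" "ht b > 0" shows "b \<in> pos"
  using root_sign[OF assms(1)]
proof
  assume "- b \<in> pos"
  then obtain n where "ht (- b) = real n" using ht_nat by blast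
  then show ?thesis using assms(2) ht_minus[of b] by simp
qed

end

section \<open>The Weyl group and diagram isometries\<close>

context based_root_system
begin

lemma weyl_isometry: 
  assumes "w \<in> weyl_group \<Phi>"
  shows "linear w" "w x \<bullet> w y = x \<bullet> y" "a \<in> \<Phi> \<Longrightarrow> w a \<in> \<Phi>"
proof -
  have "linear w \<and> (\<forall>x y. w x \<bullet> w y = x \<bullet> y) \<and> (\<forall>a\<in>\<Phi>. w a \<in> \<Phi>)"
    using assms
  proof induction
    case 1
    then show ?case by (auto simp: id_def intro: linearI)
  next
    case (2 a w)
    then have "linear (refl a \<circ> w)" using linear_compose[of w "refl a"] linear_refl by blast
    with 2 show ?case by (auto simp: refl_inner refl_root o_def)
  qed
  then show "linear w" "w x \<bullet> w y = x \<bullet> y" "a \<in> \<Phi> \<Longrightarrow> w a \<in> \<Phi>" by auto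
qed

lemma weyl_comp: "u \<in> weyl_group \<Phi> \<Longrightarrow> w \<in> weyl_group \<Phi> \<Longrightarrow> u \<circ> w \<in> weyl_group \<Phi>"
proof (induction rule: weyl_group.induct)
  case (2 a u)
  then show ?case using weyl_group.intros(2)[of a \<Phi> "u \<circ> w"] by (simp only: comp_assoc)
qed simp

lemma refl_weyl: "a \<in> \<Phi> \<Longrightarrow> refl a \<in> weyl_group \<Phi>"
  using weyl_group.intros(2)[OF _ weyl_group.intros(1), of a \<Phi>] by simp

lemma weyl_inverse: "w \<in> weyl_group \<Phi> \<Longrightarrow> \<exists>u\<in>weyl_group \<Phi>. u \<circ> w = id \<and> w \<circ> u = id"
proof (induction rule: weyl_group.induct)
  case 1
  show ?case by (intro bexI[of _ id] weyl_group.intros(1)) auto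
next
  case (2 a w)
  then obtain u where u: "u \<in> weyl_group \<Phi>" "u \<circ> w = id" "w \<circ> u = id" by blast
  have rr: "refl a \<circ> refl a = id" by (auto simp: refl_refl)
  have "(u \<circ> refl a) \<circ> (refl a \<circ> w) = u \<circ> (refl a \<circ> refl a) \<circ> w" by (simp only: comp_assoc)
  moreover have "(refl a \<circ> w) \<circ> (u \<circ> refl a) = refl a \<circ> (w \<circ> u) \<circ> refl a" by (simp only: comp_assoc)
  ultimately show ?case using weyl_comp[OF u(1) refl_weyl[OF 2(1)]] u rr by (metis comp_id)
qed

lemma weyl_inv: 
  assumes "w \<in> weyl_group \<Phi>"
  shows "inv w \<in> weyl_group \<Phi>" "bij w" "w (inv w x) = x" "inv w (w x) = x"
proof -
  obtain u where u: "u \<in> weyl_group \<Phi>" "u \<circ> w = id" "w \<circ> u = id" using weyl_inverse[OF assms] by blast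
  then have "inv w = u" by (metis inv_unique_comp)
  then show "inv w \<in> weyl_group \<Phi>" "w (inv w x) = x" "inv w (w x) = x" using u pointfree_idE by metis+
  show "bij w" using u by (metis o_bij)
qed

text \<open>The roots span, so an element is determined by its restriction to the finite set of roots.\<close>
lemma finite_weyl: "finite (weyl_group \<Phi>)"
proof -
  have inj: "inj_on (\<lambda>w. restrict w \<Phi>) (weyl_group \<Phi>)"
  proof (rule inj_onI)
    fix u w assume uw: "u \<in> weyl_group \<Phi>" "w \<in> weyl_group \<Phi>" "restrict u \<Phi> = restrict w \<Phi>"
    have "u a = w a" if "a \<in> \<Phi>" for a using uw(3) that by (metis restrict_apply')
    then show "u = w" using linear_eq_on_span[of u w \<Phi>] weyl_isometry(1) uw span_roots by auto
  qed
  have "(\<lambda>w. restrict w \<Phi>) ` weyl_group \<Phi> \<subseteq> \<Phi> \<rightarrow>\<^sub>E \<Phi>" using weyl_isometry(3) by auto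
  then show ?thesis using inj finite_roots finite_PiE[of \<Phi> "\<lambda>_. \<Phi>"] by (meson finite_imageD finite_subset)
qed

lemma weyl_coroot: "w \<in> weyl_group \<Phi> \<Longrightarrow> coroot (w a) = w (coroot a)"
  by (rule coroot_isometry) (auto intro: weyl_isometry)

lemma weyl_inner_inv: "w \<in> weyl_group \<Phi> \<Longrightarrow> x \<bullet> w y = inv w x \<bullet> y"
  by (metis weyl_inv(3) weyl_isometry(2))

lemma weyl_image_roots: "w \<in> weyl_group \<Phi> \<Longrightarrow> w ` \<Phi> = \<Phi>"
  by (intro endo_inj_surj finite_roots inj_on_subset[OF bij_is_inj[OF weyl_inv(2)]]) (auto intro: weyl_isometry(3))

lemma ht_pos: "b \<in> pos \<Longrightarrow> ht b \<ge> 1"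
  using ht_nat[of b] by auto

lemma in_pos_iff_ht: "b \<in> \<Phi> \<Longrightarrow> b \<in> pos \<longleftrightarrow> ht b > 0"
  using pos_if_ht_pos ht_pos[of b] by fastforce

lemma in_neg_iff_ht: "b \<in> \<Phi> \<Longrightarrow> b \<in> neg \<longleftrightarrow> ht b < 0"
  using in_pos_iff_ht[of "- b"] uminus_root[of b] by (simp add: neg_iff ht_minus)

lemma simple_iff_ht: "b \<in> \<Phi> \<Longrightarrow> b \<in> simple_roots \<alpha> \<longleftrightarrow> ht b = 1"
  using ht_eq_1[of b] ht_simple by (auto simp: simple_roots_def)

lemma ht_nonzero: "b \<in> \<Phi> \<Longrightarrow> ht b \<noteq> 0"
  using root_sign[of b] ht_pos[of b] ht_pos[of "- b"] ht_minus[of b] by auto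

lemma parabolic_simple_iff:
  assumes "b \<in> \<Phi>" "p \<in> {1..DIM('v)}"
  shows "b \<in> parabolic_simple_roots \<alpha> p \<longleftrightarrow> ht b = 1 \<and> fw p \<bullet> coroot b = 0"
proof
  assume "b \<in> parabolic_simple_roots \<alpha> p"
  then obtain i where "i \<in> {1..DIM('v)}" "i \<noteq> p" "b = \<alpha> i"
    unfolding parabolic_simple_roots_def simple_roots_def by blast
  then show "ht b = 1 \<and> fw p \<bullet> coroot b = 0" by (simp add: ht_simple fw_coroot_simple)
next
  assume h: "ht b = 1 \<and> fw p \<bullet> coroot b = 0"
  then obtain i where i: "i \<in> {1..DIM('v)}" "b = \<alpha> i"
    using simple_iff_ht[OF assms(1)] by (auto simp: simple_roots_def)
  then have "i \<noteq> p" using h by (auto simp: fw_coroot_simple)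
  then have "\<alpha> i \<noteq> \<alpha> p" using inj_onD[OF inj_simple] i assms by blast
  then show "b \<in> parabolic_simple_roots \<alpha> p"
    using i by (auto simp: parabolic_simple_roots_def simple_roots_def)
qed

lemma fw_coroot_eq_0_iff: "fw p \<bullet> coroot b = 0 \<longleftrightarrow> b = 0 \<or> fw p \<bullet> b = 0"
  by (auto simp: coroot_def)

text \<open>Among the Weyl group elements fixing \<open>\<lambda>\<^sub>p\<close> choose \<open>u\<close> with \<open>u \<rho> \<bullet> \<rho>\<close> minimal. For \<open>k \<noteq> p\<close> the
reflection in \<open>\<alpha> k\<close> fixes \<open>\<lambda>\<^sub>p\<close>, and composing with it cannot decrease the value further; this means that
\<open>u \<rho>\<close> pairs nonpositively with the coroot of \<open>\<alpha> k\<close>. Hence the inverse of \<open>u\<close> makes every positive root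
of level 0 negative. (It is the longest element of the Weyl group of \<open>\<Phi>\<^sub>p\<close>.)\<close>
lemma parabolic_longest_exists:
  assumes p: "p \<in> {1..DIM('v)}"
  shows "\<exists>v\<in>weyl_group \<Phi>. v (fw p) = fw p \<and> (\<forall>b\<in>pos. fw p \<bullet> b = 0 \<longrightarrow> v b \<in> neg)"
proof -
  define W where "W = {u\<in>weyl_group \<Phi>. u (fw p) = fw p}"
  have "id \<in> W" by (simp add: W_def weyl_group.intros(1))
  moreover have finW: "finite W" using finite_weyl by (simp add: W_def)
  ultimately have "\<exists>u\<in>W. u \<rho> \<bullet> \<rho> = Min ((\<lambda>u. u \<rho> \<bullet> \<rho>) ` W)"
    using Min_in[of "(\<lambda>u. u \<rho> \<bullet> \<rho>) ` W"] by fastforce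
  then obtain u where u: "u \<in> W" "\<And>x. x \<in> W \<Longrightarrow> u \<rho> \<bullet> \<rho> \<le> x \<rho> \<bullet> \<rho>"
    using Min_le finW by fastforce
  have uW: "u \<in> weyl_group \<Phi>" "u (fw p) = fw p" using u by (auto simp: W_def)
  have le: "coroot (\<alpha> k) \<bullet> u \<rho> \<le> 0" if k: "k \<in> {1..DIM('v)}" "k \<noteq> p" for k
  proof -
    have "refl (\<alpha> k) (fw p) = fw p" using k by (simp add: refl_def coroot_simple_fw)
    then have "refl (\<alpha> k) \<circ> u \<in> W" using uW k by (auto simp: W_def intro!: weyl_group.intros simple_root)
    then have "u \<rho> \<bullet> \<rho> \<le> refl (\<alpha> k) (u \<rho>) \<bullet> \<rho>" using u(2) by fastforce
    also have "\<dots> = u \<rho> \<bullet> \<rho> - (coroot (\<alpha> k) \<bullet> u \<rho>) * (\<alpha> k \<bullet> \<rho>)" by (simp add: refl_def inner_diff_left)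
    finally have "(coroot (\<alpha> k) \<bullet> u \<rho>) * (\<alpha> k \<bullet> \<rho>) \<le> 0" by simp
    moreover have "\<alpha> k \<bullet> \<rho> > 0"
    proof -
      have "2 * (\<alpha> k \<bullet> \<rho>) = \<alpha> k \<bullet> \<alpha> k" using coroot_simple_rho[OF k(1)] simple_nonzero[OF k(1)] by (simp add: coroot_def field_simps)
      moreover have "\<alpha> k \<bullet> \<alpha> k > 0" using simple_nonzero[OF k(1)] by simp
      ultimately show ?thesis by linarith
    qed
    ultimately show ?thesis by (simp add: mult_le_0_iff)
  qed
  define v where "v = inv u"
  have vW: "v \<in> weyl_group \<Phi>" unfolding v_def by (rule weyl_inv[OF uW(1)])
  have "v (fw p) = fw p" unfolding v_def using weyl_inv(4)[OF uW(1), of "fw p"] uW(2) by simp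
  moreover have "v b \<in> neg" if b: "b \<in> pos" "fw p \<bullet> b = 0" for b
  proof -
    have vb: "v b \<in> \<Phi>" using weyl_isometry(3)[OF vW] pos_root[OF b(1)] .
    have "ht (v b) = u \<rho> \<bullet> coroot b"
    proof -
      have "u \<rho> \<bullet> coroot b = u \<rho> \<bullet> u (v (coroot b))" unfolding v_def by (simp only: weyl_inv(3)[OF uW(1)])
      also have "\<dots> = \<rho> \<bullet> v (coroot b)" by (rule weyl_isometry(2)[OF uW(1)])
      finally show ?thesis by (simp only: coroot_height_def weyl_coroot[OF vW])
    qed
    also have "\<dots> = (\<Sum>j\<in>{1..DIM('v)}. (fw j \<bullet> coroot b) * (coroot (\<alpha> j) \<bullet> u \<rho>))"
      by (subst expand_coroot[of "coroot b"]) (simp add: inner_sum_right inner_commute)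
    also have "\<dots> \<le> 0"
    proof (intro sum_nonpos)
      fix j assume j: "j \<in> {1..DIM('v)}"
      show "(fw j \<bullet> coroot b) * (coroot (\<alpha> j) \<bullet> u \<rho>) \<le> 0"
        using le[OF j] fw_coroot_nonneg[OF b(1) j] b(2) by (cases "j = p") (auto simp: fw_coroot_eq_0_iff mult_le_0_iff)
    qed
    finally show ?thesis using in_neg_iff_ht[OF vb] ht_nonzero[OF vb] by linarith
  qed
  ultimately show ?thesis using vW by blast
qed

text \<open>Both half sums pair to 1 with the coroot of \<open>\<alpha> k\<close> for \<open>k \<noteq> p\<close>, so the difference is a
multiple of \<open>\<lambda>\<^sub>p\<close>.\<close>
lemma half_sum_minus_parabolic:
  assumes p: "p \<in> {1..DIM('v)}"
  shows "2 *\<^sub>R \<rho> - 2 *\<^sub>R rho_parabolic \<Phi> \<alpha> p = c_parabolic \<Phi> \<alpha> p *\<^sub>R fw p"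
proof -
  let ?A = "parabolic_roots \<Phi> \<alpha> p \<inter> pos"
  have 1: "coroot (\<alpha> k) \<bullet> rho_parabolic \<Phi> \<alpha> p = 1" if k: "k \<in> {1..DIM('v)}" "k \<noteq> p" for k
    unfolding rho_parabolic_def
  proof (rule half_sum_coroot[OF k(1)])
    show "\<alpha> k \<in> ?A" using k by (auto simp: parabolic_roots_def simple_root simple_pos fw_simple)
    show "refl (\<alpha> k) ` (?A - {\<alpha> k}) \<subseteq> ?A"
    proof
      fix x assume "x \<in> refl (\<alpha> k) ` (?A - {\<alpha> k})"
      then obtain b where b: "x = refl (\<alpha> k) b" "b \<in> pos" "b \<noteq> \<alpha> k" "fw p \<bullet> b = 0" by (auto simp: parabolic_roots_def)
      then have "x \<in> pos" using refl_simple_pos[OF k(1)] by blast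
      moreover have "fw p \<bullet> x = 0" using b k by (simp add: refl_def inner_diff_right fw_simple)
      ultimately show "x \<in> ?A" using pos_root by (auto simp: parabolic_roots_def)
    qed
  qed auto
  show ?thesis
  proof (rule eq_simple)
    fix i assume i: "i \<in> {1..DIM('v)}"
    show "coroot (\<alpha> i) \<bullet> (2 *\<^sub>R \<rho> - 2 *\<^sub>R rho_parabolic \<Phi> \<alpha> p) = coroot (\<alpha> i) \<bullet> (c_parabolic \<Phi> \<alpha> p *\<^sub>R fw p)"
      using i 1[OF i] p
      by (cases "i = p") (auto simp: inner_diff_right coroot_simple_rho coroot_simple_fw c_parabolic_def inner_diff_left inner_commute)
  qed
qed

lemma c_parabolic_int:
  assumes p: "p \<in> {1..DIM('v)}"
  shows "c_parabolic \<Phi> \<alpha> p \<in> \<int>"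
proof -
  have "2 * (rho_parabolic \<Phi> \<alpha> p \<bullet> coroot (\<alpha> p)) = (\<Sum>a\<in>parabolic_roots \<Phi> \<alpha> p \<inter> pos. coroot (\<alpha> p) \<bullet> a)"
    by (simp add: rho_parabolic_def inner_sum_right inner_commute[of _ "coroot (\<alpha> p)"])
  also have "\<dots> \<in> \<int>" by (intro Ints_sum coroot_root_int[OF simple_root[OF p] pos_root]) auto
  finally have "2 * (rho_parabolic \<Phi> \<alpha> p \<bullet> coroot (\<alpha> p)) \<in> \<int>" .
  moreover have "c_parabolic \<Phi> \<alpha> p = 2 - 2 * (rho_parabolic \<Phi> \<alpha> p \<bullet> coroot (\<alpha> p))"
    using p by (simp add: c_parabolic_def inner_diff_left fw_coroot_simple)
  ultimately show ?thesis by simp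
qed

text \<open>The element permutes the positive roots outside \<open>\<Phi>\<^sub>p\<close> and maps the positive roots of \<open>\<Phi>\<^sub>p\<close> onto
their negatives, so it sends \<open>\<rho>\<close> to \<open>\<rho> - 2 \<rho>\<^sub>p\<close>.\<close>
lemma parabolic_longest:
  assumes p: "p \<in> {1..DIM('v)}"
  shows "\<exists>v\<in>weyl_group \<Phi>. v (fw p) = fw p \<and> v \<rho> = c_parabolic \<Phi> \<alpha> p *\<^sub>R fw p - \<rho> \<and>
    (\<forall>b. ht (v b) = c_parabolic \<Phi> \<alpha> p * (fw p \<bullet> coroot b) - ht b)"
proof -
  obtain v where v: "v \<in> weyl_group \<Phi>" "v (fw p) = fw p" "\<And>b. b \<in> pos \<Longrightarrow> fw p \<bullet> b = 0 \<Longrightarrow> v b \<in> neg"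
    using parabolic_longest_exists[OF p] by blast
  let ?A = "parabolic_roots \<Phi> \<alpha> p \<inter> pos"
  let ?B = "pos - parabolic_roots \<Phi> \<alpha> p"
  have lin: "linear v" by (rule weyl_isometry[OF v(1)])
  have inj: "inj v" using weyl_inv(2)[OF v(1)] by (simp add: bij_def)
  have lev: "fw p \<bullet> v b = fw p \<bullet> b" for b using weyl_isometry(2)[OF v(1), of "fw p" b] v(2) by simp
  have "v b \<in> ?B" if "b \<in> ?B" for b
  proof -
    have "b \<in> pos" "fw p \<bullet> b \<noteq> 0" using that pos_root by (auto simp: parabolic_roots_def)
    then have "fw p \<bullet> b > 0" using p by (force simp: pos_iff)
    then have "fw p \<bullet> v b > 0" using lev by simp
    moreover have "v b \<in> \<Phi>" using weyl_isometry(3)[OF v(1) pos_root[OF \<open>b \<in> pos\<close>]] .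
    ultimately show ?thesis using pos_if_fw_pos[OF _ p] by (auto simp: parabolic_roots_def)
  qed
  then have B: "v ` ?B = ?B" using finite_pos by (intro endo_inj_surj inj_on_subset[OF inj]) auto
  have "(\<lambda>b. - v b) b \<in> ?A" if "b \<in> ?A" for b
  proof -
    have "- v b \<in> pos" using v(3)[of b] that by (auto simp: parabolic_roots_def neg_iff)
    then show ?thesis using that lev pos_root by (auto simp: parabolic_roots_def)
  qed
  moreover have injm: "inj (\<lambda>b. - v b)" using inj by (auto simp: inj_def)
  ultimately have A: "(\<lambda>b. - v b) ` ?A = ?A" using finite_pos by (intro endo_inj_surj inj_on_subset[OF injm]) auto
  have "(\<Sum>a\<in>?A. a) = (\<Sum>a\<in>(\<lambda>b. - v b) ` ?A. a)" by (simp only: A)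
  also have "\<dots> = (\<Sum>a\<in>?A. - v a)" by (rule sum.reindex_cong[OF inj_on_subset[OF injm]]) auto
  also have "\<dots> = - v (\<Sum>a\<in>?A. a)" by (simp only: sum_negf linear_sum[OF lin])
  finally have sA: "v (\<Sum>a\<in>?A. a) = - (\<Sum>a\<in>?A. a)" by (simp only: equation_minus_iff[of "\<Sum>a\<in>?A. a"])
  have "(\<Sum>a\<in>?B. a) = (\<Sum>a\<in>v ` ?B. a)" by (simp only: B)
  also have "\<dots> = (\<Sum>a\<in>?B. v a)" by (rule sum.reindex_cong[OF inj_on_subset[OF inj]]) auto
  also have "\<dots> = v (\<Sum>a\<in>?B. a)" by (simp only: linear_sum[OF lin])
  finally have sB: "v (\<Sum>a\<in>?B. a) = (\<Sum>a\<in>?B. a)" by (rule sym)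
  have AB: "(\<Sum>a\<in>pos. a) = (\<Sum>a\<in>?A. a) + (\<Sum>a\<in>?B. a)"
    using finite_pos by (subst sum.union_disjoint[symmetric]) (auto intro!: sum.cong)
  have "v \<rho> = (1/2) *\<^sub>R (- (\<Sum>a\<in>?A. a) + (\<Sum>a\<in>?B. a))"
    unfolding rho_def AB by (simp add: linear_cmul[OF lin] linear_add[OF lin] sA sB)
  also have "\<dots> = \<rho> - 2 *\<^sub>R rho_parabolic \<Phi> \<alpha> p"
    unfolding rho_def rho_parabolic_def AB
    by (rule euclidean_eqI) (simp add: inner_add_left inner_diff_left field_simps)
  also have "\<dots> = (2 *\<^sub>R \<rho> - 2 *\<^sub>R rho_parabolic \<Phi> \<alpha> p) - \<rho>" by (simp add: scaleR_2)
  finally have vr: "v \<rho> = c_parabolic \<Phi> \<alpha> p *\<^sub>R fw p - \<rho>" unfolding half_sum_minus_parabolic[OF p] .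
  have ivr: "inv v \<rho> = c_parabolic \<Phi> \<alpha> p *\<^sub>R fw p - \<rho>"
  proof -
    have li: "linear (inv v)" by (rule weyl_isometry[OF weyl_inv(1)[OF v(1)]])
    have "inv v (fw p) = fw p" using weyl_inv(4)[OF v(1), of "fw p"] v(2) by simp
    moreover have "inv v (v \<rho>) = \<rho>" by (rule weyl_inv(4)[OF v(1)])
    ultimately have "\<rho> = c_parabolic \<Phi> \<alpha> p *\<^sub>R fw p - inv v \<rho>"
      unfolding vr by (simp add: linear_diff[OF li] linear_cmul[OF li])
    then show ?thesis by (simp add: algebra_simps)
  qed
  have "ht (v b) = c_parabolic \<Phi> \<alpha> p * (fw p \<bullet> coroot b) - ht b" for b
    unfolding coroot_height_def weyl_coroot[OF v(1)] weyl_inner_inv[OF v(1)] ivr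
    by (simp add: inner_diff_left)
  then show ?thesis using v vr by blast
qed

lemma linear_diagram_action: "linear (diagram_action \<alpha> \<sigma>)"
  and diagram_action_simple: "i \<in> {1..DIM('v)} \<Longrightarrow> diagram_action \<alpha> \<sigma> (\<alpha> i) = \<alpha> (\<sigma> i)"
proof -
  obtain f where f: "linear f \<and> (\<forall>i\<in>{1..DIM('v)}. f (\<alpha> i) = \<alpha> (\<sigma> i))"
    using linear_simple_exists[of "\<lambda>i. \<alpha> (\<sigma> i)"] by blast
  have "linear (diagram_action \<alpha> \<sigma>) \<and> (\<forall>i\<in>{1..DIM('v)}. diagram_action \<alpha> \<sigma> (\<alpha> i) = \<alpha> (\<sigma> i))"
    unfolding diagram_action_def
  proof (rule theI[of _ f])
    fix g assume "linear g \<and> (\<forall>i\<in>{1..DIM('v)}. g (\<alpha> i) = \<alpha> (\<sigma> i))"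
    then show "g = f" using f linear_simple_unique[of g f] by auto
  qed (rule f)
  then show "linear (diagram_action \<alpha> \<sigma>)" "i \<in> {1..DIM('v)} \<Longrightarrow> diagram_action \<alpha> \<sigma> (\<alpha> i) = \<alpha> (\<sigma> i)" by auto
qed

end

text \<open>The action of a diagram automorphism, with the properties that enter the proof. They hold for the action
of \<open>\<sigma>\<close> and for the action of \<open>\<pi>0\<close>, which is \<open>- w\<^sub>0\<^sup>-\<^sup>1\<close>.\<close>
locale diagram_isometry = based_root_system \<Phi> \<alpha> for \<Phi> :: "'v::euclidean_space set" and \<alpha> +
  fixes \<sigma> :: "nat \<Rightarrow> nat" and h :: "'v \<Rightarrow> 'v"
  assumes sigma: "\<sigma> permutes {1..DIM('v)}" and lin: "linear h" and iso: "h x \<bullet> h y = x \<bullet> y"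
    and h_simple: "i \<in> {1..DIM('v)} \<Longrightarrow> h (\<alpha> i) = \<alpha> (\<sigma> i)"
begin

lemma sigma_ind: "\<sigma> i \<in> {1..DIM('v)} \<longleftrightarrow> i \<in> {1..DIM('v)}"
  using permutes_in_image[OF sigma] .

lemma h_fw: "i \<in> {1..DIM('v)} \<Longrightarrow> h (fw i) = fw (\<sigma> i)"
proof (rule eq_simple)
  fix k assume i: "i \<in> {1..DIM('v)}" and k: "k \<in> {1..DIM('v)}"
  define j where "j = inv \<sigma> k"
  have j: "j \<in> {1..DIM('v)}" "\<sigma> j = k"
    using k permutes_inverses[OF sigma] sigma_ind[of j] by (auto simp: j_def)
  have "coroot (\<alpha> k) \<bullet> h (fw i) = h (coroot (\<alpha> j)) \<bullet> h (fw i)"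
    using j by (simp add: coroot_isometry[OF lin iso, symmetric] h_simple)
  also have "\<dots> = (if j = i then 1 else 0)" using j by (simp add: iso coroot_simple_fw)
  also have "\<dots> = coroot (\<alpha> k) \<bullet> fw (\<sigma> i)" 
    using k j permutes_inj[OF sigma] by (auto simp: coroot_simple_fw inj_eq)
  finally show "coroot (\<alpha> k) \<bullet> h (fw i) = coroot (\<alpha> k) \<bullet> fw (\<sigma> i)" .
qed

lemma h_rho: "h \<rho> = \<rho>"
proof (rule eq_simple)
  fix k assume k: "k \<in> {1..DIM('v)}"
  define j where "j = inv \<sigma> k"
  have j: "j \<in> {1..DIM('v)}" "\<sigma> j = k"
    using k permutes_inverses[OF sigma] sigma_ind[of j] by (auto simp: j_def)
  have "coroot (\<alpha> k) \<bullet> h \<rho> = h (coroot (\<alpha> j)) \<bullet> h \<rho>"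
    using j by (simp add: coroot_isometry[OF lin iso, symmetric] h_simple)
  also have "\<dots> = coroot (\<alpha> k) \<bullet> \<rho>" using j k by (simp add: iso coroot_simple_rho)
  finally show "coroot (\<alpha> k) \<bullet> h \<rho> = coroot (\<alpha> k) \<bullet> \<rho>" .
qed

text \<open>Every root is obtained from a simple root by simple reflections, up to sign, and \<open>h\<close> intertwines
simple reflections.\<close>
lemma h_root: "b \<in> \<Phi> \<Longrightarrow> h b \<in> \<Phi>"
proof -
  have P: "h b \<in> \<Phi>" if "b \<in> pos" for b
    using that
  proof (induction rule: positive_root_induct)
    case (simple i)
    then show ?case using h_simple simple_root sigma_ind by simp
  next
    case (refl i b)
    then have "\<alpha> (\<sigma> i) \<in> \<Phi>" using simple_root sigma_ind by blast
    then show ?case using refl by (simp add: refl_isometry[OF lin iso] h_simple refl_root)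
  qed
  assume "b \<in> \<Phi>"
  then show ?thesis using P[of b] P[of "- b"] root_sign[of b] uminus_root[of "h (- b)"] by (auto simp: linear_neg[OF lin])
qed

lemma h_inj: "inj h"
  using iso by (metis (no_types, lifting) injI inner_eq_zero_iff inner_diff_left inner_diff_right lin linear_diff right_minus_eq)

lemma h_image: "h ` \<Phi> = \<Phi>"
  using h_root finite_roots by (intro endo_inj_surj inj_on_subset[OF h_inj]) auto

lemma h_ht: "ht (h b) = ht b"
  using iso[of \<rho> "coroot b"] by (simp add: coroot_height_def coroot_isometry[OF lin iso] h_rho)

lemma h_level: "p \<in> {1..DIM('v)} \<Longrightarrow> fw (\<sigma> p) \<bullet> coroot (h b) = fw p \<bullet> coroot b"
  using iso[of "fw p" "coroot b"] by (simp add: coroot_isometry[OF lin iso] h_fw)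

lemma h_bij: "bij h"
  using h_inj lin by (metis bij_def linear_injective_imp_surjective)

lemma h_inv: "h (inv h x) = x" "inv h (h x) = x"
  using h_bij by (auto simp: bij_def surj_f_inv_f)

lemma h_conj_weyl: "w \<in> weyl_group \<Phi> \<Longrightarrow> h \<circ> w \<circ> inv h \<in> weyl_group \<Phi>"
proof (induction rule: weyl_group.induct)
  case 1
  have "h \<circ> id \<circ> inv h = id" using h_inv by auto
  then show ?case using weyl_group.intros(1) by metis
next
  case (2 a w)
  have "h \<circ> (refl a \<circ> w) \<circ> inv h = refl (h a) \<circ> (h \<circ> w \<circ> inv h)"
    by (auto simp: refl_isometry[OF lin iso])
  then show ?case using weyl_group.intros(2)[OF h_root[OF 2(1)] 2(3)] by (simp only:)
qed

end

section \<open>Iterated residues\<close>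

text \<open>The variable \<open>p\<close> is frozen at the value \<open>s\<close>; the others vary in a disc about 0.\<close>
definition polydisc :: "nat \<Rightarrow> complex \<Rightarrow> real \<Rightarrow> (nat \<Rightarrow> complex) set" where
  "polydisc p s \<epsilon> = {t. t p = s \<and> (\<forall>k. k \<noteq> p \<longrightarrow> norm (t k) < \<epsilon>)}"

definition sep_holomorphic :: "nat \<Rightarrow> complex \<Rightarrow> real \<Rightarrow> ((nat \<Rightarrow> complex) \<Rightarrow> complex) \<Rightarrow> bool" where
  "sep_holomorphic p s \<epsilon> h \<longleftrightarrow>
     (\<forall>t\<in>polydisc p s \<epsilon>. \<forall>k. k \<noteq> p \<longrightarrow> (\<lambda>z. h (t(k := z))) holomorphic_on ball 0 \<epsilon>)"

lemma polydisc_update: "t \<in> polydisc p s \<epsilon> \<Longrightarrow> k \<noteq> p \<Longrightarrow> norm z < \<epsilon> \<Longrightarrow> t(k := z) \<in> polydisc p s \<epsilon>"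
  by (auto simp: polydisc_def)

lemma residue_simple_pole_plus:
  assumes \<epsilon>: "\<epsilon> > 0" and G: "G holomorphic_on ball 0 \<epsilon>" and K: "K holomorphic_on ball 0 \<epsilon>"
    and f: "\<And>z. z \<in> ball 0 \<epsilon> - {0} \<Longrightarrow> f z = G z / z + K z"
  shows "residue f 0 = G 0"
proof -
  \<comment> \<open>Near 0, \<open>f z = F z / z\<close> with \<open>F 0 = G 0\<close>.\<close>
  define F where "F = (\<lambda>z. G z + z * K z)"
  have "F holomorphic_on ball 0 \<epsilon>" unfolding F_def by (intro holomorphic_intros G K)
  then have r: "residue (\<lambda>z. F z / (z - 0)) 0 = F 0"
    using \<epsilon> by (intro residue_simple[of "ball 0 \<epsilon>"]) auto
  have "eventually (\<lambda>z::complex. z \<in> ball 0 \<epsilon> - {0}) (at 0)"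
    using \<epsilon> by (intro eventually_at_in_open) auto
  then have "eventually (\<lambda>z. f z = F z / (z - 0)) (at 0)"
  proof eventually_elim
    case (elim z)
    then have "f z = G z / z + K z" "z \<noteq> 0" using f by auto
    then show ?case by (simp add: F_def field_simps)
  qed
  then have "residue f 0 = residue (\<lambda>z. F z / (z - 0)) 0" by (intro residue_cong) auto
  then show ?thesis unfolding r by (simp add: F_def)
qed

text \<open>Taking the residue in the variable \<open>k\<close> keeps the terms with \<open>k \<in> S w\<close> and sets \<open>t k = 0\<close> in their
regular parts; the other terms are holomorphic at 0. So each step preserves the shape of the
hypothesis, and at the end only the terms with a pole in every variable are left.\<close>
lemma iterated_residue_sum:
  assumes "finite W" "\<epsilon> > 0" "distinct ks" "p \<notin> set ks"
    and "\<And>w. w \<in> W \<Longrightarrow> sep_holomorphic p s \<epsilon> (h w)"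
    and "\<And>w. w \<in> W \<Longrightarrow> S w \<subseteq> set ks"
    and "\<And>t. t \<in> polydisc p s \<epsilon> \<Longrightarrow> (\<And>k. k \<in> set ks \<Longrightarrow> t k \<noteq> 0) \<Longrightarrow>
           f t = (\<Sum>w\<in>W. h w t * (\<Prod>k\<in>S w. 1 / t k))"
    and "t \<in> polydisc p s \<epsilon>"
  shows "iterated_residue ks f t = (\<Sum>w\<in>{w\<in>W. S w = set ks}. h w (\<lambda>k. if k \<in> set ks then 0 else t k))"
  using assms
proof (induction ks arbitrary: W h S f t)
  case Nil
  then have "{w\<in>W. S w = {}} = W" by auto
  moreover have "(\<Sum>w\<in>W. h w t * (\<Prod>k\<in>S w. 1 / t k)) = (\<Sum>w\<in>W. h w t)"
  proof (rule sum.cong)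
    fix w assume "w \<in> W"
    then have "S w = {}" using Nil.prems(6)[of w] by simp
    then show "h w t * (\<Prod>k\<in>S w. 1 / t k) = h w t" by simp
  qed simp
  moreover have "f t = (\<Sum>w\<in>W. h w t * (\<Prod>k\<in>S w. 1 / t k))" by (rule Nil.prems(7)[OF Nil.prems(8)]) simp
  ultimately show ?case by simp
next
  case (Cons k ks)
  have k: "k \<noteq> p" "k \<notin> set ks" and pks: "p \<notin> set ks" "distinct ks" using Cons.prems by auto
  define W' where "W' = {w\<in>W. k \<in> S w}"
  define h' where "h' = (\<lambda>w t. h w (t(k := 0)))"
  define S' where "S' = (\<lambda>w. S w - {k})"
  define f' where "f' = (\<lambda>t. residue (\<lambda>z. f (t(k := z))) 0)"
  have \<epsilon>: "\<epsilon> > 0" by fact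
  have fin: "finite (S w)" if "w \<in> W" for w using Cons.prems(6)[OF that] by (rule finite_subset) simp
  have f': "f' u = (\<Sum>w\<in>W'. h' w u * (\<Prod>j\<in>S' w. 1 / u j))" 
    if u: "u \<in> polydisc p s \<epsilon>" "\<And>j. j \<in> set ks \<Longrightarrow> u j \<noteq> 0" for u
  proof -
    define g where "g = (\<lambda>w z. h w (u(k := z)) * (\<Prod>j\<in>S w - {k}. 1 / u j))"
    have g: "g w holomorphic_on ball 0 \<epsilon>" if "w \<in> W" for w
      using Cons.prems(5)[OF that] u(1) k(1) unfolding g_def sep_holomorphic_def
      by (intro holomorphic_intros) auto
    have "residue (\<lambda>z. f (u(k := z))) 0 = (\<lambda>z. \<Sum>w\<in>W'. g w z) 0"
    proof (rule residue_simple_pole_plus[OF \<epsilon>])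
      show "(\<lambda>z. \<Sum>w\<in>W'. g w z) holomorphic_on ball 0 \<epsilon>" "(\<lambda>z. \<Sum>w\<in>W-W'. g w z) holomorphic_on ball 0 \<epsilon>"
        using g by (auto intro!: holomorphic_intros simp: W'_def)
      fix z assume z: "z \<in> ball 0 \<epsilon> - {0::complex}"
      have "f (u(k := z)) = (\<Sum>w\<in>W. h w (u(k := z)) * (\<Prod>j\<in>S w. 1 / (u(k := z)) j))"
        using z u k by (intro Cons.prems(7) polydisc_update) auto
      also have "\<dots> = (\<Sum>w\<in>W. if w \<in> W' then g w z / z else g w z)"
      proof (rule sum.cong)
        fix w assume w: "w \<in> W"
        have eq: "(\<Prod>j\<in>S w - {k}. 1 / (u(k := z)) j) = (\<Prod>j\<in>S w - {k}. 1 / u j)" by (rule prod.cong) auto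
        show "h w (u(k := z)) * (\<Prod>j\<in>S w. 1 / (u(k := z)) j) = (if w \<in> W' then g w z / z else g w z)"
        proof (cases "k \<in> S w")
          case True
          then have "(\<Prod>j\<in>S w. 1 / (u(k := z)) j) = 1 / z * (\<Prod>j\<in>S w - {k}. 1 / u j)"
            using prod.remove[OF fin[OF w] True, of "\<lambda>j. 1 / (u(k := z)) j"] unfolding eq by simp
          then show ?thesis using w True by (simp add: W'_def g_def)
        next
          case False
          then show ?thesis using w eq by (simp add: W'_def g_def)
        qed
      qed simp
      also have "\<dots> = (\<Sum>w\<in>W'. g w z / z) + (\<Sum>w\<in>W-W'. g w z)"
        using Cons.prems(1) by (subst sum.If_cases) (auto simp: W'_def Int_def Diff_eq)
      finally show "f (u(k := z)) = (\<Sum>w\<in>W'. g w z) / z + (\<Sum>w\<in>W-W'. g w z)" by (simp add: sum_divide_distrib)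
    qed
    then show ?thesis by (simp add: f'_def g_def h'_def S'_def)
  qed
  have "iterated_residue (k # ks) f t = iterated_residue ks f' t" by (simp add: f'_def)
  also have "\<dots> = (\<Sum>w\<in>{w\<in>W'. S' w = set ks}. h' w (\<lambda>j. if j \<in> set ks then 0 else t j))"
  proof (rule Cons.IH)
    show "finite W'" using Cons.prems(1) by (simp add: W'_def)
    show "S' w \<subseteq> set ks" if "w \<in> W'" for w using that Cons.prems(6)[of w] by (auto simp: W'_def S'_def)
    show "sep_holomorphic p s \<epsilon> (h' w)" if w: "w \<in> W'" for w
      unfolding sep_holomorphic_def
    proof (intro ballI allI impI)
      fix u j assume u: "u \<in> polydisc p s \<epsilon>" and j: "j \<noteq> p"
      show "(\<lambda>z. h' w (u(j := z))) holomorphic_on ball 0 \<epsilon>"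
      proof (cases "j = k")
        case False
        have "u(k := 0) \<in> polydisc p s \<epsilon>" using u k \<epsilon> by (intro polydisc_update) auto
        then have "(\<lambda>z. h w ((u(k := 0))(j := z))) holomorphic_on ball 0 \<epsilon>"
          using Cons.prems(5)[of w] w j by (auto simp: sep_holomorphic_def W'_def)
        moreover have "(u(k := 0))(j := z) = u(j := z, k := 0)" for z using False by (simp add: fun_upd_twist)
        ultimately show ?thesis by (simp add: h'_def)
      qed (simp add: h'_def)
    qed
  qed (use f' Cons.prems pks in auto)
  also have "\<dots> = (\<Sum>w\<in>{w\<in>W. S w = set (k # ks)}. h w (\<lambda>j. if j \<in> set (k # ks) then 0 else t j))"
  proof (rule sum.cong)
    show "{w\<in>W'. S' w = set ks} = {w\<in>W. S w = set (k # ks)}"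
      using k(2) by (auto simp: W'_def S'_def)
    have "(\<lambda>j. if j \<in> set ks then 0 else t j)(k := 0) = (\<lambda>j. if j \<in> set (k # ks) then 0 else t j)" by auto
    then show "h' w (\<lambda>j. if j \<in> set ks then 0 else t j) = h w (\<lambda>j. if j \<in> set (k # ks) then 0 else t j)" for w
      by (simp only: h'_def)
  qed
  finally show ?case .
qed

text \<open>Germs of separately holomorphic functions at the point with \<open>p\<close>-th coordinate \<open>s\<close> and all other
coordinates 0.\<close>
definition nice_at :: "nat \<Rightarrow> complex \<Rightarrow> ((nat \<Rightarrow> complex) \<Rightarrow> complex) \<Rightarrow> bool" where
  "nice_at p s h \<longleftrightarrow> (\<exists>\<epsilon>>0. sep_holomorphic p s \<epsilon> h)"

lemma sep_holomorphic_mono: "sep_holomorphic p s \<epsilon> h \<Longrightarrow> \<delta> \<le> \<epsilon> \<Longrightarrow> sep_holomorphic p s \<delta> h"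
  unfolding sep_holomorphic_def
proof (intro ballI allI impI)
  fix t k assume h: "\<forall>t\<in>polydisc p s \<epsilon>. \<forall>k. k \<noteq> p \<longrightarrow> (\<lambda>z. h (t(k := z))) holomorphic_on ball 0 \<epsilon>"
    and "\<delta> \<le> \<epsilon>" "t \<in> polydisc p s \<delta>" "k \<noteq> p"
  then have "t \<in> polydisc p s \<epsilon>" by (fastforce simp: polydisc_def)
  then have "(\<lambda>z. h (t(k := z))) holomorphic_on ball 0 \<epsilon>" using h \<open>k \<noteq> p\<close> by blast
  then show "(\<lambda>z. h (t(k := z))) holomorphic_on ball 0 \<delta>"
    using \<open>\<delta> \<le> \<epsilon>\<close> by (meson holomorphic_on_subset subset_ball)
qed

lemma nice_at_common:
  assumes "finite W" "\<And>w. w \<in> W \<Longrightarrow> nice_at p s (h w)"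
  shows "\<exists>\<epsilon>>0. \<forall>w\<in>W. sep_holomorphic p s \<epsilon> (h w)"
  using assms
proof (induction W)
  case empty
  show ?case by (rule exI[of _ 1]) auto
next
  case (insert w W)
  then obtain \<epsilon> where \<epsilon>: "\<epsilon> > 0" "\<forall>w\<in>W. sep_holomorphic p s \<epsilon> (h w)" by auto
  obtain \<delta> where \<delta>: "\<delta> > 0" "sep_holomorphic p s \<delta> (h w)" using insert.prems[of w] by (auto simp: nice_at_def)
  show ?case
    by (rule exI[of _ "min \<epsilon> \<delta>"]) (use \<epsilon> \<delta> in \<open>auto intro: sep_holomorphic_mono\<close>)
qed

lemma nice_at_const: "nice_at p s (\<lambda>_. c)"
  unfolding nice_at_def sep_holomorphic_def by (intro exI[of _ 1]) auto

lemma nice_at_mult: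
  assumes "nice_at p s f" "nice_at p s g" shows "nice_at p s (\<lambda>t. f t * g t)"
proof -
  obtain e d where "e > 0" "sep_holomorphic p s e f" "d > 0" "sep_holomorphic p s d g"
    using assms by (auto simp: nice_at_def)
  then have "min e d > 0" "sep_holomorphic p s (min e d) f" "sep_holomorphic p s (min e d) g"
    by (auto intro: sep_holomorphic_mono)
  moreover define \<epsilon> where "\<epsilon> = min e d"
  ultimately show ?thesis unfolding nice_at_def sep_holomorphic_def
    by (intro exI[of _ \<epsilon>]) (auto intro!: holomorphic_intros)
qed

lemma nice_at_prod: "(\<And>x. x \<in> A \<Longrightarrow> nice_at p s (f x)) \<Longrightarrow> nice_at p s (\<lambda>t. \<Prod>x\<in>A. f x t)"
  by (induction A rule: infinite_finite_induct) (auto intro: nice_at_const nice_at_mult)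

text \<open>The affine form moves by at most a multiple of the polyradius, so it stays in a ball on which
\<open>F\<close> is holomorphic.\<close>
lemma nice_at_affine:
  fixes a :: "nat \<Rightarrow> complex"
  assumes F: "F analytic_on {c + s * a p}" and p: "p \<in> I" and I: "finite I"
  shows "nice_at p s (\<lambda>t. F (c + (\<Sum>k\<in>I. t k * a k)))"
proof -
  obtain \<delta> where \<delta>: "\<delta> > 0" "F holomorphic_on ball (c + s * a p) \<delta>"
    using F by (auto simp: analytic_on_def)
  define M where "M = 1 + (\<Sum>k\<in>I. norm (a k))"
  have M: "M > 0" unfolding M_def by (intro add_pos_nonneg sum_nonneg) auto
  define \<epsilon> where "\<epsilon> = \<delta> / M"
  have \<epsilon>: "\<epsilon> > 0" using \<delta> M by (simp add: \<epsilon>_def)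
  have in_ball: "c + (\<Sum>k\<in>I. t k * a k) \<in> ball (c + s * a p) \<delta>" if t: "t \<in> polydisc p s \<epsilon>" for t
  proof -
    have "(\<Sum>k\<in>I. t k * a k) = s * a p + (\<Sum>k\<in>I-{p}. t k * a k)"
      using t p I by (simp add: sum.remove polydisc_def)
    then have "norm ((c + (\<Sum>k\<in>I. t k * a k)) - (c + s * a p)) = norm (\<Sum>k\<in>I-{p}. t k * a k)" by simp
    also have "\<dots> \<le> (\<Sum>k\<in>I-{p}. \<epsilon> * norm (a k))"
    proof (rule sum_norm_le)
      fix k assume "k \<in> I - {p}"
      then have "norm (t k) \<le> \<epsilon>" using t by (auto simp: polydisc_def intro: less_imp_le)
      then show "norm (t k * a k) \<le> \<epsilon> * norm (a k)" by (simp add: norm_mult mult_right_mono)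
    qed
    also have "\<dots> \<le> \<epsilon> * (\<Sum>k\<in>I. norm (a k))"
      using \<epsilon> I by (subst sum_distrib_left) (intro sum_mono2, auto)
    also have "\<dots> < \<epsilon> * M" using \<epsilon> by (simp add: M_def)
    also have "\<dots> = \<delta>" using M by (simp add: \<epsilon>_def)
    finally show ?thesis by (simp add: dist_norm norm_minus_commute)
  qed
  have "sep_holomorphic p s \<epsilon> (\<lambda>t. F (c + (\<Sum>k\<in>I. t k * a k)))"
    unfolding sep_holomorphic_def
  proof (intro ballI allI impI)
    fix t k assume t: "t \<in> polydisc p s \<epsilon>" and k: "k \<noteq> p"
    have "(\<lambda>z. (t(k := z)) j) holomorphic_on ball 0 \<epsilon>" for j by (cases "j = k") (auto intro!: holomorphic_intros)
    then have "(\<lambda>z. c + (\<Sum>j\<in>I. (t(k := z)) j * a j)) holomorphic_on ball 0 \<epsilon>" by (intro holomorphic_intros)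
    then have "F \<circ> (\<lambda>z. c + (\<Sum>j\<in>I. (t(k := z)) j * a j)) holomorphic_on ball 0 \<epsilon>"
      by (rule holomorphic_on_compose_gen[OF _ \<delta>(2)]) (intro image_subsetI in_ball polydisc_update[OF t k], simp)
    then show "(\<lambda>z. F (c + (\<Sum>j\<in>I. (t(k := z)) j * a j))) holomorphic_on ball 0 \<epsilon>" by (simp add: o_def)
  qed
  then show ?thesis using \<epsilon> by (auto simp: nice_at_def)
qed

lemma nice_at_coordinate:
  assumes "F analytic_on {0}" "k \<noteq> p"
  shows "nice_at p s (\<lambda>t. F (t k))"
proof -
  have "nice_at p s (\<lambda>t. F (0 + (\<Sum>j\<in>{p,k}. t j * (if j = k then 1 else 0))))"
    by (rule nice_at_affine) (use assms in auto)
  then show ?thesis using assms by simp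
qed

section \<open>The residue of the period\<close>

lemma eventually_cosparse_affine:
  assumes "eventually P (cosparse (UNIV :: complex set))" "a \<noteq> (0::complex)"
  shows "eventually (\<lambda>s. P (b + s * a)) (cosparse UNIV)"
proof -
  have "eventually (\<lambda>s. P (b + s * a)) (at z)" for z
  proof -
    have "eventually P (at (b + z * a))" using assms(1) by (rule eventually_cosparse_imp_eventually_at) auto
    moreover have "filterlim (\<lambda>s. b + s * a) (at (b + z * a)) (at z)"
    proof (rule filterlim_atI)
      show "((\<lambda>s. b + s * a) \<longlongrightarrow> b + z * a) (at z)" by (intro tendsto_intros)
      show "\<forall>\<^sub>F s in at z. b + s * a \<noteq> b + z * a" using assms(2) by (auto simp: eventually_at_filter)
    qed
    ultimately show ?thesis by (rule eventually_compose_filterlim)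
  qed
  then show ?thesis by (simp add: eventually_cosparse_open_eq)
qed

context based_root_system
begin

text \<open>The pairing of \<open>x\<close> with \<open>\<rho> + s \<lambda>\<^sub>p\<close>.\<close>
definition affine_point :: "nat \<Rightarrow> complex \<Rightarrow> 'v \<Rightarrow> complex" where
  "affine_point p s x = of_real (\<rho> \<bullet> x) + s * of_real (fw p \<bullet> x)"

text \<open>The values of \<open>s\<close> at which no factor of nonzero level has a zero or a pole, and at which the
functional equation of \<open>\<xi>\<close> holds for the arguments that occur (default values can break it at the poles of
the Gamma factor).\<close>
definition generic :: "nat \<Rightarrow> complex \<Rightarrow> bool" where
  "generic p s \<longleftrightarrow> (\<forall>b\<in>\<Phi>. fw p \<bullet> coroot b \<noteq> 0 \<longrightarrow>
     affine_point p s (coroot b) \<noteq> 1 \<and>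
     xi analytic_on {affine_point p s (coroot b)} \<and> xi (affine_point p s (coroot b)) \<noteq> 0 \<and>
     xi analytic_on {affine_point p s (coroot b) + 1} \<and> xi (affine_point p s (coroot b) + 1) \<noteq> 0 \<and>
     xi (affine_point p s (coroot b)) = xi (1 - affine_point p s (coroot b)) \<and>
     xi (affine_point p s (coroot b) + 1) = xi (1 - (affine_point p s (coroot b) + 1)))"

text \<open>Each condition is the pullback of a cosparse condition under a nonconstant affine map.\<close>
lemma generic_cosparse: "\<forall>\<^sub>\<approx>s\<in>UNIV. generic p s"
proof -
  have c1: "\<forall>\<^sub>\<approx>x\<in>UNIV. x \<noteq> (1::complex)"
    by (simp add: eventually_cosparse_open_eq eventually_neq_at_within)
  note c2 = meromorphic_on_imp_analytic_cosparse[OF xi_meromorphic]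
  note c3 = xi_nonzero
  have aff: "\<forall>\<^sub>\<approx>s\<in>UNIV. P (affine_point p s (coroot b))" "\<forall>\<^sub>\<approx>s\<in>UNIV. P (affine_point p s (coroot b) + 1)"
    if "\<forall>\<^sub>\<approx>x\<in>UNIV. P x" "fw p \<bullet> coroot b \<noteq> 0" for P b
    using eventually_cosparse_affine[OF that(1), of "of_real (fw p \<bullet> coroot b)" "of_real (\<rho> \<bullet> coroot b)"]
      eventually_cosparse_affine[OF that(1), of "of_real (fw p \<bullet> coroot b)" "of_real (\<rho> \<bullet> coroot b) + 1"] that(2)
    by (simp_all add: affine_point_def algebra_simps)
  have "\<forall>\<^sub>\<approx>s\<in>UNIV. fw p \<bullet> coroot b \<noteq> 0 \<longrightarrow>
     affine_point p s (coroot b) \<noteq> 1 \<and>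
     xi analytic_on {affine_point p s (coroot b)} \<and> xi (affine_point p s (coroot b)) \<noteq> 0 \<and>
     xi analytic_on {affine_point p s (coroot b) + 1} \<and> xi (affine_point p s (coroot b) + 1) \<noteq> 0 \<and>
     xi (affine_point p s (coroot b)) = xi (1 - affine_point p s (coroot b)) \<and>
     xi (affine_point p s (coroot b) + 1) = xi (1 - (affine_point p s (coroot b) + 1))" for b
  proof (cases "fw p \<bullet> coroot b = 0")
    case False
    show ?thesis
      using aff(1)[OF c1 False] aff(1)[OF c2 False] aff(1)[OF c3 False] aff(2)[OF c2 False] aff(2)[OF c3 False]
        aff(1)[OF xi_one_minus False] aff(2)[OF xi_one_minus False]
      by eventually_elim simp
  qed simp
  then show ?thesis unfolding generic_def using finite_roots by (intro eventually_ball_finite) auto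
qed

definition preimage_simple :: "('v \<Rightarrow> 'v) \<Rightarrow> 'v set" where
  "preimage_simple w = {b\<in>\<Phi>. w b \<in> simple_roots \<alpha>}"

text \<open>The \<open>w\<close>-term of the residue, with \<open>w (\<rho> + s \<lambda>\<^sub>p) \<bullet> T\<close> written as a pairing with \<open>w\<^sup>-\<^sup>1 T\<close>.\<close>
definition residue_term :: "nat \<Rightarrow> ('v \<Rightarrow> 'v) \<Rightarrow> complex \<Rightarrow> 'v \<Rightarrow> complex" where
  "residue_term p w s T =
     exp (affine_point p s (inv w T) - of_real (\<rho> \<bullet> T)) *
     (\<Prod>b\<in>preimage_simple w - parabolic_simple_roots \<alpha> p. 1 / (affine_point p s (coroot b) - 1)) *
     (\<Prod>b\<in>inversions \<Phi> \<alpha> w - parabolic_simple_roots \<alpha> p. xi (affine_point p s (coroot b))) *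
     (\<Prod>b\<in>inversions \<Phi> \<alpha> w. 1 / xi (affine_point p s (coroot b) + 1))"

text \<open>The pairing of \<open>x\<close> with the spectral point \<open>\<rho> + (\<Sum>k. t\<^sub>k \<lambda>\<^sub>k)\<close>.\<close>
definition pairing :: "(nat \<Rightarrow> complex) \<Rightarrow> 'v \<Rightarrow> complex" where
  "pairing t x = of_real (\<rho> \<bullet> x) + (\<Sum>k\<in>{1..DIM('v)}. t k * of_real (fw k \<bullet> x))"

lemma cpair_spectral_point: "cpair (spectral_point \<Phi> \<alpha> t) x = pairing t x"
  by (rule complex_eqI)
     (simp_all add: cpair_def spectral_point_def pairing_def inner_add_left inner_sum_left)

lemma cpair_weyl_spectral_point:
  assumes "w \<in> weyl_group \<Phi>"
  shows "cpair (map_prod w w (spectral_point \<Phi> \<alpha> t) - (\<rho>, 0)) x = pairing t (inv w x) - of_real (\<rho> \<bullet> x)"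
proof -
  have "w y \<bullet> x = y \<bullet> inv w x" for y using weyl_inner_inv[OF assms, of x y] by (simp add: inner_commute)
  then have "cpair (map_prod w w (spectral_point \<Phi> \<alpha> t) - (\<rho>, 0)) x = 
      cpair (spectral_point \<Phi> \<alpha> t) (inv w x) - of_real (\<rho> \<bullet> x)"
    by (simp add: cpair_def complex_eq_iff inner_diff_left)
  then show ?thesis by (simp add: cpair_spectral_point)
qed

lemma bij_preimage_simple:
  assumes "w \<in> weyl_group \<Phi>" shows "bij_betw w (preimage_simple w) (simple_roots \<alpha>)"
proof -
  have "w ` preimage_simple w = simple_roots \<alpha>"
  proof
    show "simple_roots \<alpha> \<subseteq> w ` preimage_simple w"
    proof
      fix a assume a: "a \<in> simple_roots \<alpha>"
      then have "a \<in> \<Phi>" using simple_root by (auto simp: simple_roots_def)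
      then have "inv w a \<in> \<Phi>" using weyl_isometry(3)[OF weyl_inv(1)[OF assms]] by blast
      then have "inv w a \<in> preimage_simple w" using a weyl_inv(3)[OF assms] by (simp add: preimage_simple_def)
      then show "a \<in> w ` preimage_simple w" using weyl_inv(3)[OF assms, of a] by (intro image_eqI[of _ _ "inv w a"]) auto
    qed
  qed (auto simp: preimage_simple_def)
  then show ?thesis using weyl_inv(2)[OF assms] by (auto simp: bij_betw_def intro: inj_on_subset)
qed

lemma omega_G_spectral_point:
  "omega_G \<Phi> \<alpha> (spectral_point \<Phi> \<alpha> t) T = (\<Sum>w\<in>weyl_group \<Phi>.
     exp (pairing t (inv w T) - of_real (\<rho> \<bullet> T)) *
     (\<Prod>b\<in>preimage_simple w. 1 / (pairing t (coroot b) - 1)) *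
     (\<Prod>b\<in>inversions \<Phi> \<alpha> w. xi (pairing t (coroot b)) / xi (pairing t (coroot b) + 1)))"
  unfolding omega_G_def
proof (rule sum.cong)
  fix w assume w: "w \<in> weyl_group \<Phi>"
  have "(\<Prod>a\<in>simple_roots \<alpha>. 1 / cpair (map_prod w w (spectral_point \<Phi> \<alpha> t) - (\<rho>, 0)) (coroot a)) =
        (\<Prod>b\<in>preimage_simple w. 1 / (pairing t (coroot b) - 1))"
  proof (rule prod.reindex_bij_betw[OF bij_preimage_simple[OF w], symmetric, THEN trans], rule prod.cong)
    fix b assume b: "b \<in> preimage_simple w"
    have "inv w (coroot (w b)) = coroot b" using weyl_coroot[OF w] weyl_inv(4)[OF w] by simp
    moreover have "\<rho> \<bullet> coroot (w b) = 1" using b coroot_simple_rho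
      by (auto simp: preimage_simple_def simple_roots_def inner_commute)
    ultimately show "1 / cpair (map_prod w w (spectral_point \<Phi> \<alpha> t) - (\<rho>, 0)) (coroot (w b)) = 1 / (pairing t (coroot b) - 1)"
      by (simp add: cpair_weyl_spectral_point[OF w])
  qed simp
  then show "exp (cpair (map_prod w w (spectral_point \<Phi> \<alpha> t) - (\<rho>, 0)) T) *
         (\<Prod>a\<in>simple_roots \<alpha>. 1 / cpair (map_prod w w (spectral_point \<Phi> \<alpha> t) - (\<rho>, 0)) (coroot a)) *
         (\<Prod>a\<in>inversions \<Phi> \<alpha> w. xi (cpair (spectral_point \<Phi> \<alpha> t) (coroot a)) / xi (cpair (spectral_point \<Phi> \<alpha> t) (coroot a) + 1)) =
     exp (pairing t (inv w T) - of_real (\<rho> \<bullet> T)) *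
     (\<Prod>b\<in>preimage_simple w. 1 / (pairing t (coroot b) - 1)) *
     (\<Prod>b\<in>inversions \<Phi> \<alpha> w. xi (pairing t (coroot b)) / xi (pairing t (coroot b) + 1))"
    by (simp only: cpair_weyl_spectral_point[OF w] cpair_spectral_point)
qed simp

lemma pairing_simple:
  assumes "k \<in> {1..DIM('v)}" shows "pairing t (coroot (\<alpha> k)) = 1 + t k"
proof -
  have "(\<Sum>j\<in>{1..DIM('v)}. t j * of_real (fw j \<bullet> coroot (\<alpha> k))) = (\<Sum>j\<in>{1..DIM('v)}. if j = k then t k else 0)"
    by (intro sum.cong) (use assms in \<open>auto simp: fw_coroot_simple\<close>)
  then show ?thesis using assms coroot_simple_rho[OF assms] by (simp add: pairing_def inner_commute)
qed

lemma inversionsD: "b \<in> inversions \<Phi> \<alpha> w \<Longrightarrow> b \<in> pos \<and> w b \<in> neg"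
  by (auto simp: inversions_def)

lemma finite_inversions: "finite (inversions \<Phi> \<alpha> w)"
  using finite_pos by (simp add: inversions_def)

lemma finite_preimage_simple: "finite (preimage_simple w)"
  using finite_roots by (simp add: preimage_simple_def)

lemma simple_not_neg: "a \<in> simple_roots \<alpha> \<Longrightarrow> a \<notin> neg"
  using not_pos_and_neg simple_pos by (auto simp: simple_roots_def neg_iff)

text \<open>The variables in which the \<open>w\<close>-term has a pole.\<close>
definition polar_set :: "nat \<Rightarrow> ('v \<Rightarrow> 'v) \<Rightarrow> nat set" where
  "polar_set p w = {k\<in>{1..DIM('v)} - {p}. w (\<alpha> k) \<in> simple_roots \<alpha> \<union> neg}"

text \<open>The \<open>w\<close>-term with the poles in the variables \<open>t k\<close>, \<open>k \<noteq> p\<close>, divided out.\<close>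
definition regular_part :: "nat \<Rightarrow> 'v \<Rightarrow> ('v \<Rightarrow> 'v) \<Rightarrow> (nat \<Rightarrow> complex) \<Rightarrow> complex" where
  "regular_part p T w t =
     exp (pairing t (inv w T) - of_real (\<rho> \<bullet> T)) *
     (\<Prod>b\<in>preimage_simple w - parabolic_simple_roots \<alpha> p. 1 / (pairing t (coroot b) - 1)) *
     (\<Prod>b\<in>inversions \<Phi> \<alpha> w - parabolic_simple_roots \<alpha> p. xi (pairing t (coroot b))) *
     (\<Prod>b\<in>inversions \<Phi> \<alpha> w. 1 / xi (pairing t (coroot b) + 1)) *
     (\<Prod>k\<in>{k\<in>{1..DIM('v)} - {p}. w (\<alpha> k) \<in> neg}. xi_residue_factor (t k))"

lemma parabolic_simple_roots_eq:
  assumes "p \<in> {1..DIM('v)}"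
  shows "parabolic_simple_roots \<alpha> p = \<alpha> ` ({1..DIM('v)} - {p})"
  using assms unfolding parabolic_simple_roots_def simple_roots_def
  by (subst inj_on_image_set_diff[OF inj_simple]) auto

text \<open>A simple root \<open>\<alpha> k\<close> whose image is simple contributes the factor \<open>1 / t k\<close> to the rational part;
one whose image is negative contributes \<open>\<xi>(1 + t k)\<close>, which has a simple pole. The two cases exclude each
other, so all poles are simple.\<close>
lemma term_eq_regular_part:
  assumes p: "p \<in> {1..DIM('v)}" and t: "\<And>k. k \<in> {1..DIM('v)} - {p} \<Longrightarrow> t k \<noteq> 0"
  shows "exp (pairing t (inv w T) - of_real (\<rho> \<bullet> T)) *
     (\<Prod>b\<in>preimage_simple w. 1 / (pairing t (coroot b) - 1)) *
     (\<Prod>b\<in>inversions \<Phi> \<alpha> w. xi (pairing t (coroot b)) / xi (pairing t (coroot b) + 1)) =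
     regular_part p T w t * (\<Prod>k\<in>polar_set p w. 1 / t k)"
proof -
  let ?I = "{1..DIM('v)} - {p}" and ?Dp = "parabolic_simple_roots \<alpha> p"
  let ?K1 = "{k\<in>?I. w (\<alpha> k) \<in> simple_roots \<alpha>}" and ?K2 = "{k\<in>?I. w (\<alpha> k) \<in> neg}"
  note Dp = parabolic_simple_roots_eq[OF p]
  have 1: "(\<Prod>b\<in>preimage_simple w \<inter> ?Dp. 1 / (pairing t (coroot b) - 1)) = (\<Prod>k\<in>?K1. 1 / t k)"
  proof (rule prod.reindex_cong)
    show "inj_on \<alpha> ?K1" by (rule inj_on_subset[OF inj_simple]) auto
    show "preimage_simple w \<inter> ?Dp = \<alpha> ` ?K1" unfolding Dp using simple_root by (auto simp: preimage_simple_def)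
  qed (auto simp: pairing_simple)
  have 2: "(\<Prod>b\<in>inversions \<Phi> \<alpha> w \<inter> ?Dp. xi (pairing t (coroot b))) = (\<Prod>k\<in>?K2. xi_residue_factor (t k) * (1 / t k))"
  proof (rule prod.reindex_cong)
    show "inj_on \<alpha> ?K2" by (rule inj_on_subset[OF inj_simple]) auto
    show "inversions \<Phi> \<alpha> w \<inter> ?Dp = \<alpha> ` ?K2" unfolding Dp using simple_pos by (auto simp: inversions_def)
    show "xi (pairing t (coroot (\<alpha> k))) = xi_residue_factor (t k) * (1 / t k)" if "k \<in> ?K2" for k
      using that t[of k] by (simp add: pairing_simple xi_residue_factor_def)
  qed
  have disj: "?K1 \<inter> ?K2 = {}" using simple_not_neg by blast
  have "polar_set p w = ?K1 \<union> ?K2" by (auto simp: polar_set_def)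
  then have S: "(\<Prod>k\<in>polar_set p w. 1 / t k) = (\<Prod>k\<in>?K1. 1 / t k) * (\<Prod>k\<in>?K2. 1 / t k)"
    using disj by (subst prod.union_disjoint[symmetric]) auto
  have A: "(\<Prod>b\<in>preimage_simple w. 1 / (pairing t (coroot b) - 1)) =
     (\<Prod>b\<in>preimage_simple w - ?Dp. 1 / (pairing t (coroot b) - 1)) * (\<Prod>k\<in>?K1. 1 / t k)"
    unfolding 1[symmetric] using prod.Int_Diff[OF finite_preimage_simple, of _ w ?Dp] by (simp add: mult.commute)
  have B: "(\<Prod>b\<in>inversions \<Phi> \<alpha> w. xi (pairing t (coroot b)) / xi (pairing t (coroot b) + 1)) =
     (\<Prod>b\<in>inversions \<Phi> \<alpha> w - ?Dp. xi (pairing t (coroot b))) * (\<Prod>k\<in>?K2. xi_residue_factor (t k) * (1 / t k)) *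
     (\<Prod>b\<in>inversions \<Phi> \<alpha> w. 1 / xi (pairing t (coroot b) + 1))"
  proof -
    have "(\<Prod>b\<in>inversions \<Phi> \<alpha> w. xi (pairing t (coroot b)) / xi (pairing t (coroot b) + 1)) =
      (\<Prod>b\<in>inversions \<Phi> \<alpha> w. xi (pairing t (coroot b))) * (\<Prod>b\<in>inversions \<Phi> \<alpha> w. 1 / xi (pairing t (coroot b) + 1))"
      by (simp add: prod.distrib[symmetric])
    then show ?thesis unfolding 2[symmetric] 
      using prod.Int_Diff[OF finite_inversions, of "\<lambda>b. xi (pairing t (coroot b))" w ?Dp] by (simp add: mult.commute)
  qed
  show ?thesis unfolding regular_part_def A B S prod.distrib by (simp only: mult_ac)
qed

lemma affine_point_level_0: "fw p \<bullet> coroot b = 0 \<Longrightarrow> affine_point p s (coroot b) = of_real (ht b)"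
  by (simp add: affine_point_def coroot_height_def)

text \<open>For roots of nonzero level this is genericity. A root of level 0 pairs to its height, and
the roots of level 0 and height 1 are the simple ones that are left out.\<close>
lemma generic_regular:
  assumes g: "generic p s" and p: "p \<in> {1..DIM('v)}"
  shows "b \<in> \<Phi> \<Longrightarrow> b \<notin> parabolic_simple_roots \<alpha> p \<Longrightarrow> affine_point p s (coroot b) \<noteq> 1"
    and "b \<in> pos \<Longrightarrow> b \<notin> parabolic_simple_roots \<alpha> p \<Longrightarrow>
           xi analytic_on {affine_point p s (coroot b)} \<and> xi (affine_point p s (coroot b)) \<noteq> 0"
    and "b \<in> pos \<Longrightarrow> xi analytic_on {affine_point p s (coroot b) + 1} \<and> xi (affine_point p s (coroot b) + 1) \<noteq> 0"
proof -
  show "affine_point p s (coroot b) \<noteq> 1" if b: "b \<in> \<Phi>" "b \<notin> parabolic_simple_roots \<alpha> p"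
  proof (cases "fw p \<bullet> coroot b = 0")
    case True
    then have "ht b \<noteq> 1" using parabolic_simple_iff[OF b(1) p] b(2) by blast
    then show ?thesis using affine_point_level_0[OF True] by (metis of_real_1 of_real_eq_iff)
  qed (use g b in \<open>auto simp: generic_def\<close>)
  show "xi analytic_on {affine_point p s (coroot b)} \<and> xi (affine_point p s (coroot b)) \<noteq> 0"
    if b: "b \<in> pos" "b \<notin> parabolic_simple_roots \<alpha> p"
  proof (cases "fw p \<bullet> coroot b = 0")
    case True
    then have h: "ht b \<noteq> 1" using parabolic_simple_iff[OF pos_root[OF b(1)] p] b(2) by blast
    obtain n where n: "n \<ge> 1" "ht b = real n" using ht_nat[OF b(1)] by blast
    then have "n \<ge> 2" using h by (cases "n = 1") auto
    then show ?thesis using affine_point_level_0[OF True] n xi_analytic_of_nat[of n] by simp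
  qed (use g b pos_root in \<open>auto simp: generic_def\<close>)
  show "xi analytic_on {affine_point p s (coroot b) + 1} \<and> xi (affine_point p s (coroot b) + 1) \<noteq> 0"
    if b: "b \<in> pos"
  proof (cases "fw p \<bullet> coroot b = 0")
    case True
    obtain n where n: "n \<ge> 1" "ht b = real n" using ht_nat[OF b(1)] by blast
    then have e: "affine_point p s (coroot b) + 1 = of_nat (n + 1)" using affine_point_level_0[OF True] by simp
    show ?thesis unfolding e using n by (intro conjI xi_analytic_of_nat) auto
  qed (use g b pos_root in \<open>auto simp: generic_def\<close>)
qed

lemma pairing_nice:
  assumes p: "p \<in> {1..DIM('v)}" and F: "F analytic_on {affine_point p s x}"
  shows "nice_at p s (\<lambda>t. F (pairing t x))"
  unfolding pairing_def by (rule nice_at_affine) (use p F in \<open>auto simp: affine_point_def\<close>)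

lemma regular_part_nice:
  assumes g: "generic p s" and p: "p \<in> {1..DIM('v)}"
  shows "nice_at p s (regular_part p T w)"
  unfolding regular_part_def[abs_def]
proof (intro nice_at_mult nice_at_prod)
  show "nice_at p s (\<lambda>t. exp (pairing t (inv w T) - of_real (\<rho> \<bullet> T)))"
    by (rule pairing_nice[OF p, of "\<lambda>z. exp (z - _)"]) (intro analytic_intros)
  show "nice_at p s (\<lambda>t. 1 / (pairing t (coroot b) - 1))" if "b \<in> preimage_simple w - parabolic_simple_roots \<alpha> p" for b
    using generic_regular(1)[OF g p, of b] that
    by (intro pairing_nice[OF p, of "\<lambda>z. 1 / (z - 1)"] analytic_intros) (auto simp: preimage_simple_def)
  show "nice_at p s (\<lambda>t. xi (pairing t (coroot b)))" if "b \<in> inversions \<Phi> \<alpha> w - parabolic_simple_roots \<alpha> p" for b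
    using generic_regular(2)[OF g p, of b] that by (intro pairing_nice[OF p]) (auto dest: inversionsD)
  show "nice_at p s (\<lambda>t. 1 / xi (pairing t (coroot b) + 1))" if "b \<in> inversions \<Phi> \<alpha> w" for b
  proof (rule pairing_nice[OF p, of "\<lambda>z. 1 / xi (z + 1)"])
    let ?x = "affine_point p s (coroot b)"
    have x: "xi analytic_on {?x + 1}" "xi (?x + 1) \<noteq> 0" using generic_regular(3)[OF g p, of b] that inversionsD by blast+
    have "xi \<circ> (\<lambda>z. z + 1) analytic_on {?x}" using x(1) by (intro analytic_on_compose analytic_intros) auto
    then show "(\<lambda>z. 1 / xi (z + 1)) analytic_on {?x}" using x(2) by (intro analytic_intros) (auto simp: o_def)
  qed
  show "nice_at p s (\<lambda>t. xi_residue_factor (t k))" if "k \<in> {k\<in>{1..DIM('v)} - {p}. w (\<alpha> k) \<in> neg}" for k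
    using that by (intro nice_at_coordinate xi_residue_factor_analytic) auto
qed

lemma pairing_point:
  assumes "p \<in> {1..DIM('v)}"
  shows "pairing ((\<lambda>_. 0)(p := s)) x = affine_point p s x"
proof -
  have "(\<Sum>k\<in>{1..DIM('v)}. ((\<lambda>_. 0)(p := s)) k * of_real (fw k \<bullet> x)) = (\<Sum>k\<in>{1..DIM('v)}. if k = p then s * of_real (fw p \<bullet> x) else 0)"
    by (rule sum.cong) auto
  then show ?thesis using assms by (simp add: pairing_def affine_point_def)
qed

lemma regular_part_point:
  assumes "p \<in> {1..DIM('v)}"
  shows "regular_part p T w ((\<lambda>_. 0)(p := s)) = residue_term p w s T"
proof -
  have "(\<Prod>k\<in>{k\<in>{1..DIM('v)} - {p}. w (\<alpha> k) \<in> neg}. xi_residue_factor (((\<lambda>_. 0)(p := s)) k)) = 1"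
    by (rule prod.neutral) (auto simp: xi_residue_factor_def)
  then show ?thesis unfolding regular_part_def residue_term_def pairing_point[OF assms] by simp
qed

lemma finite_admissible: "finite (admissible \<Phi> \<alpha> p)"
  using finite_weyl by (simp add: admissible_def)

text \<open>The iterated residue is the sum of the \<open>w\<close>-terms over the admissible \<open>w\<close>, since having a pole in
every variable \<open>s\<^sub>k\<close>, \<open>k \<noteq> p\<close>, is the condition defining admissibility.\<close>
lemma omega_GP_eq:
  assumes g: "generic p s" and p: "p \<in> {1..DIM('v)}"
  shows "omega_GP \<Phi> \<alpha> p s T = (\<Sum>w\<in>admissible \<Phi> \<alpha> p. residue_term p w s T)"
proof -
  let ?ks = "filter (\<lambda>k. k \<noteq> p) [1..<Suc DIM('v)]"
  have ks: "set ?ks = {1..DIM('v)} - {p}" by auto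
  obtain \<epsilon> where \<epsilon>: "\<epsilon> > 0" "\<forall>w\<in>weyl_group \<Phi>. sep_holomorphic p s \<epsilon> (regular_part p T w)"
    using nice_at_common[OF finite_weyl regular_part_nice[OF g p], of "\<lambda>_. T" "\<lambda>w. w"] by blast
  have "omega_GP \<Phi> \<alpha> p s T = (\<Sum>w\<in>{w\<in>weyl_group \<Phi>. polar_set p w = set ?ks}.
      regular_part p T w (\<lambda>k. if k \<in> set ?ks then 0 else ((\<lambda>_. 0)(p := s)) k))"
    unfolding omega_GP_def
  proof (rule iterated_residue_sum[OF finite_weyl \<epsilon>(1)])
    show "polar_set p w \<subseteq> set ?ks" for w unfolding ks by (auto simp: polar_set_def)
    show "omega_G \<Phi> \<alpha> (spectral_point \<Phi> \<alpha> t) T =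
        (\<Sum>w\<in>weyl_group \<Phi>. regular_part p T w t * (\<Prod>k\<in>polar_set p w. 1 / t k))"
      if "\<And>k. k \<in> set ?ks \<Longrightarrow> t k \<noteq> 0" for t
      using that unfolding ks omega_G_spectral_point by (intro sum.cong refl term_eq_regular_part[OF p]) auto
    show "(\<lambda>_. 0)(p := s) \<in> polydisc p s \<epsilon>" using \<epsilon> by (auto simp: polydisc_def)
  qed (use \<epsilon> in auto)
  also have "{w\<in>weyl_group \<Phi>. polar_set p w = set ?ks} = admissible \<Phi> \<alpha> p"
    unfolding ks admissible_def parabolic_simple_roots_eq[OF p] polar_set_def by auto
  also have "(\<lambda>k. if k \<in> set ?ks then 0 else ((\<lambda>_. 0)(p := s)) k) = (\<lambda>_. 0)(p := s)" by auto
  finally show ?thesis by (simp only: regular_part_point[OF p])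
qed

lemma residue_term_meromorphic: "(\<lambda>s. residue_term p w s T) meromorphic_on UNIV"
proof -
  have xi: "(\<lambda>s. xi (affine_point p s x)) meromorphic_on UNIV" "(\<lambda>s. xi (affine_point p s x + 1)) meromorphic_on UNIV" for x
    using xi_meromorphic_affine[of "of_real (fw p \<bullet> x)" "of_real (\<rho> \<bullet> x)"]
      xi_meromorphic_affine[of "of_real (fw p \<bullet> x)" "of_real (\<rho> \<bullet> x) + 1"]
    by (simp_all add: affine_point_def algebra_simps)
  have "(\<lambda>s. exp (affine_point p s x - c)) meromorphic_on UNIV" for x c
    unfolding affine_point_def by (intro analytic_on_imp_meromorphic_on analytic_intros)
  moreover have "(\<lambda>s. affine_point p s x) meromorphic_on UNIV" for x
    unfolding affine_point_def by (intro analytic_on_imp_meromorphic_on analytic_intros)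
  ultimately show ?thesis unfolding residue_term_def by (intro meromorphic_intros xi)
qed

lemma omega_GP_meromorphic:
  assumes p: "p \<in> {1..DIM('v)}"
  shows "(\<lambda>s. omega_GP \<Phi> \<alpha> p s T) meromorphic_on UNIV"
proof -
  have "(\<lambda>s. \<Sum>w\<in>admissible \<Phi> \<alpha> p. residue_term p w s T) meromorphic_on UNIV"
    by (intro meromorphic_intros residue_term_meromorphic)
  moreover have "\<forall>\<^sub>\<approx>s\<in>UNIV. omega_GP \<Phi> \<alpha> p s T = (\<Sum>w\<in>admissible \<Phi> \<alpha> p. residue_term p w s T)"
    using generic_cosparse[of p] by eventually_elim (rule omega_GP_eq[OF _ p])
  ultimately show ?thesis by (subst meromorphic_on_cong') auto
qed

lemma xi_GP_meromorphic:
  assumes p: "p \<in> {1..DIM('v)}"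
  shows "(\<lambda>s. xi_GP \<Phi> \<alpha> p s T) meromorphic_on UNIV"
  unfolding xi_GP_def case_prod_beta
  by (intro meromorphic_intros omega_GP_meromorphic[OF p] xi_meromorphic_affine)

end

section \<open>Invariance under diagram automorphisms\<close>

context based_root_system
begin

lemma simple_or_neg_iff:
  assumes "w \<in> weyl_group \<Phi>" "b \<in> \<Phi>"
  shows "w b \<in> simple_roots \<alpha> \<union> neg \<longleftrightarrow> ht (w b) = 1 \<or> ht (w b) < 0"
  using simple_iff_ht in_neg_iff_ht weyl_isometry(3)[OF assms] by blast

lemma parabolic_simple_root: "b \<in> parabolic_simple_roots \<alpha> p \<Longrightarrow> b \<in> \<Phi>"
  using simple_root by (auto simp: parabolic_simple_roots_def simple_roots_def)

text \<open>Admissibility, inversions and preimages of simple roots are expressed through heights, because the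
heights transform simply under diagram automorphisms and under the longest parabolic element.\<close>
lemma admissible_iff:
  "w \<in> admissible \<Phi> \<alpha> p \<longleftrightarrow>
     w \<in> weyl_group \<Phi> \<and> (\<forall>b\<in>parabolic_simple_roots \<alpha> p. ht (w b) = 1 \<or> ht (w b) < 0)"
  using simple_or_neg_iff[of w] parabolic_simple_root
  unfolding admissible_def mem_Collect_eq subset_eq vimage_eq by blast

lemma in_inversions_iff:
  assumes "w \<in> weyl_group \<Phi>"
  shows "b \<in> inversions \<Phi> \<alpha> w \<longleftrightarrow> b \<in> \<Phi> \<and> ht b > 0 \<and> ht (w b) < 0"
  using in_pos_iff_ht[of b] pos_root[of b] in_neg_iff_ht weyl_isometry(3)[OF assms, of b]
  by (auto simp: inversions_def)

lemma in_preimage_simple_iff: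
  assumes "w \<in> weyl_group \<Phi>"
  shows "b \<in> preimage_simple w \<longleftrightarrow> b \<in> \<Phi> \<and> ht (w b) = 1"
  using simple_iff_ht weyl_isometry(3)[OF assms, of b] by (auto simp: preimage_simple_def)

end

context diagram_isometry
begin

lemma inv_isometry: "diagram_isometry \<Phi> \<alpha> (inv \<sigma>) (inv h)"
proof (intro diagram_isometry.intro diagram_isometry_axioms.intro based_root_system_axioms)
  show "inv \<sigma> permutes {1..DIM('v)}" by (rule permutes_inv[OF sigma])
  show "linear (inv h)"
  proof (rule linearI)
    show "inv h (x + y) = inv h x + inv h y" for x y
      by (rule injD[OF h_inj]) (simp only: linear_add[OF lin] h_inv)
    show "inv h (c *\<^sub>R x) = c *\<^sub>R inv h x" for c x
      by (rule injD[OF h_inj]) (simp only: linear_cmul[OF lin] h_inv)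
  qed
  show "inv h x \<bullet> inv h y = x \<bullet> y" for x y using iso[of "inv h x" "inv h y"] by (simp only: h_inv)
  show "inv h (\<alpha> i) = \<alpha> (inv \<sigma> i)" if "i \<in> {1..DIM('v)}" for i
  proof (rule injD[OF h_inj])
    have "inv \<sigma> i \<in> {1..DIM('v)}" using that permutes_in_image[OF permutes_inv[OF sigma]] by blast
    then show "h (inv h (\<alpha> i)) = h (\<alpha> (inv \<sigma> i))" by (simp only: h_inv h_simple permutes_inverses[OF sigma])
  qed
qed

definition conj :: "('v \<Rightarrow> 'v) \<Rightarrow> 'v \<Rightarrow> 'v" where "conj w = h \<circ> w \<circ> inv h"

lemma conj_h: "conj w (h b) = h (w b)"
  by (simp add: conj_def h_inv)

lemma conj_weyl: "w \<in> weyl_group \<Phi> \<Longrightarrow> conj w \<in> weyl_group \<Phi>"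
  unfolding conj_def by (rule h_conj_weyl)

lemma in_parabolic_simple:
  assumes "p \<in> {1..DIM('v)}" "b \<in> \<Phi>"
  shows "h b \<in> parabolic_simple_roots \<alpha> (\<sigma> p) \<longleftrightarrow> b \<in> parabolic_simple_roots \<alpha> p"
  using parabolic_simple_iff[OF assms(2,1)] parabolic_simple_iff[OF h_root[OF assms(2)], of "\<sigma> p"]
  by (simp only: sigma_ind assms h_ht h_level simp_thms)

lemma root_preimage: "b \<in> \<Phi> \<Longrightarrow> \<exists>a\<in>\<Phi>. b = h a"
  using h_image by blast

lemma conj_admissible:
  assumes p: "p \<in> {1..DIM('v)}" and w: "w \<in> admissible \<Phi> \<alpha> p"
  shows "conj w \<in> admissible \<Phi> \<alpha> (\<sigma> p)"
  unfolding admissible_iff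
proof (intro conjI ballI)
  show "conj w \<in> weyl_group \<Phi>" using w by (intro conj_weyl) (simp add: admissible_def)
  fix b assume b: "b \<in> parabolic_simple_roots \<alpha> (\<sigma> p)"
  then obtain a where a: "a \<in> \<Phi>" "b = h a" using root_preimage parabolic_simple_root by blast
  then have "a \<in> parabolic_simple_roots \<alpha> p" using b in_parabolic_simple[OF p] by blast
  then show "ht (conj w b) = 1 \<or> ht (conj w b) < 0" using w by (simp add: admissible_iff a conj_h h_ht)
qed

lemma conj_bij_betw_admissible:
  assumes p: "p \<in> {1..DIM('v)}"
  shows "bij_betw conj (admissible \<Phi> \<alpha> p) (admissible \<Phi> \<alpha> (\<sigma> p))"
proof (rule bij_betw_byWitness[where f' = "\<lambda>w. inv h \<circ> w \<circ> h"])
  interpret i: diagram_isometry \<Phi> \<alpha> "inv \<sigma>" "inv h" by (rule inv_isometry)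
  have ii: "inv (inv h) = h" by (rule inv_inv_eq[OF h_bij])
  show "\<forall>w\<in>admissible \<Phi> \<alpha> p. inv h \<circ> conj w \<circ> h = w" by (auto simp: conj_def h_inv)
  show "\<forall>w\<in>admissible \<Phi> \<alpha> (\<sigma> p). conj (inv h \<circ> w \<circ> h) = w" by (auto simp: conj_def h_inv)
  show "conj ` admissible \<Phi> \<alpha> p \<subseteq> admissible \<Phi> \<alpha> (\<sigma> p)" using conj_admissible[OF p] by blast
  have "inv h \<circ> w \<circ> h \<in> admissible \<Phi> \<alpha> p" if "w \<in> admissible \<Phi> \<alpha> (\<sigma> p)" for w
    using i.conj_admissible[of "\<sigma> p" w] that p sigma_ind
    unfolding i.conj_def ii permutes_inverses[OF sigma] by blast
  then show "(\<lambda>w. inv h \<circ> w \<circ> h) ` admissible \<Phi> \<alpha> (\<sigma> p) \<subseteq> admissible \<Phi> \<alpha> p" by blast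
qed

lemma inversions_conj:
  assumes "w \<in> weyl_group \<Phi>"
  shows "inversions \<Phi> \<alpha> (conj w) = h ` inversions \<Phi> \<alpha> w"
proof -
  have "b \<in> inversions \<Phi> \<alpha> (conj w) \<longleftrightarrow> b \<in> h ` inversions \<Phi> \<alpha> w" if "b \<in> \<Phi>" for b
  proof -
    obtain a where a: "a \<in> \<Phi>" "b = h a" using root_preimage \<open>b \<in> \<Phi>\<close> by blast
    show ?thesis unfolding a(2) inj_image_mem_iff[OF h_inj] in_inversions_iff[OF assms] in_inversions_iff[OF conj_weyl[OF assms]]
      using a(1) h_root by (simp add: conj_h h_ht)
  qed
  moreover have "inversions \<Phi> \<alpha> (conj w) \<subseteq> \<Phi>" "h ` inversions \<Phi> \<alpha> w \<subseteq> \<Phi>"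
    using in_inversions_iff[OF assms] in_inversions_iff[OF conj_weyl[OF assms]] h_root by auto
  ultimately show ?thesis by blast
qed

lemma preimage_simple_conj:
  assumes "w \<in> weyl_group \<Phi>"
  shows "preimage_simple (conj w) = h ` preimage_simple w"
proof -
  have "b \<in> preimage_simple (conj w) \<longleftrightarrow> b \<in> h ` preimage_simple w" if "b \<in> \<Phi>" for b
  proof -
    obtain a where a: "a \<in> \<Phi>" "b = h a" using root_preimage \<open>b \<in> \<Phi>\<close> by blast
    show ?thesis unfolding a(2) inj_image_mem_iff[OF h_inj] in_preimage_simple_iff[OF assms] in_preimage_simple_iff[OF conj_weyl[OF assms]]
      using a(1) h_root by (simp add: conj_h h_ht)
  qed
  moreover have "preimage_simple (conj w) \<subseteq> \<Phi>" "h ` preimage_simple w \<subseteq> \<Phi>"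
    using in_preimage_simple_iff[OF assms] in_preimage_simple_iff[OF conj_weyl[OF assms]] h_root by auto
  ultimately show ?thesis by blast
qed

lemma image_minus_parabolic:
  assumes "p \<in> {1..DIM('v)}" "A \<subseteq> \<Phi>"
  shows "h ` A - parabolic_simple_roots \<alpha> (\<sigma> p) = h ` (A - parabolic_simple_roots \<alpha> p)"
  using in_parabolic_simple[OF assms(1)] assms(2) by blast

lemma h_affine_point:
  assumes "p \<in> {1..DIM('v)}"
  shows "affine_point (\<sigma> p) s (h x) = affine_point p s x"
  using iso[of \<rho> x] iso[of "fw p" x] by (simp add: affine_point_def h_rho h_fw[OF assms])

lemma prod_h: "(\<Prod>b\<in>h ` A. f b) = (\<Prod>b\<in>A. f (h b))"
  by (rule prod.reindex_cong[OF inj_on_subset[OF h_inj]]) auto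

lemma residue_term_conj:
  assumes p: "p \<in> {1..DIM('v)}" and w: "w \<in> weyl_group \<Phi>"
  shows "residue_term (\<sigma> p) (conj w) s (h T) = residue_term p w s T"
proof -
  have i: "inv (conj w) (h T) = h (inv w T)"
  proof -
    have "conj w (h (inv w T)) = h T" by (simp add: conj_h weyl_inv(3)[OF w])
    then show ?thesis using weyl_inv(4)[OF conj_weyl[OF w]] by metis
  qed
  have r: "\<rho> \<bullet> h T = \<rho> \<bullet> T" using iso[of \<rho> T] by (simp add: h_rho)
  have sub: "inversions \<Phi> \<alpha> w \<subseteq> \<Phi>" "preimage_simple w \<subseteq> \<Phi>"
    using in_inversions_iff[OF w] in_preimage_simple_iff[OF w] by auto
  have c: "affine_point (\<sigma> p) s (coroot (h b)) = affine_point p s (coroot b)" for b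
    by (simp add: coroot_isometry[OF lin iso] h_affine_point[OF p])
  show ?thesis
    unfolding residue_term_def i r h_affine_point[OF p] inversions_conj[OF w] preimage_simple_conj[OF w]
      image_minus_parabolic[OF p sub(1)] image_minus_parabolic[OF p sub(2)] prod_h c ..
qed

lemma xi_exponent_conj:
  assumes p: "p \<in> {1..DIM('v)}" and w: "w \<in> weyl_group \<Phi>"
  shows "xi_exponent \<Phi> \<alpha> (\<sigma> p) (conj w) k m = xi_exponent \<Phi> \<alpha> p w k m"
proof -
  have card: "card {a \<in> h ` A. fw (\<sigma> p) \<bullet> coroot a = x \<and> ht a = y} = card {a\<in>A. fw p \<bullet> coroot a = x \<and> ht a = y}" for A x y
  proof -
    have "{a \<in> h ` A. fw (\<sigma> p) \<bullet> coroot a = x \<and> ht a = y} = h ` {a\<in>A. fw p \<bullet> coroot a = x \<and> ht a = y}"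
      by (auto simp: h_level[OF p] h_ht)
    then show ?thesis by (simp add: card_image inj_on_subset[OF h_inj])
  qed
  have sub: "inversions \<Phi> \<alpha> w \<subseteq> \<Phi>" using in_inversions_iff[OF w] by auto
  show ?thesis
    unfolding xi_exponent_def inversions_conj[OF w] image_minus_parabolic[OF p sub] card ..
qed

lemma xi_multiplicity_conj:
  assumes p: "p \<in> {1..DIM('v)}"
  shows "xi_multiplicity \<Phi> \<alpha> (\<sigma> p) = xi_multiplicity \<Phi> \<alpha> p"
proof (intro ext)
  fix k m
  have "(\<lambda>w. max 0 (- xi_exponent \<Phi> \<alpha> (\<sigma> p) w k m)) ` admissible \<Phi> \<alpha> (\<sigma> p)
      = (\<lambda>w. max 0 (- xi_exponent \<Phi> \<alpha> (\<sigma> p) (conj w) k m)) ` admissible \<Phi> \<alpha> p"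
    by (subst bij_betw_imp_surj_on[OF conj_bij_betw_admissible[OF p], symmetric]) (simp only: image_image)
  also have "\<dots> = (\<lambda>w. max 0 (- xi_exponent \<Phi> \<alpha> p w k m)) ` admissible \<Phi> \<alpha> p"
    by (rule image_cong) (auto simp: admissible_def xi_exponent_conj[OF p])
  finally show "xi_multiplicity \<Phi> \<alpha> (\<sigma> p) k m = xi_multiplicity \<Phi> \<alpha> p k m"
    by (simp add: xi_multiplicity_def)
qed

lemma xi_GP_diagram_isometry:
  assumes p: "p \<in> {1..DIM('v)}"
  shows "meromorphic_eq (\<lambda>s. xi_GP \<Phi> \<alpha> p s T) (\<lambda>s. xi_GP \<Phi> \<alpha> (\<sigma> p) s (h T))"
  unfolding meromorphic_eq_def
proof (intro conjI)
  show "(\<lambda>s. xi_GP \<Phi> \<alpha> p s T) meromorphic_on UNIV" by (rule xi_GP_meromorphic[OF p])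
  have q: "\<sigma> p \<in> {1..DIM('v)}" using p sigma_ind by blast
  show "(\<lambda>s. xi_GP \<Phi> \<alpha> (\<sigma> p) s (h T)) meromorphic_on UNIV" by (rule xi_GP_meromorphic[OF q])
  show "\<forall>\<^sub>\<approx>s\<in>UNIV. xi_GP \<Phi> \<alpha> p s T = xi_GP \<Phi> \<alpha> (\<sigma> p) s (h T)"
    using generic_cosparse[of p] generic_cosparse[of "\<sigma> p"]
  proof eventually_elim
    case (elim s)
    have "omega_GP \<Phi> \<alpha> (\<sigma> p) s (h T) = (\<Sum>w\<in>admissible \<Phi> \<alpha> p. residue_term (\<sigma> p) (conj w) s (h T))"
      unfolding omega_GP_eq[OF elim(2) q] by (rule sum.reindex_bij_betw[OF conj_bij_betw_admissible[OF p], symmetric])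
    also have "\<dots> = (\<Sum>w\<in>admissible \<Phi> \<alpha> p. residue_term p w s T)"
      by (rule sum.cong) (auto simp: admissible_def residue_term_conj[OF p])
    also have "\<dots> = omega_GP \<Phi> \<alpha> p s T" by (rule omega_GP_eq[OF elim(1) p, symmetric])
    finally show ?case by (simp add: xi_GP_def xi_multiplicity_conj[OF p])
  qed
qed

end

section \<open>The functional equation of the residue\<close>

context based_root_system
begin

definition level_nat :: "nat \<Rightarrow> 'v \<Rightarrow> nat" where
  "level_nat p b = nat \<lfloor>fw p \<bullet> coroot b\<rfloor>"

definition height_nat :: "'v \<Rightarrow> nat" where
  "height_nat b = nat \<lfloor>ht b\<rfloor>"

lemma level_nat: "b \<in> pos \<Longrightarrow> p \<in> {1..DIM('v)} \<Longrightarrow> fw p \<bullet> coroot b = real (level_nat p b)"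
  using fw_coroot_nat[of b p] by (auto simp: level_nat_def)

lemma height_nat: "b \<in> pos \<Longrightarrow> ht b = real (height_nat b) \<and> height_nat b \<ge> 1"
  using ht_nat[of b] by (auto simp: height_nat_def)

lemma identity_admissible: "id \<in> admissible \<Phi> \<alpha> p"
  unfolding admissible_def using weyl_group.intros(1) by (auto simp: parabolic_simple_roots_def)

lemma inversions_id: "inversions \<Phi> \<alpha> id = {}"
  using not_pos_and_neg by (auto simp: inversions_def neg_iff)

text \<open>The identity is admissible and has exponent 0, so the maximum of the negated exponents is already
nonnegative.\<close>
lemma xi_multiplicity_eq_Max:
  "int (xi_multiplicity \<Phi> \<alpha> p k m) = Max ((\<lambda>w. - xi_exponent \<Phi> \<alpha> p w k m) ` admissible \<Phi> \<alpha> p)"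
proof -
  let ?A = "admissible \<Phi> \<alpha> p" and ?e = "\<lambda>w. - xi_exponent \<Phi> \<alpha> p w k m"
  have ne: "finite (?e ` ?A)" "?e ` ?A \<noteq> {}" using finite_admissible identity_admissible[of p] by auto
  have "?e id = 0" by (simp add: xi_exponent_def inversions_id)
  then have nn: "Max (?e ` ?A) \<ge> 0" using Max_ge[OF ne(1), of "?e id"] identity_admissible[of p] by (metis imageI)
  have "mono (max (0::int))" by (rule monoI) auto
  then have "Max (max 0 ` (?e ` ?A)) = max 0 (Max (?e ` ?A))" using mono_Max_commute[OF _ ne] by metis
  then have "Max ((\<lambda>w. max 0 (?e w)) ` ?A) = Max (?e ` ?A)" using nn by (simp add: image_image)
  then show ?thesis using nn by (simp add: xi_multiplicity_def)
qed

lemma xi_multiplicity_nonzeroD: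
  assumes "xi_multiplicity \<Phi> \<alpha> p k m \<noteq> 0"
  shows "\<exists>b\<in>pos. fw p \<bullet> coroot b = real k \<and> ht b = real m - 1"
proof (rule ccontr)
  assume n: "\<not> ?thesis"
  have "- xi_exponent \<Phi> \<alpha> p w k m \<le> 0" for w
  proof -
    have "{a \<in> inversions \<Phi> \<alpha> w. fw p \<bullet> coroot a = real k \<and> ht a = real m - 1} = {}"
      using n inversionsD by blast
    then show ?thesis unfolding xi_exponent_def by (simp only: card.empty)
  qed
  then have "Max ((\<lambda>w. - xi_exponent \<Phi> \<alpha> p w k m) ` admissible \<Phi> \<alpha> p) \<le> 0"
    using finite_admissible identity_admissible by (subst Max_le_iff) auto
  then show False using assms unfolding xi_multiplicity_eq_Max[symmetric] by simp
qed

end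

text \<open>Here \<open>- h\<close> is the inverse of \<open>w\<^sub>0\<close>, and \<open>v\<close> is the longest element of the Weyl group of \<open>\<Phi>\<^sub>p\<close>, described
by its effect on \<open>\<lambda>\<^sub>p\<close>, \<open>\<rho>\<close> and heights.\<close>
locale functional_equation = diagram_isometry \<Phi> \<alpha> \<sigma> h
  for \<Phi> :: "'v::euclidean_space set" and \<alpha> and \<sigma> and h :: "'v \<Rightarrow> 'v" +
  fixes p :: nat and v :: "'v \<Rightarrow> 'v"
  assumes p: "p \<in> {1..DIM('v)}"
    and minus_h_weyl: "(\<lambda>x. - h x) \<in> weyl_group \<Phi>"
    and v: "v \<in> weyl_group \<Phi>" and v_fw: "v (fw p) = fw p"
    and v_rho: "v \<rho> = c_parabolic \<Phi> \<alpha> p *\<^sub>R fw p - \<rho>"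
    and v_ht: "ht (v b) = c_parabolic \<Phi> \<alpha> p * (fw p \<bullet> coroot b) - ht b"
begin

abbreviation (input) c where "c \<equiv> c_parabolic \<Phi> \<alpha> p"

abbreviation (input) reflected :: "complex \<Rightarrow> complex" where "reflected s \<equiv> - of_real c - s"

text \<open>The substitution \<open>w \<mapsto> w\<^sub>0\<^sup>-\<^sup>1 w v\<close>.\<close>
definition twist :: "('v \<Rightarrow> 'v) \<Rightarrow> 'v \<Rightarrow> 'v" where "twist w = (\<lambda>x. - h x) \<circ> w \<circ> v"

lemma v_level: "fw p \<bullet> coroot (v b) = fw p \<bullet> coroot b"
  using weyl_isometry(2)[OF v, of "fw p" "coroot b"] by (simp add: weyl_coroot[OF v] v_fw)

lemma v_root: "b \<in> \<Phi> \<Longrightarrow> v b \<in> \<Phi>" by (rule weyl_isometry(3)[OF v])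

lemma weyl_minus: "w \<in> weyl_group \<Phi> \<Longrightarrow> w (- b) = - w b" by (rule linear_neg[OF weyl_isometry(1)])

lemma v_inj: "inj v" using weyl_inv(2)[OF v] by (simp add: bij_def)

lemma v_surj: "b \<in> \<Phi> \<Longrightarrow> \<exists>a\<in>\<Phi>. b = v a" using weyl_image_roots[OF v] by blast

lemma twist_weyl: "w \<in> weyl_group \<Phi> \<Longrightarrow> twist w \<in> weyl_group \<Phi>"
  unfolding twist_def by (intro weyl_comp minus_h_weyl v)

lemma ht_twist: "ht (twist w b) = - ht (w (v b))"
  by (simp add: twist_def ht_minus h_ht)

text \<open>At level 0 the height changes sign under \<open>v\<close>, so \<open>b \<mapsto> - v b\<close> preserves it; level 0 and height 1
characterize the simple roots other than \<open>\<alpha> p\<close>.\<close>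
lemma in_parabolic_minus_v:
  "b \<in> \<Phi> \<Longrightarrow> - v b \<in> parabolic_simple_roots \<alpha> p \<longleftrightarrow> b \<in> parabolic_simple_roots \<alpha> p"
  using parabolic_simple_iff[of b p] parabolic_simple_iff[of "- v b" p] p uminus_root[OF v_root]
  by (auto simp: ht_minus v_ht v_level)

lemma twist_admissible: "w \<in> admissible \<Phi> \<alpha> p \<Longrightarrow> twist w \<in> admissible \<Phi> \<alpha> p"
  unfolding admissible_iff
proof (intro conjI ballI; elim conjE)
  fix b assume w: "w \<in> weyl_group \<Phi>" and adm: "\<forall>b\<in>parabolic_simple_roots \<alpha> p. ht (w b) = 1 \<or> ht (w b) < 0"
    and b: "b \<in> parabolic_simple_roots \<alpha> p"
  have "- v b \<in> parabolic_simple_roots \<alpha> p" using b in_parabolic_minus_v parabolic_simple_root by blast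
  moreover have "ht (twist w b) = ht (w (- v b))" by (simp add: ht_twist weyl_minus[OF w] ht_minus)
  ultimately show "ht (twist w b) = 1 \<or> ht (twist w b) < 0" using adm by auto
qed (rule twist_weyl)

lemma twist_inj: "inj twist"
proof (rule injI)
  fix u w assume "twist u = twist w"
  then have e: "h (u (v x)) = h (w (v x))" for x by (auto simp: twist_def fun_eq_iff)
  have "u x = w x" for x
    using injD[OF h_inj e[of "inv v x"]] by (simp add: weyl_inv(3)[OF v])
  then show "u = w" by auto
qed

lemma twist_bij_betw: "bij_betw twist (admissible \<Phi> \<alpha> p) (admissible \<Phi> \<alpha> p)"
proof -
  have "twist ` admissible \<Phi> \<alpha> p = admissible \<Phi> \<alpha> p"
    using twist_admissible by (intro endo_inj_surj finite_admissible inj_on_subset[OF twist_inj]) auto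
  then show ?thesis using inj_on_subset[OF twist_inj] by (auto simp: bij_betw_def)
qed

text \<open>The pairing form of \<open>v (\<rho> + s' \<lambda>\<^sub>p) = - (\<rho> + s \<lambda>\<^sub>p)\<close>.\<close>
lemma affine_point_reflected: "affine_point p (reflected s) x = - affine_point p s (v x)"
proof -
  have i: "inv v (fw p) = fw p" using weyl_inv(4)[OF v, of "fw p"] by (simp add: v_fw)
  have li: "linear (inv v)" by (rule weyl_isometry(1)[OF weyl_inv(1)[OF v]])
  have "\<rho> = inv v (v \<rho>)" by (simp add: weyl_inv(4)[OF v])
  also have "\<dots> = c *\<^sub>R fw p - inv v \<rho>" unfolding v_rho by (simp add: linear_diff[OF li] linear_cmul[OF li] i)
  finally have r: "inv v \<rho> = c *\<^sub>R fw p - \<rho>" by (simp add: algebra_simps)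
  have "affine_point p s (v x) = of_real ((c *\<^sub>R fw p - \<rho>) \<bullet> x) + s * of_real (fw p \<bullet> x)"
    unfolding affine_point_def weyl_inner_inv[OF v] r i ..
  then show ?thesis by (simp add: affine_point_def inner_diff_left algebra_simps)
qed

lemma affine_point_minus: "affine_point p s (- x) = - affine_point p s x"
  by (simp add: affine_point_def)

lemma affine_point_reflected_coroot:
  "affine_point p (reflected s) (coroot b) = affine_point p s (coroot (- v b))"
  by (simp add: affine_point_reflected weyl_coroot[OF v] affine_point_minus)

lemma prod_minus_v: "(\<Prod>b\<in>A. f (- v b)) = (\<Prod>b\<in>(\<lambda>b. - v b) ` A. f b)"
proof -
  have "inj (\<lambda>b. - v b)" using v_inj by (auto simp: inj_def)
  then show ?thesis by (intro prod.reindex_cong[symmetric, OF inj_on_subset]) auto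
qed

lemma minus_v_image:
  assumes "A \<subseteq> \<Phi>" "B \<subseteq> \<Phi>" "\<And>b. b \<in> \<Phi> \<Longrightarrow> b \<in> A \<longleftrightarrow> - v b \<in> B"
  shows "(\<lambda>b. - v b) ` A = B"
proof
  show "B \<subseteq> (\<lambda>b. - v b) ` A"
  proof
    fix b assume b: "b \<in> B"
    then have "- b \<in> \<Phi>" using assms(2) uminus_root by blast
    then obtain a where a: "a \<in> \<Phi>" "- b = v a" using v_surj by blast
    then have "b = - v a" by (metis minus_minus)
    then show "b \<in> (\<lambda>b. - v b) ` A" using assms(3)[OF a(1)] b by blast
  qed
qed (use assms in blast)

definition level0 :: "'v set" where "level0 = {b\<in>\<Phi>. fw p \<bullet> coroot b = 0}"
text \<open>The positive roots outside \<open>\<Phi>\<^sub>p\<close>.\<close>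
definition upper :: "'v set" where "upper = {b\<in>pos. fw p \<bullet> coroot b \<noteq> 0}"

lemma finite_upper: "finite upper" using finite_pos by (simp add: upper_def)

lemma v_upper: "b \<in> upper \<Longrightarrow> v b \<in> upper"
proof -
  assume b: "b \<in> upper"
  then have "fw p \<bullet> b \<ge> 0" "fw p \<bullet> b \<noteq> 0" using p by (auto simp: upper_def pos_iff coroot_def)
  moreover have "fw p \<bullet> v b = fw p \<bullet> b" using weyl_isometry(2)[OF v, of "fw p" b] by (simp add: v_fw)
  ultimately have "fw p \<bullet> v b > 0" by simp
  then show "v b \<in> upper" using b pos_if_fw_pos[OF v_root p] pos_root v_level by (auto simp: upper_def)
qed

lemma v_image_upper: "v ` upper = upper"
  using v_upper finite_upper by (intro endo_inj_surj inj_on_subset[OF v_inj]) auto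

lemma parabolic_level0: "parabolic_simple_roots \<alpha> p \<subseteq> level0"
  using parabolic_simple_iff[OF _ p] parabolic_simple_root by (auto simp: level0_def)

lemma inversions_level: "inversions \<Phi> \<alpha> w = (inversions \<Phi> \<alpha> w \<inter> level0) \<union> (inversions \<Phi> \<alpha> w \<inter> upper)"
  "(inversions \<Phi> \<alpha> w \<inter> level0) \<inter> (inversions \<Phi> \<alpha> w \<inter> upper) = {}"
  using inversionsD pos_root by (auto simp: level0_def upper_def)

lemma prod_inversions_level:
  "(\<Prod>b\<in>inversions \<Phi> \<alpha> w. f b) = (\<Prod>b\<in>inversions \<Phi> \<alpha> w \<inter> level0. f b) * (\<Prod>b\<in>inversions \<Phi> \<alpha> w \<inter> upper. f b)"
  by (subst inversions_level(1), rule prod.union_disjoint) (use finite_inversions inversions_level(2) in auto)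

text \<open>At level 0, \<open>b \<mapsto> - v b\<close> preserves positivity, and it replaces \<open>w (v b)\<close> by its negative just as
passing from \<open>w\<close> to its twist does.\<close>
lemma inversions_twist_level0:
  assumes w: "w \<in> weyl_group \<Phi>"
  shows "(\<lambda>b. - v b) ` (inversions \<Phi> \<alpha> (twist w) \<inter> level0) = inversions \<Phi> \<alpha> w \<inter> level0"
  by (rule minus_v_image)
     (auto simp: level0_def in_inversions_iff[OF w] in_inversions_iff[OF twist_weyl[OF w]] ht_twist
        weyl_minus[OF w] ht_minus v_ht v_level uminus_root v_root)

text \<open>At positive level \<open>v\<close> preserves positivity, so the sign change in the twist turns inversions into
non-inversions.\<close>
lemma inversions_twist_upper:
  assumes w: "w \<in> weyl_group \<Phi>"
  shows "v ` (inversions \<Phi> \<alpha> (twist w) \<inter> upper) = upper - inversions \<Phi> \<alpha> w"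
proof -
  have "b \<in> inversions \<Phi> \<alpha> (twist w) \<longleftrightarrow> v b \<notin> inversions \<Phi> \<alpha> w" if b: "b \<in> upper" for b
  proof -
    have r: "b \<in> pos" "v b \<in> pos" using b v_upper[OF b] by (auto simp: upper_def)
    then have r2: "b \<in> \<Phi>" "v b \<in> \<Phi>" "ht b > 0" "ht (v b) > 0" using pos_root ht_pos by force+
    then have "ht (w (v b)) \<noteq> 0" by (intro ht_nonzero weyl_isometry(3)[OF w])
    then show ?thesis
      unfolding in_inversions_iff[OF w] in_inversions_iff[OF twist_weyl[OF w]] ht_twist using r2 by linarith
  qed
  note key = this
  show ?thesis
  proof (intro equalityI subsetI)
    fix x assume "x \<in> v ` (inversions \<Phi> \<alpha> (twist w) \<inter> upper)"
    then show "x \<in> upper - inversions \<Phi> \<alpha> w" using key v_upper by auto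
  next
    fix x assume x: "x \<in> upper - inversions \<Phi> \<alpha> w"
    then have "x \<in> v ` upper" by (simp only: v_image_upper) simp
    then obtain b where "b \<in> upper" "x = v b" by blast
    then show "x \<in> v ` (inversions \<Phi> \<alpha> (twist w) \<inter> upper)" using key x by auto
  qed
qed

text \<open>The factor by which every \<open>w\<close>-term changes.\<close>
definition ratio :: "complex \<Rightarrow> complex" where
  "ratio s = (\<Prod>b\<in>upper. xi (affine_point p s (coroot b) + 1) / xi (affine_point p s (coroot b)))"

lemma generic_upper:
  assumes "generic p s" "b \<in> upper"
  shows "xi (affine_point p s (coroot b)) \<noteq> 0" "xi (affine_point p s (coroot b) + 1) \<noteq> 0"
     "xi (1 - affine_point p s (coroot b)) = xi (affine_point p s (coroot b))"
     "xi (- affine_point p s (coroot b)) = xi (affine_point p s (coroot b) + 1)"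
proof -
  have "b \<in> \<Phi>" "fw p \<bullet> coroot b \<noteq> 0" using assms(2) pos_root by (auto simp: upper_def)
  then have "xi (affine_point p s (coroot b)) \<noteq> 0 \<and> xi (affine_point p s (coroot b) + 1) \<noteq> 0 \<and>
     xi (affine_point p s (coroot b)) = xi (1 - affine_point p s (coroot b)) \<and>
     xi (affine_point p s (coroot b) + 1) = xi (1 - (affine_point p s (coroot b) + 1))"
    using assms(1) unfolding generic_def by blast
  moreover have "1 - (affine_point p s (coroot b) + 1) = - affine_point p s (coroot b)" by simp
  ultimately show "xi (affine_point p s (coroot b)) \<noteq> 0" "xi (affine_point p s (coroot b) + 1) \<noteq> 0"
     "xi (1 - affine_point p s (coroot b)) = xi (affine_point p s (coroot b))"
     "xi (- affine_point p s (coroot b)) = xi (affine_point p s (coroot b) + 1)"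
    by metis+
qed

text \<open>By the functional equation of \<open>\<xi>\<close>, a non-inversion \<open>b\<close> of \<open>w\<close> contributes the inverse of what it
would contribute as an inversion. Multiplying by the inverse factors of the inversions as well
completes the product to one over all positive roots of positive level.\<close>
lemma upper_factor_twist:
  assumes g: "generic p s" and w: "w \<in> weyl_group \<Phi>"
  shows "(\<Prod>b\<in>inversions \<Phi> \<alpha> (twist w) \<inter> upper. xi (affine_point p (reflected s) (coroot b)) *
            (1 / xi (affine_point p (reflected s) (coroot b) + 1))) =
     ratio s * (\<Prod>b\<in>inversions \<Phi> \<alpha> w \<inter> upper. xi (affine_point p s (coroot b)) * (1 / xi (affine_point p s (coroot b) + 1)))"
proof -
  let ?x = "\<lambda>b. affine_point p s (coroot b)"
  let ?f = "\<lambda>b. xi (- ?x b) * (1 / xi (- ?x b + 1))"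
  have "(\<Prod>b\<in>inversions \<Phi> \<alpha> (twist w) \<inter> upper. xi (affine_point p (reflected s) (coroot b)) *
            (1 / xi (affine_point p (reflected s) (coroot b) + 1))) =
        (\<Prod>b\<in>inversions \<Phi> \<alpha> (twist w) \<inter> upper. ?f (v b))"
    by (simp add: affine_point_reflected weyl_coroot[OF v])
  also have "\<dots> = (\<Prod>b\<in>v ` (inversions \<Phi> \<alpha> (twist w) \<inter> upper). ?f b)"
    by (rule prod.reindex_cong[symmetric, OF inj_on_subset[OF v_inj]]) auto
  also have "\<dots> = (\<Prod>b\<in>upper - inversions \<Phi> \<alpha> w. xi (?x b + 1) / xi (?x b))"
    unfolding inversions_twist_upper[OF w]
  proof (rule prod.cong)
    fix b assume "b \<in> upper - inversions \<Phi> \<alpha> w"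
    then have b: "b \<in> upper" by blast
    have "- ?x b + 1 = 1 - ?x b" by simp
    then show "?f b = xi (?x b + 1) / xi (?x b)"
      by (simp only: generic_upper(3,4)[OF g b]) simp
  qed simp
  finally have 1: "(\<Prod>b\<in>inversions \<Phi> \<alpha> (twist w) \<inter> upper. xi (affine_point p (reflected s) (coroot b)) *
            (1 / xi (affine_point p (reflected s) (coroot b) + 1))) = (\<Prod>b\<in>upper - inversions \<Phi> \<alpha> w. xi (?x b + 1) / xi (?x b))" .
  have "ratio s = (\<Prod>b\<in>upper \<inter> inversions \<Phi> \<alpha> w. xi (?x b + 1) / xi (?x b)) *
       (\<Prod>b\<in>upper - inversions \<Phi> \<alpha> w. xi (?x b + 1) / xi (?x b))"
    unfolding ratio_def by (rule prod.Int_Diff[OF finite_upper])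
  moreover have "(\<Prod>b\<in>upper \<inter> inversions \<Phi> \<alpha> w. xi (?x b + 1) / xi (?x b)) *
      (\<Prod>b\<in>inversions \<Phi> \<alpha> w \<inter> upper. xi (?x b) * (1 / xi (?x b + 1))) = 1"
    unfolding Int_commute[of upper] prod.distrib[symmetric]
    by (rule prod.neutral) (use generic_upper[OF g] in auto)
  ultimately show ?thesis unfolding 1 by (simp add: mult_ac)
qed

text \<open>The exponential factor, the rational factors and the factors of level 0 are matched by
\<open>b \<mapsto> - v b\<close>, which also preserves the set of simple roots other than \<open>\<alpha> p\<close>; the factors of positive
level change by the ratio.\<close>
lemma residue_term_twist:
  assumes g: "generic p s" and w: "w \<in> weyl_group \<Phi>"
  shows "residue_term p (twist w) (reflected s) (h T) = ratio s * residue_term p w s T"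
proof -
  let ?D = "parabolic_simple_roots \<alpha> p"
  let ?x = "\<lambda>b. affine_point p s (coroot b)" and ?y = "\<lambda>b. affine_point p (reflected s) (coroot b)"
  let ?I = "inversions \<Phi> \<alpha> w" and ?J = "inversions \<Phi> \<alpha> (twist w)"
  have E: "affine_point p (reflected s) (inv (twist w) (h T)) - of_real (\<rho> \<bullet> h T) = affine_point p s (inv w T) - of_real (\<rho> \<bullet> T)"
  proof -
    have "twist w (inv v (- inv w T)) = h T"
      by (simp add: twist_def weyl_inv(3)[OF v] weyl_minus[OF w] weyl_inv(3)[OF w] linear_neg[OF lin])
    then have "inv (twist w) (h T) = inv v (- inv w T)" using weyl_inv(4)[OF twist_weyl[OF w]] by metis
    then have "affine_point p (reflected s) (inv (twist w) (h T)) = affine_point p s (inv w T)"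
      by (simp only: affine_point_reflected weyl_inv(3)[OF v] affine_point_minus minus_minus)
    moreover have "\<rho> \<bullet> h T = \<rho> \<bullet> T" using iso[of \<rho> T] by (simp add: h_rho)
    ultimately show ?thesis by simp
  qed
  have P: "(\<Prod>b\<in>preimage_simple (twist w) - ?D. 1 / (?y b - 1)) = (\<Prod>b\<in>preimage_simple w - ?D. 1 / (?x b - 1))"
  proof -
    have "(\<lambda>b. - v b) ` (preimage_simple (twist w) - ?D) = preimage_simple w - ?D"
      by (rule minus_v_image)
         (auto simp: in_preimage_simple_iff[OF w] in_preimage_simple_iff[OF twist_weyl[OF w]] ht_twist
            weyl_minus[OF w] ht_minus in_parabolic_minus_v uminus_root v_root)
    then show ?thesis unfolding affine_point_reflected_coroot using prod_minus_v[of "\<lambda>b. 1 / (?x b - 1)"] by metis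
  qed
  have X0: "(\<Prod>b\<in>?J \<inter> level0 - ?D. xi (?y b)) = (\<Prod>b\<in>?I \<inter> level0 - ?D. xi (?x b))"
  proof -
    have "(\<lambda>b. - v b) ` (?J \<inter> level0 - ?D) = ?I \<inter> level0 - ?D"
      by (rule minus_v_image)
         (auto simp: level0_def in_inversions_iff[OF w] in_inversions_iff[OF twist_weyl[OF w]] ht_twist
        weyl_minus[OF w] ht_minus v_ht v_level uminus_root v_root in_parabolic_minus_v)
    then show ?thesis unfolding affine_point_reflected_coroot using prod_minus_v[of "\<lambda>b. xi (?x b)"] by metis
  qed
  have Y0: "(\<Prod>b\<in>?J \<inter> level0. 1 / xi (?y b + 1)) = (\<Prod>b\<in>?I \<inter> level0. 1 / xi (?x b + 1))"
    unfolding affine_point_reflected_coroot using prod_minus_v[of "\<lambda>b. 1 / xi (?x b + 1)"] inversions_twist_level0[OF w] by metis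
  have split: "(\<Prod>b\<in>inversions \<Phi> \<alpha> u - ?D. f b) = (\<Prod>b\<in>inversions \<Phi> \<alpha> u \<inter> level0 - ?D. f b) * (\<Prod>b\<in>inversions \<Phi> \<alpha> u \<inter> upper. f b)"
    for u and f :: "'v \<Rightarrow> complex"
  proof -
    have "inversions \<Phi> \<alpha> u - ?D = (inversions \<Phi> \<alpha> u \<inter> level0 - ?D) \<union> (inversions \<Phi> \<alpha> u \<inter> upper)"
      using inversions_level(1)[of u] parabolic_level0 by (auto simp: level0_def upper_def)
    then show ?thesis
      by (simp only:) (rule prod.union_disjoint, use finite_inversions inversions_level(2) in auto)
  qed
  note U = upper_factor_twist[OF g w, unfolded prod.distrib]
  have "residue_term p (twist w) (reflected s) (h T) =
     exp (affine_point p s (inv w T) - of_real (\<rho> \<bullet> T)) * (\<Prod>b\<in>preimage_simple w - ?D. 1 / (?x b - 1)) *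
     ((\<Prod>b\<in>?I \<inter> level0 - ?D. xi (?x b)) * (\<Prod>b\<in>?I \<inter> level0. 1 / xi (?x b + 1))) *
     ((\<Prod>b\<in>?J \<inter> upper. xi (?y b)) * (\<Prod>b\<in>?J \<inter> upper. 1 / xi (?y b + 1)))"
    unfolding residue_term_def E P split prod_inversions_level[of _ "twist w"] X0 Y0 by (simp only: mult_ac)
  also have "\<dots> = ratio s * residue_term p w s T"
    unfolding U residue_term_def split prod_inversions_level[of _ w] by (simp only: mult_ac)
  finally show ?thesis .
qed

lemma omega_GP_reflected:
  assumes g: "generic p s" "generic p (reflected s)"
  shows "omega_GP \<Phi> \<alpha> p (reflected s) (h T) = ratio s * omega_GP \<Phi> \<alpha> p s T"
proof -
  have "omega_GP \<Phi> \<alpha> p (reflected s) (h T) = (\<Sum>w\<in>admissible \<Phi> \<alpha> p. residue_term p (twist w) (reflected s) (h T))"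
    unfolding omega_GP_eq[OF g(2) p] by (rule sum.reindex_bij_betw[OF twist_bij_betw, symmetric])
  also have "\<dots> = (\<Sum>w\<in>admissible \<Phi> \<alpha> p. ratio s * residue_term p w s T)"
    by (rule sum.cong) (auto simp: admissible_def residue_term_twist[OF g(1)])
  finally show ?thesis by (simp add: omega_GP_eq[OF g(1) p] sum_distrib_left)
qed

end

section \<open>The denominators\<close>

context functional_equation
begin

lemma upper_level: "b \<in> upper \<Longrightarrow> fw p \<bullet> coroot b = real (level_nat p b) \<and> level_nat p b \<ge> 1"
  using level_nat[of b p] p by (cases "level_nat p b") (auto simp: upper_def)

lemma upper_pos: "b \<in> upper \<Longrightarrow> b \<in> pos" by (simp add: upper_def)

lemma simple_upper: "\<alpha> p \<in> upper"
  using p simple_pos by (auto simp: upper_def fw_coroot_simple)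

definition c_nat :: nat where "c_nat = nat \<lfloor>c\<rfloor>"

lemma c_eq: "c = real c_nat"
proof -
  obtain z where z: "c = of_int z" using c_parabolic_int[OF p] by (auto elim: Ints_cases)
  have "v (\<alpha> p) \<in> pos" using v_upper[OF simple_upper] by (simp add: upper_def)
  then have "ht (v (\<alpha> p)) \<ge> 1" by (rule ht_pos)
  then have "c \<ge> 0" using p by (simp add: v_ht fw_coroot_simple ht_simple)
  then show ?thesis using z by (simp add: c_nat_def)
qed

text \<open>The bound on the height is \<open>ht (v b) \<ge> 1\<close>: at level \<open>k\<close> the element \<open>v\<close> reflects the heights about
\<open>k c\<^sub>p / 2\<close>.\<close>
lemma upper_ht:
  assumes "b \<in> upper"
  shows "ht b = real (height_nat b)" "1 \<le> height_nat b" "height_nat b + 1 \<le> level_nat p b * c_nat"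
proof -
  have b: "b \<in> pos" "v b \<in> pos" using assms v_upper[OF assms] by (auto simp: upper_def)
  show h: "ht b = real (height_nat b)" "1 \<le> height_nat b" using height_nat[OF b(1)] by auto
  have "1 \<le> ht (v b)" using ht_pos[OF b(2)] .
  then have "real (height_nat b + 1) \<le> real (level_nat p b * c_nat)"
    using upper_level[OF assms] h by (simp add: v_ht c_eq mult.commute)
  then show "height_nat b + 1 \<le> level_nat p b * c_nat" by (simp only: of_nat_le_iff)
qed

definition root_count :: "nat \<Rightarrow> real \<Rightarrow> nat" where
  "root_count k y = card {b\<in>pos. fw p \<bullet> coroot b = real k \<and> ht b = y}"

definition inversion_count :: "('v \<Rightarrow> 'v) \<Rightarrow> nat \<Rightarrow> real \<Rightarrow> nat" where
  "inversion_count w k y = card {b\<in>inversions \<Phi> \<alpha> w. fw p \<bullet> coroot b = real k \<and> ht b = y}"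

lemma xi_exponent_eq:
  assumes "k \<ge> 1"
  shows "xi_exponent \<Phi> \<alpha> p w k m = int (inversion_count w k (real m)) - int (inversion_count w k (real m - 1))"
proof -
  have "{a \<in> inversions \<Phi> \<alpha> w - parabolic_simple_roots \<alpha> p. fw p \<bullet> coroot a = real k \<and> ht a = real m}
     = {a \<in> inversions \<Phi> \<alpha> w. fw p \<bullet> coroot a = real k \<and> ht a = real m}"
    using parabolic_level0 assms by (auto simp: level0_def)
  then show ?thesis by (simp only: xi_exponent_def inversion_count_def)
qed

text \<open>The map \<open>v\<close> sends the inversions of the twist to the non-inversions of \<open>w\<close>, of the same level and
of reflected height.\<close>
lemma inversion_count_twist:
  assumes k: "k \<ge> 1" and w: "w \<in> weyl_group \<Phi>"
  shows "inversion_count (twist w) k y + inversion_count w k (real k * c - y) = root_count k (real k * c - y)"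
proof -
  let ?L = "\<lambda>A y. {b\<in>A. fw p \<bullet> coroot b = real k \<and> ht b = y}"
  have in_upper: "b \<in> upper" if "b \<in> pos" "fw p \<bullet> coroot b = real k" for b
    using that k by (simp add: upper_def)
  have up: "?L A z = ?L (A \<inter> upper) z" if "A \<subseteq> pos" for A z
    using that in_upper by blast
  have sub: "inversions \<Phi> \<alpha> u \<subseteq> pos" for u using inversionsD by blast
  have "(fw p \<bullet> coroot (v b) = real k \<and> ht (v b) = real k * c - y) = (fw p \<bullet> coroot b = real k \<and> ht b = y)" for b
    unfolding v_level v_ht mult.commute[of c] by (rule conj_cong[OF HOL.refl]) simp
  then have "?L (v ` A) (real k * c - y) = v ` ?L A y" for A
    unfolding Compr_image_eq by simp
  then have "v ` ?L (inversions \<Phi> \<alpha> (twist w) \<inter> upper) y = ?L (v ` (inversions \<Phi> \<alpha> (twist w) \<inter> upper)) (real k * c - y)"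
    by blast
  then have e: "?L (upper - inversions \<Phi> \<alpha> w) (real k * c - y) = v ` ?L (inversions \<Phi> \<alpha> (twist w)) y"
    by (subst up[OF sub, of "twist w"]) (simp only: inversions_twist_upper[OF w])
  have "inversion_count (twist w) k y = card (?L (upper - inversions \<Phi> \<alpha> w) (real k * c - y))"
    unfolding inversion_count_def e by (rule card_image[OF inj_on_subset[OF v_inj subset_UNIV], symmetric])
  moreover have "?L pos z = ?L (upper - inversions \<Phi> \<alpha> w) z \<union> ?L (inversions \<Phi> \<alpha> w) z" for z
    using sub[of w] in_upper upper_pos by blast
  then have "root_count k z = card (?L (upper - inversions \<Phi> \<alpha> w) z) + inversion_count w k z" for z
    unfolding root_count_def inversion_count_def
    using finite_upper finite_inversions[of w] by (subst card_Un_disjoint[symmetric]) auto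
  ultimately show ?thesis by simp
qed

lemma xi_exponent_twist:
  assumes k: "k \<ge> 1" and m: "1 \<le> m" "m \<le> k * c_nat" and w: "w \<in> weyl_group \<Phi>"
  shows "xi_exponent \<Phi> \<alpha> p (twist w) k (k * c_nat + 1 - m) =
     xi_exponent \<Phi> \<alpha> p w k m + int (root_count k (real m - 1)) - int (root_count k (real m))"
proof -
  have r: "real (k * c_nat + 1 - m) = real k * c + 1 - real m" using m by (simp add: c_eq of_nat_diff)
  have "real k * c - (real k * c + 1 - real m) = real m - 1" "real k * c - (real k * c + 1 - real m - 1) = real m" by simp_all
  then show ?thesis
    using inversion_count_twist[OF k w, of "real k * c + 1 - real m"] inversion_count_twist[OF k w, of "real k * c + 1 - real m - 1"]
    unfolding xi_exponent_eq[OF k] r by simp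
qed

text \<open>The exponents of all admissible elements are shifted by the same amount, hence so is their
maximum.\<close>
lemma xi_multiplicity_reflected:
  assumes k: "k \<ge> 1" and m: "1 \<le> m" "m \<le> k * c_nat"
  shows "xi_multiplicity \<Phi> \<alpha> p k (k * c_nat + 1 - m) + root_count k (real m - 1) =
         xi_multiplicity \<Phi> \<alpha> p k m + root_count k (real m)"
proof -
  let ?A = "admissible \<Phi> \<alpha> p" and ?m' = "k * c_nat + 1 - m"
  define d where "d = int (root_count k (real m)) - int (root_count k (real m - 1))"
  have "(\<lambda>w. - xi_exponent \<Phi> \<alpha> p w k ?m') ` ?A = (\<lambda>w. - xi_exponent \<Phi> \<alpha> p (twist w) k ?m') ` ?A"
    by (subst (1) bij_betw_imp_surj_on[OF twist_bij_betw, symmetric]) (simp only: image_image)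
  also have "\<dots> = (\<lambda>w. - xi_exponent \<Phi> \<alpha> p w k m + d) ` ?A"
    by (rule image_cong) (auto simp: xi_exponent_twist[OF k m] admissible_def d_def)
  finally have "int (xi_multiplicity \<Phi> \<alpha> p k ?m') = Max ((\<lambda>w. - xi_exponent \<Phi> \<alpha> p w k m + d) ` ?A)"
    by (simp only: xi_multiplicity_eq_Max)
  also have "\<dots> = int (xi_multiplicity \<Phi> \<alpha> p k m) + d"
    unfolding xi_multiplicity_eq_Max using finite_admissible identity_admissible by (intro Max_add_commute) auto
  finally show ?thesis unfolding d_def by linarith
qed

text \<open>All pairs \<open>(k, m)\<close>, \<open>k \<ge> 1\<close>, that can occur as level and height, or as level and height plus 1; the
set is stable under \<open>m \<mapsto> k c\<^sub>p + 1 - m\<close>.\<close>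
definition critical_pairs :: "(nat \<times> nat) set" where
  "critical_pairs = (SIGMA k : level_nat p ` upper. {1..k * c_nat})"

lemma finite_critical_pairs: "finite critical_pairs"
  using finite_upper by (auto simp: critical_pairs_def)

lemma critical_pairsD: "(k, m) \<in> critical_pairs \<Longrightarrow> k \<ge> 1 \<and> 1 \<le> m \<and> m \<le> k * c_nat"
  using upper_level by (auto simp: critical_pairs_def)

definition denominator :: "complex \<Rightarrow> complex" where
  "denominator s = (\<Prod>(k, m) \<in> {(k, m). m \<ge> 1 \<and> xi_multiplicity \<Phi> \<alpha> p k m \<noteq> 0}.
        xi (of_nat k * s + of_nat m) ^ xi_multiplicity \<Phi> \<alpha> p k m)"

text \<open>A factor \<open>\<xi>(k s + m)\<close> in a denominator comes from a root of level \<open>k\<close> and height \<open>m - 1\<close>; for \<open>k \<ge> 1\<close>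
this forces \<open>m \<le> k c\<^sub>p\<close>.\<close>
lemma multiplicity_support:
  assumes "xi_multiplicity \<Phi> \<alpha> p k m \<noteq> 0"
  shows "(k, m) \<in> (\<lambda>b. (level_nat p b, height_nat b + 1)) ` pos" "k \<ge> 1 \<Longrightarrow> (k, m) \<in> critical_pairs"
proof -
  obtain b where b: "b \<in> pos" "fw p \<bullet> coroot b = real k" "ht b = real m - 1"
    using xi_multiplicity_nonzeroD[OF assms] by blast
  have e: "level_nat p b = k" "height_nat b + 1 = m"
    using level_nat[OF b(1) p] height_nat[OF b(1)] b by auto
  then show "(k, m) \<in> (\<lambda>b. (level_nat p b, height_nat b + 1)) ` pos" using b(1) by force
  assume "k \<ge> 1"
  then have u: "b \<in> upper" using b by (auto simp: upper_def)
  then show "(k, m) \<in> critical_pairs" using e upper_ht[OF u] by (auto simp: critical_pairs_def)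
qed

text \<open>The factors of level 0 do not depend on \<open>s\<close>.\<close>
lemma denominator_split:
  "\<exists>D0. \<forall>s. denominator s = D0 * (\<Prod>(k, m)\<in>critical_pairs. xi (of_nat k * s + of_nat m) ^ xi_multiplicity \<Phi> \<alpha> p k m)"
proof -
  let ?m = "xi_multiplicity \<Phi> \<alpha> p"
  let ?M = "{(k, m). m \<ge> 1 \<and> ?m k m \<noteq> 0}" and ?K = "{(k, m). k \<noteq> (0::nat)}"
  let ?f = "\<lambda>s (k, m). xi (of_nat k * s + of_nat m) ^ ?m k m"
  have fin: "finite ?M"
    by (rule finite_subset[of _ "(\<lambda>b. (level_nat p b, height_nat b + 1)) ` pos"])
       (use multiplicity_support(1) finite_pos in auto)
  have "denominator s = (\<Prod>(k, m)\<in>?M - ?K. xi (of_nat m) ^ ?m k m) * (\<Prod>x\<in>critical_pairs. ?f s x)" for s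
  proof -
    have "denominator s = (\<Prod>x\<in>?M \<inter> ?K. ?f s x) * (\<Prod>x\<in>?M - ?K. ?f s x)"
      unfolding denominator_def by (rule prod.Int_Diff[OF fin])
    also have "(\<Prod>x\<in>?M - ?K. ?f s x) = (\<Prod>(k, m)\<in>?M - ?K. xi (of_nat m) ^ ?m k m)"
      by (rule prod.cong) auto
    also have "(\<Prod>x\<in>?M \<inter> ?K. ?f s x) = (\<Prod>x\<in>critical_pairs. ?f s x)"
      by (rule prod.mono_neutral_left[OF finite_critical_pairs])
         (use multiplicity_support(2) critical_pairsD in \<open>force+\<close>)
    finally show ?thesis by (simp only: mult.commute)
  qed
  then show ?thesis by blast
qed

definition symmetric_point :: "complex \<Rightarrow> bool" where
  "symmetric_point s \<longleftrightarrow> (\<forall>(k, m)\<in>critical_pairs. xi (of_nat k * s + of_nat m) = xi (1 - (of_nat k * s + of_nat m)))"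

lemma symmetric_point_cosparse: "\<forall>\<^sub>\<approx>s\<in>UNIV. symmetric_point s"
proof -
  have "\<forall>\<^sub>\<approx>s\<in>UNIV. xi (of_nat k * s + of_nat m) = xi (1 - (of_nat k * s + of_nat m))" if "(k, m) \<in> critical_pairs" for k m
    using eventually_cosparse_affine[OF xi_one_minus, of "of_nat k" "of_nat m"] critical_pairsD[OF that]
    by (simp add: add.commute mult.commute)
  then show ?thesis unfolding symmetric_point_def case_prod_beta
    using finite_critical_pairs by (intro eventually_ball_finite) auto
qed

text \<open>The roots are grouped by level and height; the shift \<open>i = 1\<close> is for the factors \<open>\<xi>(\<dots> + 1)\<close>.\<close>
lemma prod_upper_critical:
  fixes f :: "nat \<Rightarrow> nat \<Rightarrow> complex"
  assumes "i \<le> 1"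
  shows "(\<Prod>b\<in>upper. f (level_nat p b) (height_nat b + i)) = (\<Prod>(k, m)\<in>critical_pairs. f k m ^ root_count k (real m - real i))"
proof -
  let ?g = "\<lambda>b. (level_nat p b, height_nat b + i)"
  have img: "?g ` upper \<subseteq> critical_pairs"
    using upper_ht(2,3) assms by (fastforce simp: critical_pairs_def)
  have "(\<Prod>b\<in>upper. f (level_nat p b) (height_nat b + i)) =
     (\<Prod>x\<in>critical_pairs. \<Prod>b\<in>{b\<in>upper. ?g b = x}. f (level_nat p b) (height_nat b + i))"
    by (rule prod.group[OF finite_upper finite_critical_pairs img, symmetric])
  also have "\<dots> = (\<Prod>(k, m)\<in>critical_pairs. f k m ^ root_count k (real m - real i))"
  proof (rule prod.cong)
    fix x assume x: "x \<in> critical_pairs"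
    obtain k m where km: "x = (k, m)" by force
    have k: "k \<ge> 1" using x critical_pairsD km by blast
    have "{b\<in>upper. ?g b = x} = {b\<in>pos. fw p \<bullet> coroot b = real k \<and> ht b = real m - real i}"
    proof (intro equalityI subsetI)
      fix b assume "b \<in> {b\<in>upper. ?g b = x}"
      then have b: "b \<in> upper" "level_nat p b = k" "height_nat b + i = m" by (auto simp: km)
      then have "b \<in> pos" "fw p \<bullet> coroot b = real k" "ht b = real m - real i"
        using upper_level[OF b(1)] upper_ht(1)[OF b(1)] by (auto simp: upper_def)
      then show "b \<in> {b\<in>pos. fw p \<bullet> coroot b = real k \<and> ht b = real m - real i}" by simp
    next
      fix b assume "b \<in> {b\<in>pos. fw p \<bullet> coroot b = real k \<and> ht b = real m - real i}"
      then have b: "b \<in> pos" "fw p \<bullet> coroot b = real k" "ht b = real m - real i" by auto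
      then have u: "b \<in> upper" using k by (auto simp: upper_def)
      have "level_nat p b = k" using upper_level[OF u] b(2) by simp
      moreover have "real (height_nat b + i) = real m" using upper_ht(1)[OF u] b(3) by simp
      then have "height_nat b + i = m" by (simp only: of_nat_eq_iff)
      ultimately show "b \<in> {b\<in>upper. ?g b = x}" using u km by simp
    qed
    then have "card {b\<in>upper. ?g b = x} = root_count k (real m - real i)" by (simp only: root_count_def)
    moreover have "(\<Prod>b\<in>{b\<in>upper. ?g b = x}. f (level_nat p b) (height_nat b + i)) = (\<Prod>b\<in>{b\<in>upper. ?g b = x}. f k m)"
      by (rule prod.cong) (auto simp: km)
    ultimately show "(\<Prod>b\<in>{b\<in>upper. ?g b = x}. f (level_nat p b) (height_nat b + i)) =
        (case x of (k, m) \<Rightarrow> f k m ^ root_count k (real m - real i))" by (simp add: km)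
  qed simp
  finally show ?thesis .
qed

lemma affine_point_upper:
  assumes "b \<in> upper"
  shows "affine_point p s (coroot b) = of_nat (level_nat p b) * s + of_nat (height_nat b)"
proof -
  have "\<rho> \<bullet> coroot b = real (height_nat b)" using upper_ht(1)[OF assms] by (simp add: coroot_height_def)
  then show ?thesis using upper_level[OF assms] by (simp add: affine_point_def)
qed

text \<open>The substitution \<open>s \<mapsto> s'\<close> and \<open>\<xi>(z) = \<xi>(1 - z)\<close> move the factor at \<open>(k, m)\<close> to
\<open>(k, k c\<^sub>p + 1 - m)\<close>; the resulting change of multiplicity is compensated by \<open>ratio s\<close>.\<close>
lemma denominator_reflected:
  assumes g: "generic p s" and sym: "symmetric_point s"
  shows "denominator (reflected s) * ratio s = denominator s"
proof -
  let ?m = "xi_multiplicity \<Phi> \<alpha> p"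
  let ?x = "\<lambda>k m. xi (of_nat k * s + of_nat m)"
  define X where "X = (\<Prod>b\<in>upper. xi (affine_point p s (coroot b)))"
  define Y where "Y = (\<Prod>b\<in>upper. xi (affine_point p s (coroot b) + 1))"
  define D where "D = (\<lambda>s. \<Prod>(k, m)\<in>critical_pairs. xi (of_nat k * s + of_nat m) ^ ?m k m)"
  have X: "X = (\<Prod>(k, m)\<in>critical_pairs. ?x k m ^ root_count k (real m))"
    using prod_upper_critical[of 0 ?x] by (simp add: X_def affine_point_upper)
  have Y: "Y = (\<Prod>(k, m)\<in>critical_pairs. ?x k m ^ root_count k (real m - 1))"
    using prod_upper_critical[of 1 ?x] by (simp add: Y_def affine_point_upper add.assoc)
  have X0: "X \<noteq> 0" unfolding X_def using generic_upper(1)[OF g] finite_upper by (simp add: prod_zero_iff)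
  have ratio: "ratio s = Y / X" unfolding ratio_def X_def Y_def by (rule prod_dividef)
  have involution: "(k, k * c_nat + 1 - m) \<in> critical_pairs \<and> k * c_nat + 1 - (k * c_nat + 1 - m) = m" if "(k, m) \<in> critical_pairs" for k m
    using that by (auto simp: critical_pairs_def)
  have "D (reflected s) = (\<Prod>(k, m)\<in>critical_pairs. ?x k (k * c_nat + 1 - m) ^ ?m k m)"
    unfolding D_def
  proof (rule prod.cong[OF HOL.refl], clarify)
    fix k m assume km: "(k, m) \<in> critical_pairs"
    have "m \<le> k * c_nat + 1" using critical_pairsD[OF km] by simp
    then have "of_nat k * reflected s + of_nat m = 1 - (of_nat k * s + of_nat (k * c_nat + 1 - m))"
      by (simp add: c_eq of_nat_diff algebra_simps)
    moreover have "?x k (k * c_nat + 1 - m) = xi (1 - (of_nat k * s + of_nat (k * c_nat + 1 - m)))"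
      using sym involution[OF km] unfolding symmetric_point_def by blast
    ultimately show "xi (of_nat k * reflected s + of_nat m) ^ ?m k m = ?x k (k * c_nat + 1 - m) ^ ?m k m" by simp
  qed
  also have "\<dots> = (\<Prod>(k, m)\<in>critical_pairs. ?x k m ^ ?m k (k * c_nat + 1 - m))"
    by (rule prod.reindex_bij_witness[of _ "\<lambda>(k, m). (k, k * c_nat + 1 - m)" "\<lambda>(k, m). (k, k * c_nat + 1 - m)"])
       (use involution in auto)
  finally have "D (reflected s) * Y = (\<Prod>(k, m)\<in>critical_pairs. ?x k m ^ (?m k (k * c_nat + 1 - m) + root_count k (real m - 1)))"
    unfolding Y by (simp add: prod.distrib[symmetric] case_prod_beta power_add)
  also have "\<dots> = (\<Prod>(k, m)\<in>critical_pairs. ?x k m ^ (?m k m + root_count k (real m)))"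
  proof (intro prod.cong[OF HOL.refl], clarify)
    fix k m assume "(k, m) \<in> critical_pairs"
    then show "?x k m ^ (?m k (k * c_nat + 1 - m) + root_count k (real m - 1)) = ?x k m ^ (?m k m + root_count k (real m))"
      using xi_multiplicity_reflected[of k m] critical_pairsD by metis
  qed
  also have "\<dots> = D s * X"
    unfolding X D_def by (simp add: prod.distrib[symmetric] case_prod_beta power_add)
  finally have DD: "D (reflected s) * ratio s = D s" using X0 by (simp add: ratio field_simps)
  obtain D0 where "\<And>s. denominator s = D0 * D s" using denominator_split unfolding D_def by blast
  then show ?thesis using DD by (simp add: mult.assoc)
qed

lemma xi_GP_reflected:
  "meromorphic_eq (\<lambda>s. xi_GP \<Phi> \<alpha> p (reflected s) (h T)) (\<lambda>s. xi_GP \<Phi> \<alpha> p s T)"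
  unfolding meromorphic_eq_def
proof (intro conjI)
  show "(\<lambda>s. xi_GP \<Phi> \<alpha> p s T) meromorphic_on UNIV" by (rule xi_GP_meromorphic[OF p])
  show "(\<lambda>s. xi_GP \<Phi> \<alpha> p (reflected s) (h T)) meromorphic_on UNIV"
    by (rule meromorphic_on_compose[OF xi_GP_meromorphic[OF p]]) (auto intro!: analytic_intros)
  have "\<forall>\<^sub>\<approx>s\<in>UNIV. generic p (reflected s)"
    using eventually_cosparse_affine[OF generic_cosparse[of p], of "-1" "- of_real c"] by simp
  then show "\<forall>\<^sub>\<approx>s\<in>UNIV. xi_GP \<Phi> \<alpha> p (reflected s) (h T) = xi_GP \<Phi> \<alpha> p s T"
    using generic_cosparse[of p] symmetric_point_cosparse
  proof eventually_elim
    case (elim s)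
    have "xi_GP \<Phi> \<alpha> p u x = omega_GP \<Phi> \<alpha> p u x * denominator u" for u x
      by (simp only: xi_GP_def denominator_def)
    then show ?case using omega_GP_reflected[OF elim(2,1), of T] denominator_reflected[OF elim(2,3)]
      by (simp add: mult_ac)
  qed
qed

end

theorem theorem2p4:
  fixes \<Phi> :: "'v::euclidean_space set" and \<alpha> :: "nat \<Rightarrow> 'v"
    and w0 :: "'v \<Rightarrow> 'v" and \<pi>0 \<sigma> :: "nat \<Rightarrow> nat" and p q :: nat and T :: 'v
  assumes "root_system \<Phi>"
    and "fundamental_system \<Phi> \<alpha>"
    and "longest_element \<Phi> \<alpha> w0"
    and "\<pi>0 \<in> diagram_auts \<alpha>"
    and "\<forall>v. - v = diagram_action \<alpha> \<pi>0 (w0 v)"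
    and "p \<in> {1..DIM('v)}"
    and "\<sigma> \<in> diagram_auts \<alpha>"
    and "\<forall>x y. diagram_action \<alpha> \<sigma> x \<bullet> diagram_action \<alpha> \<sigma> y = x \<bullet> y"
    and "q = \<sigma> p"
  shows "meromorphic_eq
           (\<lambda>s. xi_GP \<Phi> \<alpha> p (- of_real (c_parabolic \<Phi> \<alpha> p) - s) (diagram_action \<alpha> \<pi>0 T))
           (\<lambda>s. xi_GP \<Phi> \<alpha> p s T)
         \<and> meromorphic_eq
           (\<lambda>s. xi_GP \<Phi> \<alpha> p s T)
           (\<lambda>s. xi_GP \<Phi> \<alpha> q s (diagram_action \<alpha> \<sigma> T))"
proof
  interpret based_root_system \<Phi> \<alpha> by unfold_locales (fact assms(1), fact assms(2))
  interpret \<sigma>: diagram_isometry \<Phi> \<alpha> \<sigma> "diagram_action \<alpha> \<sigma>"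
    by (intro diagram_isometry.intro diagram_isometry_axioms.intro based_root_system_axioms
          linear_diagram_action diagram_action_simple)
       (use assms(7,8) in \<open>auto simp: diagram_auts_def\<close>)
  show "meromorphic_eq (\<lambda>s. xi_GP \<Phi> \<alpha> p s T) (\<lambda>s. xi_GP \<Phi> \<alpha> q s (diagram_action \<alpha> \<sigma> T))"
    unfolding assms(9) by (rule \<sigma>.xi_GP_diagram_isometry[OF assms(6)])
  let ?h = "diagram_action \<alpha> \<pi>0"
  have w0: "w0 \<in> weyl_group \<Phi>" using assms(3) by (simp add: longest_element_def)
  \<comment> \<open>The action of \<open>\<pi>0\<close> is \<open>- w\<^sub>0\<^sup>-\<^sup>1\<close>; in particular it is an isometry.\<close>
  have "- ?h x = inv w0 x" for x
  proof -
    have "?h x = ?h (w0 (inv w0 x))" by (simp add: weyl_inv(3)[OF w0])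
    also have "\<dots> = - inv w0 x" using assms(5) by metis
    finally show ?thesis by simp
  qed
  then have inv_w0: "(\<lambda>x. - ?h x) = inv w0" by auto
  have iso: "?h x \<bullet> ?h y = x \<bullet> y" for x y
    using weyl_isometry(2)[OF weyl_inv(1)[OF w0], of x y] by (simp flip: inv_w0)
  interpret \<pi>0: diagram_isometry \<Phi> \<alpha> \<pi>0 ?h
    by (intro diagram_isometry.intro diagram_isometry_axioms.intro based_root_system_axioms
          linear_diagram_action diagram_action_simple iso)
       (use assms(4) in \<open>auto simp: diagram_auts_def\<close>)
  obtain v where v: "v \<in> weyl_group \<Phi>" "v (fundamental_weight \<alpha> p) = fundamental_weight \<alpha> p"
    "v (rho \<Phi> \<alpha>) = c_parabolic \<Phi> \<alpha> p *\<^sub>R fundamental_weight \<alpha> p - rho \<Phi> \<alpha>"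
    "\<And>b. coroot_height \<Phi> \<alpha> (v b) = c_parabolic \<Phi> \<alpha> p * (fundamental_weight \<alpha> p \<bullet> coroot b) - coroot_height \<Phi> \<alpha> b"
    using parabolic_longest[OF assms(6)] by blast
  interpret fe: functional_equation \<Phi> \<alpha> \<pi>0 ?h p v
    by (intro functional_equation.intro functional_equation_axioms.intro \<pi>0.diagram_isometry_axioms assms(6) v)
       (use weyl_inv(1)[OF w0] in \<open>simp add: inv_w0\<close>)
  show "meromorphic_eq
           (\<lambda>s. xi_GP \<Phi> \<alpha> p (- of_real (c_parabolic \<Phi> \<alpha> p) - s) (diagram_action \<alpha> \<pi>0 T))
           (\<lambda>s. xi_GP \<Phi> \<alpha> p s T)"
    by (rule fe.xi_GP_reflected)
qed

end
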